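(* There exist $\mu>0$ (sufficiently large), $\delta_0>0$ and $C>0$, independent of $k$, such that for every time mesh with $k-k_{\min}\le\delta_0$ the following holds. Let $1\le p<\infty$, $f\in L^p(I;L^2(\Omega))$, $u_0=0$, and let $u_k\in X_k^0$ be the dG(0) semidiscrete solution with data $f$ and $u_0=0$. Then $$\left[\sum_{m=1}^M\left(\|A_{k,m}u_{k,m}\|^p_{L^p(I_m;L^2(\Omega))}+k_m\left\|\frac{[u_k]_{m-1}}{k_m}\right\|^p_{L^2(\Omega)}\right)\right]^{\frac1p}\le Ce^{\mu T}\ln\frac{T}{k}\,\|f\|_{L^p(I;L^2(\Omega))}.$$
   Context: Problem data. $\Omega\subset\mathbb R^d$, $d\ge1$, is a bounded Lipschitz domain, $T>0$, $I=(0,T)$. The coefficients $a_{ij}\in L^\infty(I\times\Omega)$ ($1\le i,j\le d$) satisfy $a_{ij}=a_{ji}$ and $\sum_{i,j}a_{ij}(t,x)\xi_i\xi_j\ge\alpha|\xi|^2$ for all $\xi\in\mathbb R^d$ and a.e. $(t,x)$, with a constant $\alpha>0$; they are continuous in $t$ on $\bar I$ for almost all $x$, and $|a_{ij}(t_1,x)-a_{ij}(t_2,x)|\le\omega(|t_1-t_2|)$ for all $t_1,t_2\in\bar I$ and almost all $x\in\Omega$, where $\omega:[0,T]\to[0,\infty)$ is nondecreasing, $\omega(t)/t^{3/2}$ is non-increasing on $(0,T]$, and $\int_0^T\omega(t)t^{-3/2}\,dt<\infty$. For $u,v\in H^1_0(\Omega)$ set $a(t;u,v)=\int_\Omega\sum_{i,j}a_{ij}(t,x)\partial_iu\,\partial_jv\,dx$,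 and let $A(t):H^1_0(\Omega)\to H^{-1}(\Omega)$ be given by $\langle A(t)u,v\rangle=a(t;u,v)$. Time meshes. $0=t_0<t_1<\dots<t_M=T$, $I_m=(t_{m-1},t_m]$, $k_m=t_m-t_{m-1}$, $k=\max_mk_m$, $k_{\min}=\min_mk_m$. All meshes satisfy, with fixed constants $c,\beta,\kappa>0$: (i) $k_{\min}\ge ck^\beta$; (ii) $\kappa^{-1}\le k_m/k_{m+1}\le\kappa$ for $1\le m\le M-1$; (iii) $k\le T/4$. Discretization. $X_k^0$ is the space of functions $v_k\in L^2(I;H^1_0(\Omega))$ that are constant in time on each $I_m$; $v_{k,m}:=v_k|_{I_m}$. $A_{k,m}=\frac1{k_m}\int_{I_m}A(t)\,dt:H^1_0(\Omega)\to H^{-1}(\Omega)$. The dG(0) semidiscrete solution $u_k\in X_k^0$ with data $f,u_0$ is defined by $$\int_Ia(t;u_k,\varphi_k)\,dt+\sum_{m=2}^M(u_{k,m}-u_{k,m-1},\varphi_{k,m})_\Omega+(u_{k,1},\varphi_{k,1})_\Omega=\int_I(f,\varphi_k)_\Omega\,dt+(u_0,\varphi_{k,1})_\Omega\quad\forall\varphi_k\in X_k^0 .$$ Jumps: $[u_k]_m=u_{k,m+1}-u_{k,m}$ for $1\le m\le M-1$, and $[u_k]_0=u_{k,1}-u_0$. "Independent of $k$" means: depending only on $\Omega,d,T$, the coefficients $a_{ij}$ (including $\alpha,\omega$) and $c,\beta,\kappa$, and not otherwise on the time mesh, nor on $f$. *)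

theory Defs
  imports "HOL-Analysis.Analysis"
begin

text \<open>Elements of \<open>L\<^sup>2(\<Omega>)\<close> and of the Sobolev spaces are represented by functions on the whole of
  \<open>real ^ 'n\<close>; only their values on \<open>\<Omega>\<close> matter, and only up to null sets.\<close>

text \<open>Near every boundary point, after a rigid motion taking the unit vector \<open>e\<close> to the last
  coordinate axis, \<open>\<Omega>\<close> is the strict epigraph of a Lipschitz function \<open>\<gamma>\<close> of the remaining
  coordinates; \<open>y - (y \<bullet> e) *\<^sub>R e\<close> is the projection of \<open>y\<close> to the hyperplane orthogonal to \<open>e\<close>.\<close>

definition bounded_lipschitz_domain :: "(real ^ 'n) set \<Rightarrow> bool" where
  "bounded_lipschitz_domain \<Omega> \<longleftrightarrow>
     open \<Omega> \<and> connected \<Omega> \<and> \<Omega> \<noteq> {} \<and> bounded \<Omega> \<and>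
     (\<forall>x \<in> frontier \<Omega>. \<exists>r>0. \<exists>e \<gamma> L. norm e = 1 \<and> L-lipschitz_on {z. z \<bullet> e = 0} \<gamma> \<and>
        \<Omega> \<inter> ball x r = {y \<in> ball x r. y \<bullet> e > \<gamma> (y - (y \<bullet> e) *\<^sub>R e)})"

definition L2 :: "(real ^ 'n) set \<Rightarrow> (real ^ 'n \<Rightarrow> real) set" where
  "L2 \<Omega> = {u. u \<in> borel_measurable (lebesgue_on \<Omega>) \<and> integrable (lebesgue_on \<Omega>) (\<lambda>x. (u x)\<^sup>2)}"

definition L2_inner :: "(real ^ 'n) set \<Rightarrow> (real ^ 'n \<Rightarrow> real) \<Rightarrow> (real ^ 'n \<Rightarrow> real) \<Rightarrow> real" where
  "L2_inner \<Omega> u v = (\<integral>x. u x * v x \<partial>lebesgue_on \<Omega>)"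

definition L2_norm :: "(real ^ 'n) set \<Rightarrow> (real ^ 'n \<Rightarrow> real) \<Rightarrow> real" where
  "L2_norm \<Omega> u = sqrt (L2_inner \<Omega> u u)"

definition partial :: "'n \<Rightarrow> (real ^ 'n \<Rightarrow> real) \<Rightarrow> real ^ 'n \<Rightarrow> real" where
  "partial i f x = frechet_derivative f (at x) (axis i 1)"

primrec C_times :: "nat \<Rightarrow> (real ^ 'n \<Rightarrow> real) \<Rightarrow> bool" where
  "C_times 0 f \<longleftrightarrow> continuous_on UNIV f"
| "C_times (Suc k) f \<longleftrightarrow> f differentiable_on UNIV \<and> (\<forall>i. C_times k (partial i f))"

definition test_functions :: "(real ^ 'n) set \<Rightarrow> (real ^ 'n \<Rightarrow> real) set" where
  "test_functions \<Omega> = {\<phi>. (\<forall>k. C_times k \<phi>) \<and> compact (closure {x. \<phi> x \<noteq> 0}) \<and>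
     closure {x. \<phi> x \<noteq> 0} \<subseteq> \<Omega>}"

definition is_weak_partial ::
    "(real ^ 'n) set \<Rightarrow> 'n \<Rightarrow> (real ^ 'n \<Rightarrow> real) \<Rightarrow> (real ^ 'n \<Rightarrow> real) \<Rightarrow> bool" where
  "is_weak_partial \<Omega> i u g \<longleftrightarrow>
     (\<forall>\<phi> \<in> test_functions \<Omega>. L2_inner \<Omega> u (partial i \<phi>) = - L2_inner \<Omega> g \<phi>)"

definition H1 :: "(real ^ 'n) set \<Rightarrow> (real ^ 'n \<Rightarrow> real) set" where
  "H1 \<Omega> = {u \<in> L2 \<Omega>. \<forall>i. \<exists>g \<in> L2 \<Omega>. is_weak_partial \<Omega> i u g}"

text \<open>For \<open>u \<in> H1 \<Omega>\<close> the chosen weak derivative is unique up to null sets.\<close>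

definition weak_partial :: "(real ^ 'n) set \<Rightarrow> 'n \<Rightarrow> (real ^ 'n \<Rightarrow> real) \<Rightarrow> real ^ 'n \<Rightarrow> real" where
  "weak_partial \<Omega> i u = (SOME g. g \<in> L2 \<Omega> \<and> is_weak_partial \<Omega> i u g)"

definition H1_norm :: "(real ^ 'n) set \<Rightarrow> (real ^ 'n \<Rightarrow> real) \<Rightarrow> real" where
  "H1_norm \<Omega> u = sqrt ((L2_norm \<Omega> u)\<^sup>2 + (\<Sum>i\<in>UNIV. (L2_norm \<Omega> (weak_partial \<Omega> i u))\<^sup>2))"

definition H10 :: "(real ^ 'n) set \<Rightarrow> (real ^ 'n \<Rightarrow> real) set" where
  "H10 \<Omega> = {u \<in> H1 \<Omega>. \<exists>\<phi> :: nat \<Rightarrow> real ^ 'n \<Rightarrow> real. (\<forall>n. \<phi> n \<in> test_functions \<Omega>) \<and>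
     (\<lambda>n. H1_norm \<Omega> (\<lambda>x. u x - \<phi> n x)) \<longlonglongrightarrow> 0}"

text \<open>Strong measurability: almost everywhere the limit, in the norm of \<open>L\<^sup>2(\<Omega>)\<close>, of
  measurable functions with finitely many values in \<open>L\<^sup>2(\<Omega>)\<close>.\<close>

definition strongly_measurable_L2 ::
    "(real ^ 'n) set \<Rightarrow> real set \<Rightarrow> (real \<Rightarrow> real ^ 'n \<Rightarrow> real) \<Rightarrow> bool" where
  "strongly_measurable_L2 \<Omega> J f \<longleftrightarrow>
     (\<exists>s :: nat \<Rightarrow> real \<Rightarrow> real ^ 'n \<Rightarrow> real.
        (\<forall>n. finite (s n ` J) \<and> s n ` J \<subseteq> L2 \<Omega> \<and> (\<forall>g. {t \<in> J. s n t = g} \<in> sets lebesgue)) \<and>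
        (AE t in lebesgue_on J. (\<lambda>n. L2_norm \<Omega> (\<lambda>x. f t x - s n t x)) \<longlonglongrightarrow> 0))"

definition Lp_L2 ::
    "real \<Rightarrow> real set \<Rightarrow> (real ^ 'n) set \<Rightarrow> (real \<Rightarrow> real ^ 'n \<Rightarrow> real) set" where
  "Lp_L2 p J \<Omega> = {f. (AE t in lebesgue_on J. f t \<in> L2 \<Omega>) \<and> strongly_measurable_L2 \<Omega> J f \<and>
     integrable (lebesgue_on J) (\<lambda>t. L2_norm \<Omega> (f t) powr p)}"

definition Lp_L2_norm ::
    "real \<Rightarrow> real set \<Rightarrow> (real ^ 'n) set \<Rightarrow> (real \<Rightarrow> real ^ 'n \<Rightarrow> real) \<Rightarrow> real" where
  "Lp_L2_norm p J \<Omega> f = (\<integral>t. L2_norm \<Omega> (f t) powr p \<partial>lebesgue_on J) powr (1 / p)"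

definition admissible_coefficients ::
    "(real ^ 'n) set \<Rightarrow> real \<Rightarrow> ('n \<Rightarrow> 'n \<Rightarrow> real \<Rightarrow> real ^ 'n \<Rightarrow> real) \<Rightarrow> real \<Rightarrow> (real \<Rightarrow> real) \<Rightarrow> bool" where
  "admissible_coefficients \<Omega> T a \<alpha> \<omega> \<longleftrightarrow>
     (\<forall>i j. (\<lambda>(t, x). a i j t x) \<in> borel_measurable (lebesgue_on ({0<..<T} \<times> \<Omega>))) \<and>
     (\<forall>i j. \<exists>B. AE (t, x) in lebesgue_on ({0<..<T} \<times> \<Omega>). \<bar>a i j t x\<bar> \<le> B) \<and>
     (\<forall>i j. AE (t, x) in lebesgue_on ({0<..<T} \<times> \<Omega>). a i j t x = a j i t x) \<and>
     (AE (t, x) in lebesgue_on ({0<..<T} \<times> \<Omega>).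
        \<forall>\<xi> :: real ^ 'n. (\<Sum>i\<in>UNIV. \<Sum>j\<in>UNIV. a i j t x * \<xi> $ i * \<xi> $ j) \<ge> \<alpha> * (norm \<xi>)\<^sup>2) \<and>
     (\<forall>i j. AE x in lebesgue_on \<Omega>. continuous_on {0..T} (\<lambda>t. a i j t x)) \<and>
     (\<forall>i j. \<forall>t1 \<in> {0..T}. \<forall>t2 \<in> {0..T}.
        AE x in lebesgue_on \<Omega>. \<bar>a i j t1 x - a i j t2 x\<bar> \<le> \<omega> \<bar>t1 - t2\<bar>)"

definition admissible_modulus :: "real \<Rightarrow> (real \<Rightarrow> real) \<Rightarrow> bool" where
  "admissible_modulus T \<omega> \<longleftrightarrow>
     (\<forall>t \<in> {0..T}. 0 \<le> \<omega> t) \<and> mono_on {0..T} \<omega> \<and>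
     antimono_on {0<..T} (\<lambda>t. \<omega> t / t powr (3/2)) \<and>
     integrable (lebesgue_on {0<..<T}) (\<lambda>t. \<omega> t * t powr (-3/2))"

definition form_a ::
    "(real ^ 'n) set \<Rightarrow> ('n \<Rightarrow> 'n \<Rightarrow> real \<Rightarrow> real ^ 'n \<Rightarrow> real) \<Rightarrow> real \<Rightarrow>
     (real ^ 'n \<Rightarrow> real) \<Rightarrow> (real ^ 'n \<Rightarrow> real) \<Rightarrow> real" where
  "form_a \<Omega> a t u v =
     (\<integral>x. (\<Sum>i\<in>UNIV. \<Sum>j\<in>UNIV. a i j t x * weak_partial \<Omega> i u x * weak_partial \<Omega> j v x)
        \<partial>lebesgue_on \<Omega>)"

text \<open>Elements of \<open>H\<^sup>-\<^sup>1(\<Omega>)\<close> are given by their action on \<open>H10 \<Omega>\<close>.\<close>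

definition op_A ::
    "(real ^ 'n) set \<Rightarrow> ('n \<Rightarrow> 'n \<Rightarrow> real \<Rightarrow> real ^ 'n \<Rightarrow> real) \<Rightarrow> real \<Rightarrow>
     (real ^ 'n \<Rightarrow> real) \<Rightarrow> (real ^ 'n \<Rightarrow> real) \<Rightarrow> real" where
  "op_A \<Omega> a t u = (\<lambda>v. form_a \<Omega> a t u v)"

text \<open>A functional lies in \<open>L\<^sup>2(\<Omega>)\<close> if it is the \<open>L\<^sup>2\<close> pairing with some \<open>g \<in> L\<^sup>2(\<Omega>)\<close>; this
  \<open>g\<close> is then unique up to null sets.\<close>

definition represents_L2 ::
    "(real ^ 'n) set \<Rightarrow> ((real ^ 'n \<Rightarrow> real) \<Rightarrow> real) \<Rightarrow> (real ^ 'n \<Rightarrow> real) \<Rightarrow> bool" where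
  "represents_L2 \<Omega> F g \<longleftrightarrow> g \<in> L2 \<Omega> \<and> (\<forall>v \<in> H10 \<Omega>. F v = L2_inner \<Omega> g v)"

definition functional_in_L2 :: "(real ^ 'n) set \<Rightarrow> ((real ^ 'n \<Rightarrow> real) \<Rightarrow> real) \<Rightarrow> bool" where
  "functional_in_L2 \<Omega> F \<longleftrightarrow> (\<exists>g. represents_L2 \<Omega> F g)"

definition L2_rep :: "(real ^ 'n) set \<Rightarrow> ((real ^ 'n \<Rightarrow> real) \<Rightarrow> real) \<Rightarrow> real ^ 'n \<Rightarrow> real" where
  "L2_rep \<Omega> F = (SOME g. represents_L2 \<Omega> F g)"

text \<open>A mesh is a sequence \<open>\<tau>\<close> of which only \<open>\<tau> 0, \<dots>, \<tau> M\<close> are relevant.\<close>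

definition cell :: "(nat \<Rightarrow> real) \<Rightarrow> nat \<Rightarrow> real set" where
  "cell \<tau> m = {\<tau> (m - 1)<..\<tau> m}"

definition step :: "(nat \<Rightarrow> real) \<Rightarrow> nat \<Rightarrow> real" where
  "step \<tau> m = \<tau> m - \<tau> (m - 1)"

definition max_step :: "(nat \<Rightarrow> real) \<Rightarrow> nat \<Rightarrow> real" where
  "max_step \<tau> M = Max (step \<tau> ` {1..M})"

definition min_step :: "(nat \<Rightarrow> real) \<Rightarrow> nat \<Rightarrow> real" where
  "min_step \<tau> M = Min (step \<tau> ` {1..M})"

definition admissible_mesh ::
    "real \<Rightarrow> real \<Rightarrow> real \<Rightarrow> real \<Rightarrow> (nat \<Rightarrow> real) \<Rightarrow> nat \<Rightarrow> bool" where
  "admissible_mesh T c \<beta> \<kappa> \<tau> M \<longleftrightarrow>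
     \<tau> 0 = 0 \<and> \<tau> M = T \<and> (\<forall>m \<in> {1..M}. \<tau> (m - 1) < \<tau> m) \<and>
     min_step \<tau> M \<ge> c * max_step \<tau> M powr \<beta> \<and>
     (\<forall>m \<in> {1..M - 1}. 1 / \<kappa> \<le> step \<tau> m / step \<tau> (m + 1) \<and> step \<tau> m / step \<tau> (m + 1) \<le> \<kappa>) \<and>
     max_step \<tau> M \<le> T / 4"

definition X0 :: "(real ^ 'n) set \<Rightarrow> (nat \<Rightarrow> real) \<Rightarrow> nat \<Rightarrow> (real \<Rightarrow> real ^ 'n \<Rightarrow> real) set" where
  "X0 \<Omega> \<tau> M = {v. \<forall>m \<in> {1..M}. \<exists>w \<in> H10 \<Omega>. \<forall>t \<in> cell \<tau> m. v t = w}"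

text \<open>The value on the \<open>m\<close>-th cell is read off at its right end point, which belongs to it.\<close>

definition val ::
    "(nat \<Rightarrow> real) \<Rightarrow> (real \<Rightarrow> real ^ 'n \<Rightarrow> real) \<Rightarrow> nat \<Rightarrow> real ^ 'n \<Rightarrow> real" where
  "val \<tau> v m = v (\<tau> m)"

definition jump ::
    "(nat \<Rightarrow> real) \<Rightarrow> (real ^ 'n \<Rightarrow> real) \<Rightarrow> (real \<Rightarrow> real ^ 'n \<Rightarrow> real) \<Rightarrow> nat \<Rightarrow> real ^ 'n \<Rightarrow> real" where
  "jump \<tau> u0 u m =
     (if m = 0 then (\<lambda>x. val \<tau> u 1 x - u0 x) else (\<lambda>x. val \<tau> u (m + 1) x - val \<tau> u m x))"

text \<open>The average of the operators over a cell is understood weakly, i.e. after pairing with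
  \<open>u\<close> and \<open>v\<close>.\<close>

definition avg_A ::
    "(real ^ 'n) set \<Rightarrow> ('n \<Rightarrow> 'n \<Rightarrow> real \<Rightarrow> real ^ 'n \<Rightarrow> real) \<Rightarrow> (nat \<Rightarrow> real) \<Rightarrow> nat \<Rightarrow>
     (real ^ 'n \<Rightarrow> real) \<Rightarrow> (real ^ 'n \<Rightarrow> real) \<Rightarrow> real" where
  "avg_A \<Omega> a \<tau> m u = (\<lambda>v. 1 / step \<tau> m * (\<integral>t. op_A \<Omega> a t u v \<partial>lebesgue_on (cell \<tau> m)))"

definition dG0_solution ::
    "(real ^ 'n) set \<Rightarrow> real \<Rightarrow> ('n \<Rightarrow> 'n \<Rightarrow> real \<Rightarrow> real ^ 'n \<Rightarrow> real) \<Rightarrow> (nat \<Rightarrow> real) \<Rightarrow> nat \<Rightarrow>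
     (real \<Rightarrow> real ^ 'n \<Rightarrow> real) \<Rightarrow> (real ^ 'n \<Rightarrow> real) \<Rightarrow> (real \<Rightarrow> real ^ 'n \<Rightarrow> real) \<Rightarrow> bool" where
  "dG0_solution \<Omega> T a \<tau> M f u0 u \<longleftrightarrow> u \<in> X0 \<Omega> \<tau> M \<and>
     (\<forall>\<phi> \<in> X0 \<Omega> \<tau> M.
        (\<integral>t. form_a \<Omega> a t (u t) (\<phi> t) \<partial>lebesgue_on {0<..<T})
        + (\<Sum>m=2..M. L2_inner \<Omega> (\<lambda>x. val \<tau> u m x - val \<tau> u (m - 1) x) (val \<tau> \<phi> m))
        + L2_inner \<Omega> (val \<tau> u 1) (val \<tau> \<phi> 1)
        = (\<integral>t. L2_inner \<Omega> (f t) (\<phi> t) \<partial>lebesgue_on {0<..<T}) + L2_inner \<Omega> u0 (val \<tau> \<phi> 1))"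

end

theory Submission
  imports Defs "HOL-Library.Function_Algebras" "HOL-Computational_Algebra.Polynomial"
begin

text \<open>
  Testing the dG(0) equations with a function supported on one cell turns them into the implicit
  Euler scheme \<open>u\<^sub>m - u\<^sub>m\<^sub>-\<^sub>1 + k\<^sub>m A\<^sub>m u\<^sub>m = k\<^sub>m f\<^sub>m\<close>, where \<open>f\<^sub>m\<close> is the mean of \<open>f\<close> over the cell
  (\<open>dG0_cell_equations\<close>). Hence \<open>A\<^sub>m u\<^sub>m\<close> lies in \<open>L\<^sup>2\<close>, and the jumps are controlled by \<open>f\<^sub>m\<close> and
  \<open>A\<^sub>m u\<^sub>m\<close>, so everything reduces to a bound for \<open>A\<^sub>m u\<^sub>m\<close>.

  For this the operator is frozen at the last cell, as in the Acquistapace-Terreni formula: on every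
  earlier cell, \<open>u\<^sub>l - u\<^sub>l\<^sub>-\<^sub>1 + k\<^sub>l A\<^sub>m u\<^sub>l = k\<^sub>l (f\<^sub>l + (A\<^sub>m - A\<^sub>l) u\<^sub>l)\<close>. The Euler steps with the fixed operator
  \<open>A\<^sub>m\<close> smooth. With \<open>S = \<tau>\<^sub>m - \<tau>\<^sub>l\<^sub>-\<^sub>1\<close>, a right-hand side in \<open>L\<^sup>2\<close> costs a factor \<open>1/S\<close>; one that is
  bounded by the energy norm costs \<open>S powr (-3/2)\<close>, and \<open>A\<^sub>m - A\<^sub>l\<close> contributes the factor \<open>\<omega> S\<close>. In
  terms of the spectrum these are the bounds of \<open>\<lambda> / \<Prod>(1 + k\<^sub>j \<lambda>)\<close> and \<open>\<lambda> powr (3/2) / \<Prod>(1 + k\<^sub>j \<lambda>)\<close>;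
  the second one uses that neighbouring steps are comparable.

  No spectral theory enters. First, it suffices to work in the finite-dimensional span \<open>W\<close> of
  \<open>u\<^sub>1, \<dots>, u\<^sub>M\<close>: the part of \<open>A\<^sub>m u\<^sub>m\<close> orthogonal to \<open>W\<close> equals that of \<open>f\<^sub>m\<close>. Second, on \<open>W\<close> the
  smoothing bounds follow by expanding \<open>\<Prod>(1 + k\<^sub>j A)\<close>: all the moments \<open>\<langle>A\<^sup>i y, y\<rangle>\<close> are nonnegative,
  so that single terms of the expansion may be kept and the others dropped
  (\<open>implicit_Euler_smoothing\<close>). A dual chain of Euler steps transfers them to the solution
  (\<open>implicit_Euler_duality\<close>, \<open>discrete_solution_estimate\<close>).

  There remains a discrete Volterra inequality for \<open>\<parallel>A\<^sub>m u\<^sub>m\<parallel>\<close> (\<open>log_kernel_estimate\<close>). The kernel \<open>1/S\<close> has row and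
  column sums at most \<open>1 + ln (T / k\<^sub>m\<^sub>i\<^sub>n)\<close>, whence the logarithm, and the Schur test makes the bound
  uniform in \<open>p\<close>. The kernel \<open>\<omega> S * S powr (-3/2)\<close> is integrable; the weight \<open>exp (- \<mu> \<tau>\<^sub>m)\<close> makes
  its row and column sums small, and it is absorbed at the price of the factor \<open>exp (\<mu> T)\<close>.

  Two facts about function spaces are needed besides: the mean of a strongly measurable function
  is represented by an element of \<open>L\<^sup>2\<close> (\<open>strongly_measurable_L2_integral\<close>), and test functions
  determine an element of \<open>L\<^sup>2\<close> (\<open>L2_orthogonal_to_test_functions\<close>), which makes weak gradients and
  the \<open>L\<^sup>2\<close> representatives unique almost everywhere.
\<close>

section \<open>Semi-inner products on finite-dimensional spaces\<close>

text \<open>Coefficient vectors, as functions on the natural numbers, are to form a real vector space.\<close>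

instantiation "fun" :: (type, real_vector) real_vector
begin
definition scaleR_fun :: "real \<Rightarrow> ('a \<Rightarrow> 'b) \<Rightarrow> 'a \<Rightarrow> 'b"
  where "scaleR_fun c f = (\<lambda>x. c *\<^sub>R f x)"
instance
  by standard (auto simp: scaleR_fun_def fun_eq_iff scaleR_add_right scaleR_add_left)
end

text \<open>Definiteness is left out because the Gram form of linearly dependent functions is degenerate.\<close>

definition semi_inner :: "('v::real_vector \<Rightarrow> 'v \<Rightarrow> real) \<Rightarrow> bool" where
  "semi_inner B \<longleftrightarrow> bilinear B \<and> (\<forall>x y. B x y = B y x) \<and> (\<forall>x. 0 \<le> B x x)"

lemma semi_inner_simps:
  assumes "semi_inner B"
  shows "B (x + y) z = B x z + B y z" "B z (x + y) = B z x + B z y"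
    "B (x - y) z = B x z - B y z" "B z (x - y) = B z x - B z y"
    "B (c *\<^sub>R x) z = c * B x z" "B z (c *\<^sub>R x) = c * B z x"
    "B 0 z = 0" "B z 0 = 0"
  using assms unfolding semi_inner_def
  by (auto simp: bilinear_ladd bilinear_radd bilinear_lsub bilinear_rsub bilinear_lmul
      bilinear_rmul bilinear_lzero bilinear_rzero)

lemma semi_inner_sym: "semi_inner B \<Longrightarrow> B x y = B y x"
  and semi_inner_nonneg: "semi_inner B \<Longrightarrow> 0 \<le> B x x"
  and semi_inner_bilinear: "semi_inner B \<Longrightarrow> bilinear B"
  unfolding semi_inner_def by auto

lemma semi_inner_plus_scaled:
  assumes "semi_inner B" "semi_inner E" "0 \<le> r"
  shows "semi_inner (\<lambda>x y. B x y + r * E x y)"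
  unfolding semi_inner_def bilinear_def
proof (intro conjI allI)
  show "linear (\<lambda>y. B x y + r * E x y)" for x
    by (rule linearI) (simp_all add: semi_inner_simps[OF assms(1)] semi_inner_simps[OF assms(2)] algebra_simps)
  show "linear (\<lambda>x. B x y + r * E x y)" for y
    by (rule linearI) (simp_all add: semi_inner_simps[OF assms(1)] semi_inner_simps[OF assms(2)] algebra_simps)
  show "B x y + r * E x y = B y x + r * E y x" for x y
    by (simp add: semi_inner_sym[OF assms(1), of x y] semi_inner_sym[OF assms(2), of x y])
  show "0 \<le> B x x + r * E x x" for x
    by (simp add: semi_inner_nonneg assms)
qed

lemma semi_inner_Cauchy_Schwarz:
  assumes "semi_inner B"
  shows "(B x y)\<^sup>2 \<le> B x x * B y y"
proof -
  have q: "0 \<le> B x x - 2 * s * B x y + s\<^sup>2 * B y y" for s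
  proof -
    have "0 \<le> B (x - s *\<^sub>R y) (x - s *\<^sub>R y)" by (rule semi_inner_nonneg[OF assms])
    also have "\<dots> = B x x - 2 * s * B x y + s\<^sup>2 * B y y"
      using semi_inner_sym[OF assms, of y x]
      by (simp add: semi_inner_simps[OF assms] power2_eq_square algebra_simps)
    finally show ?thesis .
  qed
  show ?thesis
  proof (cases "B y y = 0")
    case True
    have "B x y = 0"
    proof (rule ccontr)
      assume "B x y \<noteq> 0"
      then show False using q[of "(B x x + 1) / (2 * B x y)"] True by (simp add: field_simps)
    qed
    with True show ?thesis by simp
  next
    case False
    then have p: "B y y > 0" using semi_inner_nonneg[OF assms, of y] by simp
    have "0 \<le> B x x - (B x y)\<^sup>2 / B y y"
      using q[of "B x y / B y y"] p by (simp add: power2_eq_square field_simps)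
    then show ?thesis using p by (simp add: field_simps)
  qed
qed

lemma semi_inner_Cauchy_Schwarz_sqrt:
  assumes "semi_inner B"
  shows "\<bar>B x y\<bar> \<le> sqrt (B x x) * sqrt (B y y)"
  using real_sqrt_le_mono[OF semi_inner_Cauchy_Schwarz[OF assms, of x y]]
  by (simp add: real_sqrt_mult)

lemma semi_inner_null:
  assumes "semi_inner B" "B x x = 0"
  shows "B x y = 0" "B y x = 0"
  using semi_inner_Cauchy_Schwarz[OF assms(1), of x y] assms(2) semi_inner_sym[OF assms(1), of x y] by auto

text \<open>Orthogonalising the generators one by one gives representers without any completeness; a
  generator whose orthogonal part is a null vector adds no condition.\<close>

lemma finite_dim_Riesz:
  fixes B :: "'v::real_vector \<Rightarrow> 'v \<Rightarrow> real"
  assumes B: "semi_inner B" and "finite S"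
    and "linear F" and "\<And>v. v \<in> span S \<Longrightarrow> B v v = 0 \<Longrightarrow> F v = 0"
  shows "\<exists>z \<in> span S. \<forall>v \<in> span S. B z v = F v"
  using assms(2-)
proof (induction S arbitrary: F)
  case empty
  then show ?case by (auto simp: semi_inner_simps[OF B] linear_0)
next
  case (insert e S)
  have sub: "span S \<subseteq> span (insert e S)" by (intro span_mono) auto
  note s = semi_inner_simps[OF B]
  obtain c where c: "c \<in> span S" "\<And>v. v \<in> span S \<Longrightarrow> B c v = B e v"
    using insert.IH[of "B e"] semi_inner_null(2)[OF B] semi_inner_bilinear[OF B]
    unfolding bilinear_def by blast
  obtain z where z: "z \<in> span S" "\<And>v. v \<in> span S \<Longrightarrow> B z v = F v"
    using insert.IH[of F] insert.prems sub by blast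
  define r where "r = e - c"
  have r: "r \<in> span (insert e S)"
    unfolding r_def using c(1) sub by (intro span_diff) (auto intro: span_base)
  have r0: "B r v = 0" "B v r = 0" if "v \<in> span S" for v
    using c(2)[OF that] semi_inner_sym[OF B, of v r] by (simp_all add: r_def s)
  have F: "F (x + y) = F x + F y" "F (q *\<^sub>R x) = q * F x" for x y q
    using insert.prems(1) by (simp_all add: linear_add linear_scale)
  obtain q where q: "q * B r r = F r"
  proof (cases "B r r = 0")
    case True then show ?thesis using insert.prems(2)[OF r] that[of 0] by simp
  next
    case False then show ?thesis using that[of "F r / B r r"] by simp
  qed
  show ?case
  proof (intro bexI ballI)
    show "z + q *\<^sub>R r \<in> span (insert e S)" using z r sub by (auto intro!: span_add span_scale)
    fix v assume "v \<in> span (insert e S)"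
    then obtain k where k: "v - k *\<^sub>R e \<in> span S" by (auto simp: span_insert)
    define w where "w = v - k *\<^sub>R e + k *\<^sub>R c"
    have w: "w \<in> span S" unfolding w_def using k c by (auto intro!: span_add span_scale)
    have v: "v = w + k *\<^sub>R r" by (simp add: w_def r_def algebra_simps)
    show "B (z + q *\<^sub>R r) v = F v"
      unfolding v using z(2)[OF w] r0(1)[OF w] r0(2)[OF z(1)] q by (simp add: s F)
  qed
qed

section \<open>Smoothing by implicit Euler steps\<close>

text \<open>Here \<open>P n i\<close> is the moment \<open>\<langle>A\<^sup>i y\<^sub>n, y\<^sub>n\<rangle>\<close> along the chain \<open>y\<^sub>n\<^sub>+\<^sub>1 = (1 + k\<^sub>n A) y\<^sub>n\<close>, so that \<open>P n i\<close> is the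
  combination of the initial moments with the coefficients of \<open>(\<Prod>(1 + k\<^sub>j x))\<^sup>2\<close>. In terms of the elementary
  symmetric polynomials \<open>e\<^sub>1 = S\<close> and \<open>e\<^sub>2 = E / 2\<close> of the steps, the first four coefficients are \<open>1\<close>,
  \<open>2 e\<^sub>1\<close>, \<open>e\<^sub>1\<^sup>2 + 2 e\<^sub>2\<close> and \<open>2 e\<^sub>1 e\<^sub>2 + 2 e\<^sub>3\<close>; the remaining terms are nonnegative.\<close>

lemma moment_growth:
  fixes P :: "nat \<Rightarrow> nat \<Rightarrow> real" and k :: "nat \<Rightarrow> real"
  assumes nonneg: "\<And>i. 0 \<le> P 0 i" and k: "\<And>n. n < N \<Longrightarrow> 0 \<le> k n"
    and rec: "\<And>n i. n < N \<Longrightarrow> P (Suc n) i = P n i + 2 * k n * P n (i + 1) + (k n)\<^sup>2 * P n (i + 2)"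
  defines "S \<equiv> \<lambda>n. \<Sum>j<n. k j" and "E \<equiv> \<lambda>n. (\<Sum>j<n. k j)\<^sup>2 - (\<Sum>j<n. (k j)\<^sup>2)"
  assumes "n \<le> N"
  shows "P 0 i + 2 * S n * P 0 (i+1) + ((S n)\<^sup>2 + E n) * P 0 (i+2) + S n * E n * P 0 (i+3) \<le> P n i"
  using \<open>n \<le> N\<close>
proof (induction n arbitrary: i)
  case 0
  then show ?case by (simp add: S_def E_def)
next
  case (Suc n)
  have kn: "0 \<le> k n" and kj: "\<And>j. j < n \<Longrightarrow> 0 \<le> k j" using k Suc.prems by auto
  have S0: "0 \<le> S n" unfolding S_def by (intro sum_nonneg) (simp add: kj)
  have E0: "0 \<le> E n"
  proof -
    have "(\<Sum>j<n. (k j)\<^sup>2) \<le> (\<Sum>j<n. k j * S n)"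
      unfolding S_def power2_eq_square
      by (intro sum_mono mult_left_mono kj member_le_sum) (auto simp: kj)
    then show ?thesis by (simp add: E_def S_def power2_eq_square sum_distrib_right[symmetric])
  qed
  have S1: "S (Suc n) = S n + k n" by (simp add: S_def)
  have E1: "E (Suc n) = E n + 2 * k n * S n" by (simp add: E_def S_def power2_eq_square algebra_simps)
  have I: "P 0 i + 2 * S n * P 0 (i+1) + ((S n)\<^sup>2 + E n) * P 0 (i+2) + S n * E n * P 0 (i+3) \<le> P n i"
    for i using Suc by simp
  define x1 x2 x3 x4 x5 where "x1 = P 0 (i+1)" and "x2 = P 0 (i+2)" and "x3 = P 0 (i+3)"
    and "x4 = P 0 (i+4)" and "x5 = P 0 (i+5)"
  note x = x1_def x2_def x3_def x4_def x5_def
  have a: "P 0 i + 2 * S n * x1 + ((S n)\<^sup>2 + E n) * x2 + S n * E n * x3 \<le> P n i"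
    using I[of i] by (simp add: x)
  have b: "x1 + 2 * S n * x2 + ((S n)\<^sup>2 + E n) * x3 \<le> P n (i+1)"
  proof -
    have "0 \<le> S n * E n * x4" using S0 E0 nonneg by (simp add: x)
    moreover have "P 0 (i+1) + 2 * S n * P 0 (i+2) + ((S n)\<^sup>2 + E n) * P 0 (i+3) + S n * E n * P 0 (i+4) \<le> P n (i+1)"
      using I[of "i+1"] by (simp add: eval_nat_numeral)
    ultimately show ?thesis by (simp add: x)
  qed
  have c: "x2 + 2 * S n * x3 \<le> P n (i+2)"
  proof -
    have "0 \<le> S n * E n * x5" "0 \<le> ((S n)\<^sup>2 + E n) * x4" using S0 E0 nonneg by (simp_all add: x)
    moreover have "P 0 (i+2) + 2 * S n * P 0 (i+3) + ((S n)\<^sup>2 + E n) * P 0 (i+4) + S n * E n * P 0 (i+5) \<le> P n (i+2)"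
      using I[of "i+2"] by (simp add: eval_nat_numeral)
    ultimately show ?thesis by (simp add: x)
  qed
  have b': "2 * k n * (x1 + 2 * S n * x2 + ((S n)\<^sup>2 + E n) * x3) \<le> 2 * k n * P n (i+1)"
    using b kn by (intro mult_left_mono) auto
  have c': "(k n)\<^sup>2 * (x2 + 2 * S n * x3) \<le> (k n)\<^sup>2 * P n (i+2)"
    using c by (intro mult_left_mono) auto
  have "0 \<le> k n * E n * x3" using kn E0 nonneg by (simp add: x)
  moreover have "P 0 i + 2 * (S n + k n) * x1 + ((S n + k n)\<^sup>2 + (E n + 2 * k n * S n)) * x2
        + (S n + k n) * (E n + 2 * k n * S n) * x3 + k n * E n * x3
      = (P 0 i + 2 * S n * x1 + ((S n)\<^sup>2 + E n) * x2 + S n * E n * x3)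
        + 2 * k n * (x1 + 2 * S n * x2 + ((S n)\<^sup>2 + E n) * x3) + (k n)\<^sup>2 * (x2 + 2 * S n * x3)"
    by algebra
  ultimately show ?case
    using a b' c' rec[of n i] Suc.prems unfolding S1 E1 by (simp add: x)
qed

text \<open>With at least two steps of comparable neighbouring lengths no single step dominates, so the
  elementary symmetric polynomial of degree two in the step lengths has full size.\<close>

lemma sum_squares_steps:
  fixes k :: "nat \<Rightarrow> real"
  assumes k: "\<And>j. j < n \<Longrightarrow> 0 < k j" and \<kappa>: "\<kappa> > 0" and n: "2 \<le> n"
    and ratio: "\<And>j. Suc j < n \<Longrightarrow> k j \<le> \<kappa> * k (Suc j) \<and> k (Suc j) \<le> \<kappa> * k j"
  shows "(\<Sum>j<n. k j)\<^sup>2 / (1 + \<kappa>) \<le> (\<Sum>j<n. k j)\<^sup>2 - (\<Sum>j<n. (k j)\<^sup>2)"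
proof -
  define S where "S = (\<Sum>j<n. k j)"
  have two: "k i + k j \<le> S" if "i < n" "j < n" "i \<noteq> j" for i j
  proof -
    have "(\<Sum>l\<in>{i,j}. k l) \<le> S" unfolding S_def
      by (rule sum_mono2) (use that k in \<open>auto intro: less_imp_le\<close>)
    then show ?thesis using that by simp
  qed
  have "k j \<le> \<kappa> * (S - k j)" if j: "j < n" for j
  proof (cases "Suc j < n")
    case True
    have "k j \<le> \<kappa> * k (Suc j)" using ratio True by blast
    also have "\<dots> \<le> \<kappa> * (S - k j)" using two[of "Suc j" j] True \<kappa> by (intro mult_left_mono) auto
    finally show ?thesis .
  next
    case False
    then obtain i where i: "j = Suc i" using n j by (cases j) auto
    have "k j \<le> \<kappa> * k i" using ratio i j by blast
    also have "\<dots> \<le> \<kappa> * (S - k j)" using two[of i j] i j \<kappa> by (intro mult_left_mono) auto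
    finally show ?thesis .
  qed
  then have "(\<Sum>j<n. k j * k j) \<le> (\<Sum>j<n. k j * (\<kappa> * (S - k j)))"
    using k by (intro sum_mono mult_left_mono) (auto intro: less_imp_le)
  also have "\<dots> = \<kappa> * (S\<^sup>2 - (\<Sum>j<n. (k j)\<^sup>2))"
    by (simp add: S_def power2_eq_square sum_distrib_left sum_distrib_right algebra_simps sum_subtractf)
  finally have "(\<Sum>j<n. (k j)\<^sup>2) \<le> \<kappa> * (S\<^sup>2 - (\<Sum>j<n. (k j)\<^sup>2))" by (simp add: power2_eq_square)
  then have "S\<^sup>2 \<le> (1 + \<kappa>) * (S\<^sup>2 - (\<Sum>j<n. (k j)\<^sup>2))" by (simp add: algebra_simps)
  then show ?thesis using \<kappa> unfolding S_def[symmetric] by (simp add: field_simps)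
qed


text \<open>The even moments are \<open>\<parallel>A\<^sup>j y\<parallel>\<^sup>2\<close>, the odd ones \<open>a (A\<^sup>j y) (A\<^sup>j y)\<close>, so all are nonnegative, and the terms of
  second and third order in \<open>moment_growth\<close> give the two bounds. The map \<open>A\<close> stands for the operator of
  the form \<open>a\<close> on \<open>W\<close>; it is determined up to null vectors of \<open>ip\<close>, so the proof argues with its
  symmetry in place of linearity.\<close>

lemma implicit_Euler_smoothing:
  fixes ip a :: "'v::real_vector \<Rightarrow> 'v \<Rightarrow> real" and k :: "nat \<Rightarrow> real"
  assumes ip: "semi_inner ip" and a: "semi_inner a"
    and AW: "\<And>z. z \<in> W \<Longrightarrow> A z \<in> W" and A: "\<And>z v. z \<in> W \<Longrightarrow> v \<in> W \<Longrightarrow> ip (A z) v = a z v"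
    and y: "\<And>n. n \<le> N \<Longrightarrow> y n \<in> W" and k: "\<And>n. n < N \<Longrightarrow> 0 < k n"
    and chain: "\<And>n v. n < N \<Longrightarrow> v \<in> W \<Longrightarrow> ip (y (Suc n)) v = ip (y n) v + k n * a (y n) v"
  defines "S \<equiv> \<Sum>n<N. k n"
  shows "S\<^sup>2 * ip (A (y 0)) (A (y 0)) \<le> ip (y N) (y N)"
    and "\<kappa> > 0 \<Longrightarrow> 2 \<le> N \<Longrightarrow> (\<And>j. Suc j < N \<Longrightarrow> k j \<le> \<kappa> * k (Suc j) \<and> k (Suc j) \<le> \<kappa> * k j)
      \<Longrightarrow> S ^ 3 / (1 + \<kappa>) * a (A (y 0)) (A (y 0)) \<le> ip (y N) (y N)"
proof -
  have adj: "ip (A x) v = ip x (A v)" if "x \<in> W" "v \<in> W" for x v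
    using A[OF that] A[OF that(2,1)] semi_inner_sym[OF ip, of x "A v"] semi_inner_sym[OF a, of x v] by simp
  have pow: "(A ^^ i) x \<in> W" if "x \<in> W" for i x
    using that by (induction i) (auto intro: AW)
  have adjn: "ip ((A ^^ (i + j)) x) v = ip ((A ^^ i) x) ((A ^^ j) v)" if "x \<in> W" "v \<in> W" for i j x v
    using that(2)
  proof (induction j arbitrary: v)
    case 0 then show ?case by simp
  next
    case (Suc j)
    have "ip ((A ^^ (i + Suc j)) x) v = ip ((A ^^ (i + j)) x) (A v)"
      using adj[OF pow[OF that(1)] Suc.prems] by simp
    then show ?case using Suc.IH[OF AW[OF Suc.prems]] by (simp add: funpow_swap1)
  qed
  define P where "P n i = ip ((A ^^ i) (y n)) (y n)" for n i
  have P_nonneg: "0 \<le> P 0 i" for i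
  proof (cases "even i")
    case True
    then obtain j where i: "i = j + j" by (auto elim!: evenE simp: mult_2)
    show ?thesis unfolding P_def i using adjn[of "y 0" "y 0" j j] y[of 0] semi_inner_nonneg[OF ip] by simp
  next
    case False
    then obtain j where i: "i = Suc j + j" by (auto elim!: oddE simp: mult_2)
    have "ip ((A ^^ i) (y 0)) (y 0) = ip ((A ^^ Suc j) (y 0)) ((A ^^ j) (y 0))"
      unfolding i using adjn[of "y 0" "y 0" "Suc j" j] y[of 0] by blast
    also have "\<dots> = a ((A ^^ j) (y 0)) ((A ^^ j) (y 0))"
      using A pow y[of 0] by simp
    finally show ?thesis unfolding P_def using semi_inner_nonneg[OF a] by simp
  qed
  have rec: "P (Suc n) i = P n i + 2 * k n * P n (i + 1) + (k n)\<^sup>2 * P n (i + 2)" if n: "n < N" for n i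
  proof -
    define z where "z = y n" define z' where "z' = y (Suc n)"
    have zW: "z \<in> W" "z' \<in> W" "A z \<in> W" using y n AW by (auto simp: z_def z'_def)
    have ch: "ip z' v = ip z v + k n * ip (A z) v" if "v \<in> W" for v
      using chain[OF n that] A[OF zW(1) that] by (simp add: z_def z'_def)
    have sw: "ip x ((A ^^ i) z') = ip z' ((A ^^ i) x)" if "x \<in> W" for x
      using adjn[of x z' 0 i] that zW semi_inner_sym[OF ip, of z'] by simp
    have m1: "ip z ((A ^^ j) z) = P n j" for j
      unfolding P_def using semi_inner_sym[OF ip] by (simp add: z_def)
    have m2: "ip (A z) ((A ^^ j) z) = P n (Suc j)" for j
      using adj[OF zW(1) pow[OF zW(1)], of j] m1[of "Suc j"] by simp
    have "P (Suc n) i = ip z' ((A ^^ i) z')"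
      unfolding P_def using semi_inner_sym[OF ip] by (simp add: z'_def)
    also have "\<dots> = ip z ((A ^^ i) z') + k n * ip (A z) ((A ^^ i) z')" by (rule ch[OF pow[OF zW(2)]])
    also have "\<dots> = ip z' ((A ^^ i) z) + k n * ip z' ((A ^^ i) (A z))" using sw zW by simp
    also have "(A ^^ i) (A z) = (A ^^ Suc i) z" by (simp add: funpow_swap1)
    also have "ip z' ((A ^^ i) z) + k n * ip z' ((A ^^ Suc i) z)
        = P n i + k n * P n (Suc i) + k n * (P n (Suc i) + k n * P n (Suc (Suc i)))"
      unfolding ch[OF pow[OF zW(1)]] m1 m2 by simp
    finally show ?thesis by (simp add: algebra_simps power2_eq_square)
  qed
  define E where "E = (\<Sum>j<N. k j)\<^sup>2 - (\<Sum>j<N. (k j)\<^sup>2)"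
  have y0: "y 0 \<in> W" "A (y 0) \<in> W" using y[of 0] AW by auto
  have P2: "P 0 2 = ip (A (y 0)) (A (y 0))" and P3: "P 0 3 = a (A (y 0)) (A (y 0))"
    using adj[OF y0(2) y0(1)] adj[OF AW[OF y0(2)] y0(1)] A[OF y0(2) y0(2)]
    by (simp_all add: P_def eval_nat_numeral)
  have S0: "0 \<le> S" unfolding S_def using k by (intro sum_nonneg) (auto intro: less_imp_le)
  have E0: "0 \<le> E"
  proof -
    have "(\<Sum>j<N. (k j)\<^sup>2) \<le> (\<Sum>j<N. k j * S)"
      unfolding S_def power2_eq_square using k
      by (intro sum_mono mult_left_mono member_le_sum) (auto intro: less_imp_le)
    then show ?thesis by (simp add: E_def S_def power2_eq_square sum_distrib_right[symmetric])
  qed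
  have main: "P 0 0 + 2 * S * P 0 1 + (S\<^sup>2 + E) * P 0 2 + S * E * P 0 3 \<le> P N 0"
    using moment_growth[of P N k N 0, OF P_nonneg _ rec] k unfolding S_def E_def by (simp add: less_imp_le numeral_2_eq_2)
  have pos: "0 \<le> P 0 0" "0 \<le> S * P 0 1" "0 \<le> S\<^sup>2 * P 0 2" "0 \<le> E * P 0 2" "0 \<le> S * E * P 0 3"
    using P_nonneg S0 E0 by auto
  have PN: "P N 0 = ip (y N) (y N)" by (simp add: P_def)
  show "S\<^sup>2 * ip (A (y 0)) (A (y 0)) \<le> ip (y N) (y N)"
    using main pos unfolding PN P2[symmetric] by (simp add: algebra_simps)
  assume \<kappa>: "\<kappa> > 0" and N: "2 \<le> N"
    and ratio: "\<And>j. Suc j < N \<Longrightarrow> k j \<le> \<kappa> * k (Suc j) \<and> k (Suc j) \<le> \<kappa> * k j"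
  have "S\<^sup>2 / (1 + \<kappa>) \<le> E" unfolding S_def E_def by (rule sum_squares_steps) (use k \<kappa> N ratio in auto)
  then have "S * (S\<^sup>2 / (1 + \<kappa>)) * P 0 3 \<le> S * E * P 0 3"
    using S0 P_nonneg by (intro mult_right_mono mult_left_mono) auto
  then show "S ^ 3 / (1 + \<kappa>) * a (A (y 0)) (A (y 0)) \<le> ip (y N) (y N)"
    using main pos unfolding PN P3[symmetric] by (simp add: algebra_simps power3_eq_cube power2_eq_square)
qed

text \<open>A backward chain of implicit Euler steps \<open>z\<^sub>l = (1 + k\<^sub>l A)\<^sup>-\<^sup>1 z\<^sub>l\<^sub>+\<^sub>1\<close> started at \<open>A u\<^sub>m\<close> solves the dual
  problem: testing the equations with \<open>A z\<^sub>l\<close> telescopes to \<open>\<parallel>A u\<^sub>m\<parallel>\<^sup>2\<close>, and smoothing bounds \<open>A z\<^sub>l\<close> in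
  both norms. A single Euler step does not gain the power \<open>3/2\<close>, so the functional on the last cell has to
  be bounded by the norm of \<open>ip\<close> alone.\<close>

lemma implicit_Euler_duality:
  fixes ip a :: "'v::real_vector \<Rightarrow> 'v \<Rightarrow> real" and k p q :: "nat \<Rightarrow> real"
  assumes ip: "semi_inner ip" and a: "semi_inner a" and "finite G" and W: "W = span G"
    and null: "\<And>v. v \<in> W \<Longrightarrow> ip v v = 0 \<Longrightarrow> a v v = 0"
    and m: "1 \<le> m" and k: "\<And>l. 1 \<le> l \<Longrightarrow> l \<le> m \<Longrightarrow> 0 < k l" and \<kappa>: "\<kappa> > 0"
    and ratio: "\<And>l. 1 \<le> l \<Longrightarrow> l < m \<Longrightarrow> k l \<le> \<kappa> * k (Suc l) \<and> k (Suc l) \<le> \<kappa> * k l"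
    and u: "\<And>l. u l \<in> W" "u 0 = 0"
    and eq: "\<And>l v. 1 \<le> l \<Longrightarrow> l \<le> m \<Longrightarrow> v \<in> W
      \<Longrightarrow> ip (u l - u (l - 1)) v + k l * a (u l) v = k l * F l v"
    and F: "\<And>l v. 1 \<le> l \<Longrightarrow> l \<le> m \<Longrightarrow> v \<in> W \<Longrightarrow> \<bar>F l v\<bar> \<le> p l * sqrt (ip v v) + q l * sqrt (a v v)"
    and p: "\<And>l. 0 \<le> p l" and q: "\<And>l. 0 \<le> q l" "q m = 0"
  defines "S \<equiv> \<lambda>l. \<Sum>j=l..m. k j"
  shows "\<exists>g\<in>W. (\<forall>v\<in>W. ip g v = a (u m) v) \<and>
    sqrt (ip g g) \<le> (\<Sum>l=1..m. k l * (p l / S l + q l * sqrt ((1 + \<kappa>) / S l ^ 3)))"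
proof -
  have "\<forall>z\<in>W. \<exists>x\<in>W. \<forall>v\<in>W. ip x v = a z v"
    unfolding W using finite_dim_Riesz[OF ip \<open>finite G\<close>, of "a _"] semi_inner_bilinear[OF a]
      semi_inner_null(2)[OF a] null[unfolded W] unfolding bilinear_def by metis
  then obtain A where A: "\<And>z. z \<in> W \<Longrightarrow> A z \<in> W" "\<And>z v. z \<in> W \<Longrightarrow> v \<in> W \<Longrightarrow> ip (A z) v = a z v"
    by metis
  have "\<exists>z\<in>W. \<forall>v\<in>W. ip z v + r * a z v = ip y v" if "0 < r" for r y
  proof -
    have B: "semi_inner (\<lambda>x y. ip x y + r * a x y)" using that by (intro semi_inner_plus_scaled ip a) auto
    have "ip y v = 0" if "ip v v + r * a v v = 0" for v
    proof -
      have "ip v v = 0" using that semi_inner_nonneg[OF ip, of v] semi_inner_nonneg[OF a, of v] \<open>0 < r\<close>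
        by (smt (verit) mult_nonneg_nonneg)
      then show ?thesis by (rule semi_inner_null(2)[OF ip])
    qed
    then show ?thesis unfolding W
      using finite_dim_Riesz[OF B \<open>finite G\<close>, of "ip y"] semi_inner_bilinear[OF ip]
      unfolding bilinear_def by blast
  qed
  then obtain R where R: "\<And>r y. 0 < r \<Longrightarrow> R r y \<in> W"
    "\<And>r y v. 0 < r \<Longrightarrow> v \<in> W \<Longrightarrow> ip (R r y) v + r * a (R r y) v = ip y v"
    by metis
  define g where "g = A (u m)"
  have g: "g \<in> W" "\<And>v. v \<in> W \<Longrightarrow> ip g v = a (u m) v" unfolding g_def using A u by auto
  define zz where "zz = rec_nat g (\<lambda>n. R (k (m - n)))"
  define z where "z l = zz (m + 1 - l)" for l
  have zm: "z (Suc m) = g" by (simp add: z_def zz_def)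
  have zl: "z l = R (k l) (z (Suc l))" if "1 \<le> l" "l \<le> m" for l
  proof -
    have *: "m + 1 - l = Suc (m - l)" "m - (m - l) = l" "m + 1 - Suc l = m - l" using that by auto
    show ?thesis unfolding z_def * by (simp add: zz_def *)
  qed
  have zW: "z l \<in> W" if "1 \<le> l" "l \<le> Suc m" for l
    using zl[of l] R(1) k[of l] zm g(1) that by (cases "l = Suc m") auto
  have zeq: "ip (z l) v + k l * a (z l) v = ip (z (Suc l)) v" if "1 \<le> l" "l \<le> m" "v \<in> W" for l v
    using R(2)[OF k[OF that(1,2)] that(3)] zl[OF that(1,2)] by simp
  note s = semi_inner_simps[OF ip] semi_inner_simps[OF a]
  have tele: "k l * F l (A (z l)) = a (u l) (z (Suc l)) - a (u (l-1)) (z l)" if l: "1 \<le> l" "l \<le> m" for l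
  proof -
    have W': "z l \<in> W" "A (z l) \<in> W" "A (u l) \<in> W" "u l \<in> W" "u (l-1) \<in> W" "z (Suc l) \<in> W"
      using zW l A u by auto
    have 1: "ip (u l) (A (z l)) = ip (z l) (A (u l))"
      using A(2)[OF W'(1) W'(4)] A(2)[OF W'(4) W'(1)] semi_inner_sym[OF ip] semi_inner_sym[OF a] by metis
    have 2: "a (u l) (A (z l)) = a (z l) (A (u l))"
      using A(2)[OF W'(1) W'(3)] A(2)[OF W'(4) W'(2)] semi_inner_sym[OF ip] by metis
    have 3: "ip (u (l-1)) (A (z l)) = a (u (l-1)) (z l)"
      using A(2)[OF W'(1) W'(5)] semi_inner_sym[OF ip] semi_inner_sym[OF a] by metis
    have 4: "ip (z (Suc l)) (A (u l)) = a (u l) (z (Suc l))"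
      using A(2)[OF W'(4) W'(6)] semi_inner_sym[OF ip] by metis
    show ?thesis using eq[OF l W'(2)] zeq[OF l W'(3)] by (simp add: s 1 2 4 3[simplified])
  qed
  define N where "N = sqrt (ip g g)"
  have N0: "0 \<le> N" and NN: "N\<^sup>2 = ip g g" by (auto simp: N_def semi_inner_nonneg[OF ip])
  have "(\<Sum>l=1..m. k l * F l (A (z l))) = (\<Sum>l=Suc 0..m. a (u l) (z (Suc l)) - a (u (l-1)) (z (Suc (l - 1))))"
    by (intro sum.cong) (auto simp: tele)
  also have "\<dots> = a (u m) (z (Suc m)) - a (u 0) (z (Suc 0))"
    using sum_telescope''[of 0 m "\<lambda>l. a (u l) (z (Suc l))"] m by simp
  also have "\<dots> = N\<^sup>2" using g zm u(2) by (simp add: s NN)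
  finally have sumN: "(\<Sum>l=1..m. k l * F l (A (z l))) = N\<^sup>2" .
  have S_pos: "0 < S l" if "1 \<le> l" "l \<le> m" for l
    unfolding S_def using that k by (intro sum_pos) auto
  have bound: "F l (A (z l)) \<le> (p l / S l + q l * sqrt ((1 + \<kappa>) / S l ^ 3)) * N"
    if l: "1 \<le> l" "l \<le> m" for l
  proof -
    define n where "n = Suc m - l"
    have Sl: "(\<Sum>j<n. k (l + j)) = S l"
      unfolding S_def n_def using l by (intro sum.reindex_bij_witness[of _ "\<lambda>j. j - l" "\<lambda>j. l + j"]) auto
    have chain: "ip (z (l + Suc j)) v = ip (z (l + j)) v + k (l + j) * a (z (l + j)) v"
      if "j < n" "v \<in> W" for j v
      using zeq[of "l + j" v] that l by (simp add: n_def)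
    have yW: "z (l + j) \<in> W" if "j \<le> n" for j using zW[of "l + j"] that l by (simp add: n_def)
    have kn: "0 < k (l + j)" if "j < n" for j using k[of "l + j"] that l by (simp add: n_def)
    have last: "z (l + n) = g" using l zm by (simp add: n_def)
    have "(\<Sum>j<n. k (l + j))\<^sup>2 * ip (A (z (l + 0))) (A (z (l + 0))) \<le> ip (z (l + n)) (z (l + n))"
      by (rule implicit_Euler_smoothing(1)[where y = "\<lambda>j. z (l + j)" and W = W and a = a])
        (fact ip a A yW kn chain)+
    then have sm1: "(S l)\<^sup>2 * ip (A (z l)) (A (z l)) \<le> ip g g" by (simp only: Sl last add_0_right)
    have "(S l * sqrt (ip (A (z l)) (A (z l))))\<^sup>2 \<le> N\<^sup>2"
      using sm1 semi_inner_nonneg[OF ip] by (simp add: power_mult_distrib NN)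
    then have "S l * sqrt (ip (A (z l)) (A (z l))) \<le> N" by (rule power2_le_imp_le) (rule N0)
    then have 1: "sqrt (ip (A (z l)) (A (z l))) \<le> N / S l" using S_pos[OF l] by (simp add: field_simps)
    have 2: "q l * sqrt (a (A (z l)) (A (z l))) \<le> q l * (sqrt ((1 + \<kappa>) / S l ^ 3) * N)"
    proof (cases "l = m")
      case True then show ?thesis using q by simp
    next
      case False
      have r: "k (l + j) \<le> \<kappa> * k (l + Suc j) \<and> k (l + Suc j) \<le> \<kappa> * k (l + j)" if "Suc j < n" for j
        using ratio[of "l + j"] that l by (simp add: n_def)
      have n2: "2 \<le> n" using False l by (simp add: n_def)
      have "(\<Sum>j<n. k (l + j)) ^ 3 / (1 + \<kappa>) * a (A (z (l + 0))) (A (z (l + 0)))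
          \<le> ip (z (l + n)) (z (l + n))"
        by (rule implicit_Euler_smoothing(2)[where y = "\<lambda>j. z (l + j)" and W = W and a = a])
          (fact ip a A yW kn chain \<kappa> n2 r)+
      then have "S l ^ 3 / (1 + \<kappa>) * a (A (z l)) (A (z l)) \<le> N\<^sup>2" by (simp only: Sl last add_0_right NN)
      then have "a (A (z l)) (A (z l)) \<le> (1 + \<kappa>) / S l ^ 3 * N\<^sup>2"
        using S_pos[OF l] \<kappa> by (simp add: field_simps)
      then have "sqrt (a (A (z l)) (A (z l))) \<le> sqrt ((1 + \<kappa>) / S l ^ 3 * N\<^sup>2)"
        by (rule real_sqrt_le_mono)
      also have "\<dots> = sqrt ((1 + \<kappa>) / S l ^ 3) * N"
        unfolding real_sqrt_mult using N0 by simp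
      finally have "sqrt (a (A (z l)) (A (z l))) \<le> sqrt ((1 + \<kappa>) / S l ^ 3) * N" .
      then show ?thesis using q by (intro mult_left_mono) auto
    qed
    have "F l (A (z l)) \<le> p l * sqrt (ip (A (z l)) (A (z l))) + q l * sqrt (a (A (z l)) (A (z l)))"
      using F[OF l A(1)[OF zW]] l by (simp add: abs_le_iff)
    also have "\<dots> \<le> p l * (N / S l) + q l * (sqrt ((1 + \<kappa>) / S l ^ 3) * N)"
      by (intro add_mono mult_left_mono 1 2 p)
    finally show ?thesis by (simp add: algebra_simps)
  qed
  define X where "X = (\<Sum>l=1..m. k l * (p l / S l + q l * sqrt ((1 + \<kappa>) / S l ^ 3)))"
  have X0: "0 \<le> X" unfolding X_def
    using k S_pos p q \<kappa> by (intro sum_nonneg mult_nonneg_nonneg add_nonneg_nonneg divide_nonneg_nonneg)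
      (auto intro: less_imp_le)
  have "N\<^sup>2 \<le> (\<Sum>l=1..m. k l * ((p l / S l + q l * sqrt ((1 + \<kappa>) / S l ^ 3)) * N))"
    unfolding sumN[symmetric] using bound k by (intro sum_mono mult_left_mono) (auto intro: less_imp_le)
  also have "\<dots> = X * N" by (simp add: X_def sum_distrib_right mult.assoc)
  finally have "N \<le> X" using X0 N0 by (cases "N = 0") (auto simp: power2_eq_square)
  then show ?thesis using g unfolding N_def X_def by blast
qed

section \<open>Weighted kernels on a time mesh\<close>

text \<open>Convexity, in the form in which a small second summand can be absorbed.\<close>

lemma powr_half_sum_le:
  fixes x y p :: real
  assumes "0 \<le> x" "0 \<le> y" "1 \<le> p"
  shows "(x + y) powr p \<le> ((2 * x) powr p + (2 * y) powr p) / 2"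
proof (cases "x = 0 \<or> y = 0")
  case True
  have "z powr p \<le> (2 * z) powr p / 2" if "0 \<le> z" for z :: real
  proof -
    have "2 powr 1 \<le> (2::real) powr p" using assms by (intro powr_mono) auto
    then have "z powr p * 2 \<le> z powr p * 2 powr p" by (intro mult_left_mono) auto
    then show ?thesis using that by (simp add: powr_mult mult.commute)
  qed
  with True assms show ?thesis by auto
next
  case False
  have "((1/2) *\<^sub>R (2*x) + (1/2) *\<^sub>R (2*y)) powr p \<le> (1/2) * (2*x) powr p + (1/2) * (2*y) powr p"
    using convex_onD[OF powr_convex[OF assms(3)], of "1/2" "2*x" "2*y"] False assms by simp
  then show ?thesis by (simp add: add_divide_distrib)
qed

text \<open>Jensen's inequality for weights of total mass at most \<open>\<rho>\<close>.\<close>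

lemma powr_weighted_sum_le:
  fixes w y :: "'a \<Rightarrow> real"
  assumes "finite I" and w: "\<And>i. i \<in> I \<Longrightarrow> 0 \<le> w i" and y: "\<And>i. i \<in> I \<Longrightarrow> 0 \<le> y i"
    and p: "1 \<le> p" and \<rho>: "(\<Sum>i\<in>I. w i) \<le> \<rho>"
  shows "(\<Sum>i\<in>I. w i * y i) powr p \<le> \<rho> powr (p - 1) * (\<Sum>i\<in>I. w i * y i powr p)"
proof -
  \<comment> \<open>Convexity is applied to positive values with positive weights.\<close>
  define J where "J = {i \<in> I. 0 < w i \<and> 0 < y i}"
  have J: "finite J" "J \<subseteq> I" using assms by (auto simp: J_def)
  have out: "w i * y i = 0" "w i * y i powr p = 0" if "i \<in> I - J" for i
    using w[of i] y[of i] that by (force simp: J_def)+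
  have e1: "(\<Sum>i\<in>I. w i * y i) = (\<Sum>i\<in>J. w i * y i)"
    by (rule sum.mono_neutral_right) (use J assms(1) out in auto)
  have e2: "(\<Sum>i\<in>I. w i * y i powr p) = (\<Sum>i\<in>J. w i * y i powr p)"
    by (rule sum.mono_neutral_right) (use J assms(1) out in auto)
  show ?thesis
  proof (cases "J = {}")
    case True
    then show ?thesis unfolding e1 e2 using p by simp
  next
    case False
    define V where "V = (\<Sum>i\<in>J. w i)"
    have V: "0 < V" unfolding V_def using J False by (intro sum_pos) (auto simp: J_def)
    have V\<rho>: "V \<le> \<rho>" using \<rho> sum_mono2[OF assms(1) J(2), of w] w by (simp add: V_def)
    have pos: "0 < (\<Sum>i\<in>J. w i * y i)" using J False by (intro sum_pos) (auto simp: J_def)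
    have "(\<Sum>i\<in>J. (w i / V) *\<^sub>R y i) powr p \<le> (\<Sum>i\<in>J. (w i / V) * y i powr p)"
      by (rule convex_on_sum[OF J(1) False powr_convex[OF p]])
        (use V in \<open>auto simp: V_def J_def sum_divide_distrib[symmetric] intro: divide_nonneg_nonneg\<close>)
    then have "((\<Sum>i\<in>J. w i * y i) / V) powr p \<le> (\<Sum>i\<in>J. w i * y i powr p) / V"
      by (simp add: sum_divide_distrib)
    then have "(\<Sum>i\<in>J. w i * y i) powr p \<le> V powr p / V * (\<Sum>i\<in>J. w i * y i powr p)"
      using V pos by (simp add: powr_divide field_simps)
    also have "V powr p / V = V powr (p - 1)" using V by (simp add: powr_diff)
    also have "V powr (p - 1) * (\<Sum>i\<in>J. w i * y i powr p) \<le> \<rho> powr (p - 1) * (\<Sum>i\<in>J. w i * y i powr p)"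
      using V V\<rho> p by (intro mult_right_mono powr_mono2 sum_nonneg) (auto simp: J_def)
    finally show ?thesis unfolding e1 e2 .
  qed
qed

text \<open>The Schur test, by Jensen's inequality in every row.\<close>

lemma discrete_Schur_test:
  fixes K :: "nat \<Rightarrow> nat \<Rightarrow> real" and k y :: "nat \<Rightarrow> real"
  assumes "finite I" and K: "\<And>m l. m \<in> I \<Longrightarrow> l \<in> I \<Longrightarrow> 0 \<le> K m l" and k: "\<And>l. l \<in> I \<Longrightarrow> 0 \<le> k l"
    and y: "\<And>l. l \<in> I \<Longrightarrow> 0 \<le> y l" and p: "1 \<le> p" and \<rho>: "0 \<le> \<rho>"
    and row: "\<And>m. m \<in> I \<Longrightarrow> (\<Sum>l\<in>I. K m l * k l) \<le> \<rho>"
    and col: "\<And>l. l \<in> I \<Longrightarrow> (\<Sum>m\<in>I. k m * K m l) \<le> \<rho>"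
  shows "(\<Sum>m\<in>I. k m * (\<Sum>l\<in>I. K m l * k l * y l) powr p) \<le> \<rho> powr p * (\<Sum>l\<in>I. k l * y l powr p)"
proof -
  have "(\<Sum>m\<in>I. k m * (\<Sum>l\<in>I. K m l * k l * y l) powr p)
      \<le> (\<Sum>m\<in>I. k m * (\<rho> powr (p - 1) * (\<Sum>l\<in>I. K m l * k l * y l powr p)))"
    using assms by (intro sum_mono mult_left_mono powr_weighted_sum_le) auto
  also have "\<dots> = \<rho> powr (p - 1) * (\<Sum>m\<in>I. \<Sum>l\<in>I. (k m * K m l) * (k l * y l powr p))"
    by (simp add: sum_distrib_left algebra_simps)
  also have "(\<Sum>m\<in>I. \<Sum>l\<in>I. (k m * K m l) * (k l * y l powr p))
      = (\<Sum>l\<in>I. (\<Sum>m\<in>I. k m * K m l) * (k l * y l powr p))"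
    by (subst sum.swap) (simp add: sum_distrib_right)
  also have "\<rho> powr (p - 1) * \<dots> \<le> \<rho> powr (p - 1) * (\<Sum>l\<in>I. \<rho> * (k l * y l powr p))"
    using col k by (intro mult_left_mono sum_mono mult_right_mono) auto
  also have "\<dots> = (\<rho> powr (p - 1) * \<rho>) * (\<Sum>l\<in>I. k l * y l powr p)"
    by (simp add: sum_distrib_left mult.assoc)
  also have "\<rho> powr (p - 1) * \<rho> = \<rho> powr p"
    using \<rho> powr_add[of \<rho> "p - 1" 1] by simp
  finally show ?thesis .
qed

lemma antimono_step_le_integral:
  fixes h :: "real \<Rightarrow> real"
  assumes h: "antimono_on {0<..b} h" "set_integrable lebesgue {0<..<b} h"
    and "0 \<le> x" "x \<le> y" "y \<le> b"
  shows "(y - x) * h y \<le> (LINT s:{x<..<y}|lebesgue. h s)"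
proof (cases "x = y")
  case False
  then have "x < y" using assms by simp
  have "(LINT s:{x<..<y}|lebesgue. h y) \<le> (LINT s:{x<..<y}|lebesgue. h s)"
  proof (rule set_integral_mono)
    show "set_integrable lebesgue {x<..<y} h"
      by (rule set_integrable_subset[OF h(2)]) (use assms in auto)
    show "h y \<le> h s" if "s \<in> {x<..<y}" for s
      using monotone_onD[OF h(1), of s y] that assms by auto
    show "set_integrable lebesgue {x<..<y} (\<lambda>s. h y)" using \<open>x < y\<close> by (simp add: set_integrable_def)
  qed
  then show ?thesis using \<open>x < y\<close> by (simp add: set_lebesgue_integral_def)
qed (simp add: set_lebesgue_integral_def)

lemma set_integral_split_open:
  fixes h :: "real \<Rightarrow> real"
  assumes h: "set_integrable lebesgue {a<..<c} h" and "a \<le> b" "b \<le> c"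
  shows "(LINT s:{a<..<c}|lebesgue. h s) = (LINT s:{a<..<b}|lebesgue. h s) + (LINT s:{b<..<c}|lebesgue. h s)"
proof -
  have i: "set_integrable lebesgue {a<..<b} h" "set_integrable lebesgue {b<..<c} h"
    by (rule set_integrable_subset[OF h]; use assms in auto)+
  have "(LINT s:{a<..<b} \<union> {b<..<c}|lebesgue. h s) = (LINT s:{a<..<b}|lebesgue. h s) + (LINT s:{b<..<c}|lebesgue. h s)"
    by (rule set_integral_Un[OF _ i]) auto
  moreover have "(LINT s:{a<..<b} \<union> {b<..<c}|lebesgue. h s) = (LINT s:{a<..<c}|lebesgue. h s)"
  proof (rule set_integral_cong_set)
    have "AE s in lebesgue. s \<noteq> b" using AE_lborel_singleton[of b] by (rule AE_completion)
    then show "AE s in lebesgue. (s \<in> {a<..<c}) = (s \<in> {a<..<b} \<union> {b<..<c})"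
      by eventually_elim (use assms in auto)
    show "set_borel_measurable lebesgue {a<..<c} h"
      using h unfolding set_integrable_def set_borel_measurable_def by auto
    show "set_borel_measurable lebesgue ({a<..<b} \<union> {b<..<c}) h"
      using set_integrable_Un[OF i] unfolding set_integrable_def set_borel_measurable_def by auto
  qed
  ultimately show ?thesis by simp
qed

lemma mesh_mono:
  fixes \<tau> :: "nat \<Rightarrow> real"
  assumes "\<forall>m\<in>{1..M}. \<tau> (m - 1) < \<tau> m" and "i \<le> j" "j \<le> M"
  shows "\<tau> i \<le> \<tau> j"
  using assms(2,3)
proof (induction j)
  case (Suc j)
  then show ?case using assms(1)[rule_format, of "Suc j"] by (cases "i = Suc j") auto
qed simp

lemma mesh_strict_mono:
  fixes \<tau> :: "nat \<Rightarrow> real"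
  assumes "\<forall>m\<in>{1..M}. \<tau> (m - 1) < \<tau> m" and "i < j" "j \<le> M"
  shows "\<tau> i < \<tau> j"
proof -
  have "i \<le> j - 1" "j - 1 \<le> M" "j \<in> {1..M}" using assms(2,3) by auto
  then show ?thesis using mesh_mono[OF assms(1), of i "j - 1"] assms(1) by fastforce
qed

lemma sum_step: "(\<Sum>j=l..m. step \<tau> j) = \<tau> m - \<tau> (l - 1)" if "1 \<le> l" "l \<le> m"
  using sum_telescope''[of "l - 1" m \<tau>] that by (simp add: step_def)

text \<open>Both sums compare with the integral because the kernel decreases.\<close>

lemma antimono_kernel_sums:
  fixes h :: "real \<Rightarrow> real"
  assumes mesh: "\<tau> 0 = 0" "\<tau> M = T" "\<forall>m\<in>{1..M}. \<tau> (m - 1) < \<tau> m"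
    and h: "antimono_on {0<..T} h" "set_integrable lebesgue {0<..<T} h" "\<And>s. s \<in> {0<..T} \<Longrightarrow> 0 \<le> h s"
  shows "m \<in> {1..M} \<Longrightarrow> (\<Sum>l\<in>{1..<m}. step \<tau> l * h (\<tau> m - \<tau> (l - 1))) \<le> (LINT s:{0<..<T}|lebesgue. h s)"
    and "l \<in> {1..M} \<Longrightarrow> (\<Sum>m\<in>{l<..M}. step \<tau> m * h (\<tau> m - \<tau> (l - 1))) \<le> (LINT s:{0<..<T}|lebesgue. h s)"
proof -
  note mono = mesh_mono[OF mesh(3)]
  have int: "set_integrable lebesgue {x<..<y} h" if "0 \<le> x" "y \<le> T" for x y
    by (rule set_integrable_subset[OF h(2)]) (use that in auto)
  have sub: "(LINT s:{x<..<y}|lebesgue. h s) \<le> (LINT s:{0<..<T}|lebesgue. h s)" if "0 \<le> x" "y \<le> T" for x y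
    unfolding set_lebesgue_integral_def
  proof (rule integral_mono)
    show "indicator {x<..<y} s *\<^sub>R h s \<le> indicator {0<..<T} s *\<^sub>R h s" for s
      using that h(3)[of s] by (auto simp: indicator_def)
  qed (use int[OF that] h(2) in \<open>simp_all add: set_integrable_def\<close>)
  {
    fix m assume m: "m \<in> {1..M}"
    have "(\<Sum>l=1..n. step \<tau> l * h (\<tau> m - \<tau> (l - 1))) \<le> (LINT s:{\<tau> m - \<tau> n<..<\<tau> m}|lebesgue. h s)" if "n < m" for n
      using that
    proof (induction n)
      case 0 then show ?case using mesh by (simp add: set_lebesgue_integral_def)
    next
      case (Suc n)
      have le: "\<tau> m - \<tau> (Suc n) \<le> \<tau> m - \<tau> n" "\<tau> m - \<tau> n \<le> \<tau> m" "\<tau> m \<le> T" "0 \<le> \<tau> m - \<tau> (Suc n)"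
        using mono[of n "Suc n"] mono[of 0 n] mono[of m M] mono[of "Suc n" m] Suc.prems m mesh by auto
      have "step \<tau> (Suc n) * h (\<tau> m - \<tau> n) \<le> (LINT s:{\<tau> m - \<tau> (Suc n)<..<\<tau> m - \<tau> n}|lebesgue. h s)"
        using antimono_step_le_integral[OF h(1,2), of "\<tau> m - \<tau> (Suc n)" "\<tau> m - \<tau> n"] le by (simp add: step_def)
      moreover have "(\<Sum>l=1..Suc n. step \<tau> l * h (\<tau> m - \<tau> (l - 1)))
          = (\<Sum>l=1..n. step \<tau> l * h (\<tau> m - \<tau> (l - 1))) + step \<tau> (Suc n) * h (\<tau> m - \<tau> n)" by simp
      moreover have "n < m" using Suc.prems by simp
      ultimately show ?case
        using Suc.IH set_integral_split_open[OF int[OF le(4) le(3)] le(1,2)] by linarith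
    qed
    moreover have "m - 1 < m" using m by auto
    moreover have "0 \<le> \<tau> m - \<tau> (m - 1)" "\<tau> m \<le> T" using mono[of "m-1" m] mono[of m M] m mesh(2) by auto
    moreover have "{1..<m} = {1..m - 1}" using m by auto
    ultimately show "(\<Sum>l\<in>{1..<m}. step \<tau> l * h (\<tau> m - \<tau> (l - 1))) \<le> (LINT s:{0<..<T}|lebesgue. h s)"
      using sub[of "\<tau> m - \<tau> (m - 1)" "\<tau> m"] by force
  }
  {
    fix l assume l: "l \<in> {1..M}"
    have "(\<Sum>m\<in>{l<..n}. step \<tau> m * h (\<tau> m - \<tau> (l - 1))) \<le> (LINT s:{0<..<\<tau> n - \<tau> (l - 1)}|lebesgue. h s)"
      if "l \<le> n" "n \<le> M" for n
      using that
    proof (induction n rule: dec_induct)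
      case base
      have "\<tau> l \<le> T" "0 \<le> \<tau> (l - 1)" using l mono[of l M] mono[of 0 "l-1"] mesh(1,2) by auto
      then have "0 \<le> (LINT s:{0<..<\<tau> l - \<tau> (l - 1)}|lebesgue. h s)"
        unfolding set_lebesgue_integral_def
        by (intro integral_nonneg_AE AE_I2) (auto simp: indicator_def intro!: h(3))
      then show ?case by simp
    next
      case (step n)
      have le: "\<tau> n \<le> \<tau> (Suc n)" "\<tau> (l - 1) \<le> \<tau> n" "\<tau> (Suc n) \<le> T" "0 \<le> \<tau> (l - 1)"
        using mono[of n "Suc n"] mono[of "l - 1" n] mono[of "Suc n" M] mono[of 0 "l - 1"] step l mesh by auto
      have "Defs.step \<tau> (Suc n) * h (\<tau> (Suc n) - \<tau> (l - 1))
          \<le> (LINT s:{\<tau> n - \<tau> (l - 1)<..<\<tau> (Suc n) - \<tau> (l - 1)}|lebesgue. h s)"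
        using antimono_step_le_integral[OF h(1,2), of "\<tau> n - \<tau> (l - 1)" "\<tau> (Suc n) - \<tau> (l - 1)"] le by (simp add: step_def)
      moreover have "{l<..Suc n} = insert (Suc n) {l<..n}" using step by auto
      then have "(\<Sum>m\<in>{l<..Suc n}. Defs.step \<tau> m * h (\<tau> m - \<tau> (l - 1)))
          = (\<Sum>m\<in>{l<..n}. Defs.step \<tau> m * h (\<tau> m - \<tau> (l - 1)))
            + Defs.step \<tau> (Suc n) * h (\<tau> (Suc n) - \<tau> (l - 1))" by simp
      moreover have "(LINT s:{0<..<\<tau> (Suc n) - \<tau> (l - 1)}|lebesgue. h s) = (LINT s:{0<..<\<tau> n - \<tau> (l - 1)}|lebesgue. h s)
          + (LINT s:{\<tau> n - \<tau> (l - 1)<..<\<tau> (Suc n) - \<tau> (l - 1)}|lebesgue. h s)"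
        by (rule set_integral_split_open[OF int]) (use le in auto)
      moreover have "n \<le> M" using step by simp
      ultimately show ?case using step.IH by linarith
    qed
    moreover have "l \<le> M" "0 \<le> \<tau> (l - 1)" using mono[of 0 "l - 1"] l mesh(1) by auto
    ultimately show "(\<Sum>m\<in>{l<..M}. step \<tau> m * h (\<tau> m - \<tau> (l - 1))) \<le> (LINT s:{0<..<T}|lebesgue. h s)"
      using sub[of 0 "\<tau> M - \<tau> (l - 1)"] mesh(2) by force
  }
qed

text \<open>The summands are bounded by differences of the logarithm, which telescope. The diagonal term,
  with quotient \<open>1\<close>, is kept apart, so that the arguments of the logarithms stay above \<open>\<delta>\<close>.\<close>

lemma reciprocal_kernel_sums:
  assumes mesh: "\<tau> 0 = 0" "\<tau> M = T" "\<forall>m\<in>{1..M}. \<tau> (m - 1) < \<tau> m"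
    and \<delta>: "0 < \<delta>" "\<And>m. m \<in> {1..M} \<Longrightarrow> \<delta> \<le> step \<tau> m"
  shows "m \<in> {1..M} \<Longrightarrow> (\<Sum>l\<in>{1..m}. step \<tau> l / (\<tau> m - \<tau> (l - 1))) \<le> 1 + ln (T / \<delta>)"
    and "l \<in> {1..M} \<Longrightarrow> (\<Sum>m\<in>{l..M}. step \<tau> m / (\<tau> m - \<tau> (l - 1))) \<le> 1 + ln (T / \<delta>)"
proof -
  note mono = mesh_mono[OF mesh(3)] and smono = mesh_strict_mono[OF mesh(3)]
  have ln_step: "(x - y) / x \<le> ln x - ln y" if "0 < y" "0 < x" for x y :: real
    using ln_diff_le[of y x] that by (simp add: field_simps)
  have fin: "ln x - ln (step \<tau> m) \<le> ln (T / \<delta>)" if "0 < x" "x \<le> T" "m \<in> {1..M}" for x m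
  proof -
    have "ln x \<le> ln T" "ln \<delta> \<le> ln (step \<tau> m)" using that \<delta>(1) \<delta>(2)[OF that(3)] by auto
    then have "ln x - ln (step \<tau> m) \<le> ln T - ln \<delta>" by linarith
    then show ?thesis using \<delta>(1) that by (simp add: ln_div)
  qed
  {
    fix m assume m: "m \<in> {1..M}"
    have "(\<Sum>l=1..n. step \<tau> l / (\<tau> m - \<tau> (l - 1))) \<le> ln (\<tau> m) - ln (\<tau> m - \<tau> n)" if "n < m" for n
      using that
    proof (induction n)
      case 0 then show ?case using mesh by simp
    next
      case (Suc n)
      have "step \<tau> (Suc n) / (\<tau> m - \<tau> n) \<le> ln (\<tau> m - \<tau> n) - ln (\<tau> m - \<tau> (Suc n))"
        using ln_step[of "\<tau> m - \<tau> (Suc n)" "\<tau> m - \<tau> n"] smono[of n m] smono[of "Suc n" m] Suc.prems m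
        by (simp add: step_def)
      then show ?case using Suc by simp
    qed
    from this[of "m - 1"] fin[of "\<tau> m" m] smono[of 0 m] mono[of m M] m mesh
    have "(\<Sum>l=1..m-1. step \<tau> l / (\<tau> m - \<tau> (l - 1))) \<le> ln (T / \<delta>)" by (simp add: step_def)
    moreover have "(\<Sum>l\<in>{1..m}. step \<tau> l / (\<tau> m - \<tau> (l - 1)))
        = (\<Sum>l=1..m-1. step \<tau> l / (\<tau> m - \<tau> (l - 1))) + step \<tau> m / (\<tau> m - \<tau> (m - 1))"
      using m by (cases m) auto
    moreover have "step \<tau> m / (\<tau> m - \<tau> (m - 1)) = 1" using smono[of "m-1" m] m by (simp add: step_def)
    ultimately show "(\<Sum>l\<in>{1..m}. step \<tau> l / (\<tau> m - \<tau> (l - 1))) \<le> 1 + ln (T / \<delta>)" by linarith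
  }
  {
    fix l assume l: "l \<in> {1..M}"
    have "(\<Sum>m\<in>{l<..n}. step \<tau> m / (\<tau> m - \<tau> (l - 1))) \<le> ln (\<tau> n - \<tau> (l - 1)) - ln (step \<tau> l)"
      if "l \<le> n" "n \<le> M" for n
      using that
    proof (induction n rule: dec_induct)
      case base then show ?case by (simp add: step_def)
    next
      case (step n)
      have "Defs.step \<tau> (Suc n) / (\<tau> (Suc n) - \<tau> (l - 1)) \<le> ln (\<tau> (Suc n) - \<tau> (l - 1)) - ln (\<tau> n - \<tau> (l - 1))"
        using ln_step[of "\<tau> n - \<tau> (l - 1)" "\<tau> (Suc n) - \<tau> (l - 1)"] smono[of "l - 1" n] smono[of "l - 1" "Suc n"] step l
        by (simp add: step_def)
      moreover have "{l<..Suc n} = insert (Suc n) {l<..n}" using step by auto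
      ultimately show ?case using step by simp
    qed
    moreover have "l - 1 < M" "l - 1 \<le> M" "l \<le> M" using l by auto
    ultimately have "(\<Sum>m\<in>{l<..M}. step \<tau> m / (\<tau> m - \<tau> (l - 1))) \<le> ln (T / \<delta>)"
      using fin[of "\<tau> M - \<tau> (l-1)" l] smono[of "l-1" M] mono[of 0 "l-1"] l mesh(1,2) by fastforce
    moreover have "{l..M} = insert l {l<..M}" using l by auto
    moreover have "step \<tau> l / (\<tau> l - \<tau> (l - 1)) = 1" using smono[of "l-1" l] l by (simp add: step_def)
    ultimately show "(\<Sum>m\<in>{l..M}. step \<tau> m / (\<tau> m - \<tau> (l - 1))) \<le> 1 + ln (T / \<delta>)" by simp
  }
qed

text \<open>Dominated convergence as the rate grows.\<close>

lemma exponential_weight_small: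
  fixes h :: "real \<Rightarrow> real"
  assumes h: "set_integrable lebesgue {0<..<T} h" and "0 < \<epsilon>"
  shows "\<exists>\<nu>>0. (LINT s:{0<..<T}|lebesgue. h s * exp (- \<nu> * s)) \<le> \<epsilon>"
proof -
  have "(\<lambda>n. LINT s|lebesgue. indicator {0<..<T} s *\<^sub>R h s * exp (- real (Suc n) * s))
      \<longlonglongrightarrow> (\<integral>s. 0 \<partial>(lebesgue :: real measure))"
  proof (rule integral_dominated_convergence[where f = "\<lambda>s. 0"
        and s = "\<lambda>n s. indicator {0<..<T} s *\<^sub>R h s * exp (- real (Suc n) * s)" and w = "\<lambda>s. \<bar>indicator {0<..<T} s *\<^sub>R h s\<bar>"])
    show "integrable lebesgue (\<lambda>s. \<bar>indicator {0<..<T} s *\<^sub>R h s\<bar>)"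
      using h unfolding set_integrable_def by (rule integrable_abs)
    have m: "(\<lambda>s. indicator {0<..<T} s *\<^sub>R h s) \<in> borel_measurable lebesgue"
      using h unfolding set_integrable_def by auto
    have e: "(\<lambda>s. exp (- real (Suc n) * s)) \<in> borel_measurable lebesgue" for n
      by (intro borel_measurable_continuous_onI measurable_completion) (auto intro!: continuous_intros)
    show "(\<lambda>s. indicator {0<..<T} s *\<^sub>R h s * exp (- real (Suc n) * s)) \<in> borel_measurable lebesgue" for n
      using m e[of n] by (rule borel_measurable_times)
    show "AE s in lebesgue. (\<lambda>n. indicator {0<..<T} s *\<^sub>R h s * exp (- real (Suc n) * s)) \<longlonglongrightarrow> 0"
    proof (rule AE_I2)
      fix s :: real
      show "(\<lambda>n. indicator {0<..<T} s *\<^sub>R h s * exp (- real (Suc n) * s)) \<longlonglongrightarrow> 0"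
      proof (cases "s \<in> {0<..<T}")
        case True
        have "(\<lambda>n. exp (- s) ^ Suc n) \<longlonglongrightarrow> 0"
          using True by (intro LIMSEQ_Suc LIMSEQ_realpow_zero) auto
        then have "(\<lambda>n. exp (- real (Suc n) * s)) \<longlonglongrightarrow> 0"
          by (simp only: exp_of_nat_mult[symmetric] mult_minus_left mult_minus_right)
        from tendsto_mult_right_zero[OF this] show ?thesis by blast
      qed simp
    qed
    show "AE s in lebesgue. norm (indicator {0<..<T} s *\<^sub>R h s * exp (- real (Suc n) * s))
        \<le> \<bar>indicator {0<..<T} s *\<^sub>R h s\<bar>" for n
      by (rule AE_I2) (auto simp: abs_mult indicator_def intro!: mult_left_le mult_nonpos_nonneg)
  qed simp
  then have "eventually (\<lambda>n. (LINT s|lebesgue. indicator {0<..<T} s *\<^sub>R h s * exp (- real (Suc n) * s)) < \<epsilon>) sequentially"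
    using \<open>0 < \<epsilon>\<close> by (intro order_tendstoD) auto
  then obtain n where "(LINT s|lebesgue. indicator {0<..<T} s *\<^sub>R h s * exp (- real (Suc n) * s)) < \<epsilon>"
    by (auto simp: eventually_sequentially)
  then show ?thesis
    by (intro exI[of _ "real (Suc n)"]) (auto simp: set_lebesgue_integral_def mult.assoc less_imp_le simp del: of_nat_Suc)
qed


lemma sum_if_le:
  fixes f :: "nat \<Rightarrow> real"
  assumes "m \<in> {1..M}"
  shows "(\<Sum>l=1..M. if l \<le> m then f l else 0) = (\<Sum>l=1..m. f l)"
    and "(\<Sum>l=1..M. if l < m then f l else 0) = (\<Sum>l\<in>{1..<m}. f l)"
    and "(\<Sum>l=1..M. if m \<le> l then f l else 0) = (\<Sum>l\<in>{m..M}. f l)"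
    and "(\<Sum>l=1..M. if m < l then f l else 0) = (\<Sum>l\<in>{m<..M}. f l)"
  by (rule sum.mono_neutral_cong_right; use assms in auto)+

text \<open>After multiplication by \<open>exp (- \<mu> \<tau>\<^sub>m)\<close> the singular kernel has small row and column sums and is
  absorbed. Neighbouring steps are comparable, so \<open>\<tau>\<^sub>m - \<tau>\<^sub>l\<close> is at least the fraction \<open>1 / (1 + \<kappa>)\<close> of
  \<open>\<tau>\<^sub>m - \<tau>\<^sub>l\<^sub>-\<^sub>1\<close>; this lets the weight be moved to the argument of the kernel, which stays decreasing.\<close>

lemma log_kernel_estimate:
  fixes h :: "real \<Rightarrow> real"
  assumes "T > 0" and h: "antimono_on {0<..T} h" "set_integrable lebesgue {0<..<T} h" "\<And>s. s \<in> {0<..T} \<Longrightarrow> 0 \<le> h s"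
    and "c > 0" "\<beta> > 0" "\<kappa> > 0" "0 < C2" "0 < C3"
  shows "\<exists>\<mu>>0. \<exists>C>0. \<forall>\<tau> M p \<phi> Y. admissible_mesh T c \<beta> \<kappa> \<tau> M \<longrightarrow> 1 \<le> p \<longrightarrow>
    (\<forall>m\<in>{1..M}. 0 \<le> \<phi> m \<and> 0 \<le> Y m \<and>
       Y m \<le> C2 * (\<Sum>l=1..m. step \<tau> l * \<phi> l / (\<tau> m - \<tau> (l - 1)))
            + C3 * (\<Sum>l\<in>{1..<m}. step \<tau> l * h (\<tau> m - \<tau> (l - 1)) * Y l)) \<longrightarrow>
    (\<Sum>m=1..M. step \<tau> m * Y m powr p)
      \<le> (C * exp (\<mu> * T) * ln (T / max_step \<tau> M)) powr p * (\<Sum>m=1..M. step \<tau> m * \<phi> m powr p)"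
proof -
  \<comment> \<open>The sums of the weighted kernel are at most \<open>1/4\<close>; convexity doubles this, and \<open>1/2\<close> can be absorbed.\<close>
  obtain \<nu> where \<nu>: "\<nu> > 0" "(LINT s:{0<..<T}|lebesgue. h s * exp (- \<nu> * s)) \<le> 1 / (4 * C3)"
    using exponential_weight_small[OF h(2), of "1 / (4 * C3)"] \<open>0 < C3\<close> by auto
  define \<mu> where "\<mu> = \<nu> * (1 + \<kappa>)"
  have \<mu>: "\<mu> > 0" using \<nu> \<open>\<kappa> > 0\<close> by (simp add: \<mu>_def)
  define g where "g s = h s * exp (- \<nu> * s)" for s
  have g: "antimono_on {0<..T} g" "set_integrable lebesgue {0<..<T} g" "\<And>s. s \<in> {0<..T} \<Longrightarrow> 0 \<le> g s"
  proof -
    show "antimono_on {0<..T} g"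
    proof (rule monotone_onI)
      fix x y assume xy: "x \<in> {0<..T}" "y \<in> {0<..T}" "x \<le> y"
      have "h y * exp (- \<nu> * y) \<le> h x * exp (- \<nu> * x)"
        using monotone_onD[OF h(1) xy] h(3)[OF xy(2)] h(3)[OF xy(1)] \<nu> xy(3) by (intro mult_mono) auto
      then show "g x \<ge> g y" by (simp add: g_def)
    qed
    show "0 \<le> g s" if "s \<in> {0<..T}" for s using h(3)[OF that] by (simp add: g_def)
    show "set_integrable lebesgue {0<..<T} g" unfolding set_integrable_def
    proof (rule Bochner_Integration.integrable_bound)
      show i: "integrable lebesgue (\<lambda>s. indicator {0<..<T} s *\<^sub>R h s)" using h(2) by (simp add: set_integrable_def)
      have e: "(\<lambda>s. exp (- \<nu> * s)) \<in> borel_measurable lebesgue"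
        by (intro borel_measurable_continuous_onI measurable_completion) (auto intro!: continuous_intros)
      have "(\<lambda>s. indicator {0<..<T} s *\<^sub>R h s * exp (- \<nu> * s)) \<in> borel_measurable lebesgue"
        using borel_measurable_integrable[OF i] e by (rule borel_measurable_times)
      then show "(\<lambda>s. indicator {0<..<T} s *\<^sub>R g s) \<in> borel_measurable lebesgue" by (simp add: g_def mult.assoc)
      show "AE s in lebesgue. norm (indicator {0<..<T} s *\<^sub>R g s) \<le> norm (indicator {0<..<T} s *\<^sub>R h s)"
        using \<nu> by (intro AE_I2) (auto simp: g_def abs_mult indicator_def intro!: mult_left_le)
    qed
  qed
  have gint: "C3 * (LINT s:{0<..<T}|lebesgue. g s) \<le> 1 / 4"
  proof -
    have "C3 * (LINT s:{0<..<T}|lebesgue. g s) \<le> C3 * (1 / (4 * C3))"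
      using \<nu>(2) \<open>0 < C3\<close> unfolding g_def by (intro mult_left_mono) auto
    then show ?thesis using \<open>0 < C3\<close> by simp
  qed
  \<comment> \<open>This turns \<open>1 + ln (T / k\<^sub>m\<^sub>i\<^sub>n)\<close> into a multiple of \<open>ln (T / k)\<close>, by \<open>k\<^sub>m\<^sub>i\<^sub>n \<ge> c * k powr \<beta>\<close> and \<open>ln (T / k) \<ge> ln 4\<close>.\<close>
  define L0 where "L0 = (1 + \<bar>ln (T powr (1 - \<beta>) / c)\<bar>) / ln 4 + \<beta>"
  have "ln 4 > (0::real)" by simp
  then have L0: "L0 > 0" using \<open>\<beta> > 0\<close> unfolding L0_def by (intro add_nonneg_pos) auto
  define C where "C = 2 * C2 * L0"
  have C: "C > 0" using \<open>0 < C2\<close> L0 by (simp add: C_def)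
  have "(\<Sum>m=1..M. step \<tau> m * Y m powr p)
      \<le> (C * exp (\<mu> * T) * ln (T / max_step \<tau> M)) powr p * (\<Sum>m=1..M. step \<tau> m * \<phi> m powr p)"
    if adm: "admissible_mesh T c \<beta> \<kappa> \<tau> M" and p: "1 \<le> p" and
      Y: "\<forall>m\<in>{1..M}. 0 \<le> \<phi> m \<and> 0 \<le> Y m \<and>
       Y m \<le> C2 * (\<Sum>l=1..m. step \<tau> l * \<phi> l / (\<tau> m - \<tau> (l - 1)))
            + C3 * (\<Sum>l\<in>{1..<m}. step \<tau> l * h (\<tau> m - \<tau> (l - 1)) * Y l)" for \<tau> M p \<phi> Y
  proof -
    have mesh: "\<tau> 0 = 0" "\<tau> M = T" "\<forall>m\<in>{1..M}. \<tau> (m - 1) < \<tau> m" and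
      mn: "min_step \<tau> M \<ge> c * max_step \<tau> M powr \<beta>" and mx: "max_step \<tau> M \<le> T / 4" and
      rat: "\<forall>m \<in> {1..M - 1}. 1 / \<kappa> \<le> step \<tau> m / step \<tau> (m + 1) \<and> step \<tau> m / step \<tau> (m + 1) \<le> \<kappa>"
      using adm by (auto simp: admissible_mesh_def)
    note mono = mesh_mono[OF mesh(3)] and smono = mesh_strict_mono[OF mesh(3)]
    have M: "1 \<le> M" using mesh \<open>T > 0\<close> by (cases M) auto
    have sp: "0 < step \<tau> m" if "m \<in> {1..M}" for m using mesh(3) that by (auto simp: step_def)
    define K where "K = max_step \<tau> M"
    have K: "0 < K" "K \<le> T / 4"
    proof -
      have "step \<tau> 1 \<le> K" unfolding K_def max_step_def using M by (intro Max_ge) auto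
      then show "0 < K" using sp[of 1] M by auto
    qed (use mx in \<open>simp add: K_def\<close>)
    define L where "L = ln (T / K)"
    have L4: "ln 4 \<le> L" unfolding L_def using K \<open>T > 0\<close> by (subst ln_le_cancel_iff) (auto simp: field_simps)
    then have L_pos: "0 < L" using ln_gt_zero[of "4::real"] by linarith
    define \<delta> where "\<delta> = c * K powr \<beta>"
    have \<delta>: "0 < \<delta>" "\<And>m. m \<in> {1..M} \<Longrightarrow> \<delta> \<le> step \<tau> m"
    proof -
      show "0 < \<delta>" using \<open>c > 0\<close> K by (simp add: \<delta>_def)
      fix m assume "m \<in> {1..M}"
      then have "min_step \<tau> M \<le> step \<tau> m" unfolding min_step_def by (intro Min_le) auto
      then show "\<delta> \<le> step \<tau> m" using mn by (simp add: \<delta>_def K_def)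
    qed
    define \<rho> where "\<rho> = 1 + ln (T / \<delta>)"
    have \<rho>L: "\<rho> \<le> L0 * L"
    proof -
      have "ln (T / \<delta>) = ln (T powr (1 - \<beta>) / c) + \<beta> * L"
        unfolding \<delta>_def L_def using K \<open>T > 0\<close> \<open>c > 0\<close> by (simp add: ln_div ln_mult ln_powr algebra_simps)
      then have "\<rho> \<le> (1 + \<bar>ln (T powr (1 - \<beta>) / c)\<bar>) * 1 + \<beta> * L" by (simp add: \<rho>_def)
      also have "\<dots> \<le> (1 + \<bar>ln (T powr (1 - \<beta>) / c)\<bar>) * (L / ln 4) + \<beta> * L"
        using L4 by (intro add_right_mono mult_left_mono) auto
      finally show ?thesis by (simp add: L0_def algebra_simps add_divide_distrib)
    qed
    have \<rho>0: "0 \<le> \<rho>"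
    proof -
      have "step \<tau> 1 = \<tau> 1" by (simp add: step_def mesh(1))
      moreover have "\<tau> 1 \<le> T" using mono[of 1 M] M mesh(2) by simp
      ultimately have "\<delta> \<le> T" using \<delta>(2)[of 1] M by simp
      then show ?thesis using \<delta>(1) by (simp add: \<rho>_def)
    qed
    define I where "I = {1..M}"
    define K1 where "K1 m l = (if l \<le> m then 1 / (\<tau> m - \<tau> (l - 1)) else 0)" for m l
    define H where "H m l = (if l < m then C3 * g (\<tau> m - \<tau> (l - 1)) else 0)" for m l
    define y where "y m = exp (- \<mu> * \<tau> m) * Y m" for m
    define b where "b m = (\<Sum>l\<in>I. K1 m l * step \<tau> l * \<phi> l)" for m
    define \<Phi> where "\<Phi> = (\<Sum>m\<in>I. step \<tau> m * \<phi> m powr p)"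
    define X where "X = (\<Sum>m\<in>I. step \<tau> m * y m powr p)"
    have tpos: "0 < \<tau> m - \<tau> (l - 1)" "\<tau> m - \<tau> (l - 1) \<le> T" if "l \<le> m" "l \<in> I" "m \<in> I" for l m
    proof -
      have 1: "l - 1 < m" "m \<le> M" "l - 1 \<le> M" using that by (auto simp: I_def)
      show "0 < \<tau> m - \<tau> (l - 1)" using smono[OF 1(1,2)] by linarith
      have "0 \<le> \<tau> (l - 1)" using mono[of 0 "l - 1"] 1 mesh(1) by simp
      then show "\<tau> m - \<tau> (l - 1) \<le> T" using mono[of m M] 1 mesh(2) by simp
    qed
    have y0: "0 \<le> y m" if "m \<in> I" for m using Y that by (simp add: y_def I_def)
    have \<phi>0: "0 \<le> \<phi> m" if "m \<in> I" for m using Y that by (simp add: I_def)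
    have K10: "0 \<le> K1 m l" "0 \<le> H m l" if "m \<in> I" "l \<in> I" for m l
      using tpos[of l m] that g(3) \<open>0 < C3\<close> by (auto simp: K1_def H_def)
    have b0: "0 \<le> b m" if "m \<in> I" for m
      unfolding b_def using K10 \<phi>0 sp that by (intro sum_nonneg mult_nonneg_nonneg) (auto simp: I_def less_imp_le)
    have I: "finite I" by (simp add: I_def)
    have B: "(\<Sum>m\<in>I. step \<tau> m * b m powr p) \<le> \<rho> powr p * \<Phi>"
      unfolding b_def \<Phi>_def
    proof (rule discrete_Schur_test[OF I K10(1) _ \<phi>0 p \<rho>0])
      fix m assume m: "m \<in> I"
      show "0 \<le> step \<tau> m" using sp m by (auto simp: I_def less_imp_le)
      have "(\<Sum>l\<in>I. K1 m l * step \<tau> l) = (\<Sum>l=1..M. if l \<le> m then step \<tau> l / (\<tau> m - \<tau> (l - 1)) else 0)"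
        unfolding I_def by (intro sum.cong) (auto simp: K1_def)
      also have "\<dots> \<le> \<rho>" using reciprocal_kernel_sums(1)[OF mesh \<delta>, of m] m sum_if_le(1)[of m M]
        by (simp add: I_def \<rho>_def)
      finally show "(\<Sum>l\<in>I. K1 m l * step \<tau> l) \<le> \<rho>" .
      have "(\<Sum>l\<in>I. step \<tau> l * K1 l m) = (\<Sum>l=1..M. if m \<le> l then step \<tau> l / (\<tau> l - \<tau> (m - 1)) else 0)"
        unfolding I_def by (intro sum.cong) (auto simp: K1_def)
      also have "\<dots> \<le> \<rho>" using reciprocal_kernel_sums(2)[OF mesh \<delta>, of m] m sum_if_le(3)[of m M]
        by (simp add: I_def \<rho>_def)
      finally show "(\<Sum>l\<in>I. step \<tau> l * K1 l m) \<le> \<rho>" .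
    qed
    have HX: "(\<Sum>m\<in>I. step \<tau> m * (\<Sum>l\<in>I. H m l * step \<tau> l * y l) powr p) \<le> (1/4) powr p * X"
      unfolding X_def
    proof (rule discrete_Schur_test[OF I K10(2) _ y0 p])
      fix m assume m: "m \<in> I"
      show "0 \<le> step \<tau> m" using sp m by (auto simp: I_def less_imp_le)
      have "(\<Sum>l\<in>I. H m l * step \<tau> l) = C3 * (\<Sum>l=1..M. if l < m then step \<tau> l * g (\<tau> m - \<tau> (l - 1)) else 0)"
        unfolding I_def sum_distrib_left by (intro sum.cong) (auto simp: H_def)
      also have "\<dots> \<le> C3 * (LINT s:{0<..<T}|lebesgue. g s)"
        using antimono_kernel_sums(1)[OF mesh g, of m] m sum_if_le(2)[of m M] \<open>0 < C3\<close>
        by (intro mult_left_mono) (auto simp: I_def)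
      finally show "(\<Sum>l\<in>I. H m l * step \<tau> l) \<le> 1/4" using gint by simp
      have "(\<Sum>l\<in>I. step \<tau> l * H l m) = C3 * (\<Sum>l=1..M. if m < l then step \<tau> l * g (\<tau> l - \<tau> (m - 1)) else 0)"
        unfolding I_def sum_distrib_left by (intro sum.cong) (auto simp: H_def)
      also have "\<dots> \<le> C3 * (LINT s:{0<..<T}|lebesgue. g s)"
        using antimono_kernel_sums(2)[OF mesh g, of m] m sum_if_le(4)[of m M] \<open>0 < C3\<close>
        by (intro mult_left_mono) (auto simp: I_def)
      finally show "(\<Sum>l\<in>I. step \<tau> l * H l m) \<le> 1/4" using gint by simp
    qed auto
    have yb: "y m \<le> C2 * b m + (\<Sum>l\<in>I. H m l * step \<tau> l * y l)" if m: "m \<in> I" for m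
    proof -
      have weight: "exp (- \<mu> * \<tau> m) * h (\<tau> m - \<tau> (l - 1)) \<le> g (\<tau> m - \<tau> (l - 1)) * exp (- \<mu> * \<tau> l)"
        if l: "l \<in> {1..<m}" for l
      proof -
        have "step \<tau> l \<le> \<kappa> * step \<tau> (Suc l)"
        proof -
          have "l \<in> {1..M-1}" "Suc l \<in> {1..M}" using l m by (auto simp: I_def)
          then have "step \<tau> l / step \<tau> (Suc l) \<le> \<kappa>" "0 < step \<tau> (Suc l)" using rat sp by force+
          then show ?thesis by (simp add: pos_divide_le_eq)
        qed
        also have "\<dots> \<le> \<kappa> * (\<tau> m - \<tau> l)"
        proof -
          have "\<tau> (Suc l) \<le> \<tau> m" by (rule mono) (use l m in \<open>auto simp: I_def\<close>)
          then show ?thesis using \<open>\<kappa> > 0\<close> by (simp add: step_def)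
        qed
        finally have "\<tau> m - \<tau> (l - 1) \<le> (1 + \<kappa>) * (\<tau> m - \<tau> l)" by (simp add: step_def algebra_simps)
        then have "\<nu> * (\<tau> m - \<tau> (l - 1)) \<le> \<mu> * (\<tau> m - \<tau> l)"
          using \<nu>(1) mult_left_mono[of "\<tau> m - \<tau> (l - 1)" "(1 + \<kappa>) * (\<tau> m - \<tau> l)" \<nu>]
          by (simp add: \<mu>_def mult.assoc)
        then have "exp (- \<mu> * \<tau> m) \<le> exp (- \<nu> * (\<tau> m - \<tau> (l - 1))) * exp (- \<mu> * \<tau> l)"
          by (simp add: exp_add[symmetric] algebra_simps)
        moreover have "0 \<le> h (\<tau> m - \<tau> (l - 1))" using tpos[of l m] h(3) l m by (auto simp: I_def)
        ultimately have "h (\<tau> m - \<tau> (l - 1)) * exp (- \<mu> * \<tau> m)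
          \<le> h (\<tau> m - \<tau> (l - 1)) * (exp (- \<nu> * (\<tau> m - \<tau> (l - 1))) * exp (- \<mu> * \<tau> l))"
          by (rule mult_left_mono)
        then show ?thesis by (simp add: g_def mult_ac)
      qed
      have bm: "b m = (\<Sum>l=1..m. step \<tau> l * \<phi> l / (\<tau> m - \<tau> (l - 1)))"
        using sum_if_le(1)[of m M "\<lambda>l. step \<tau> l * \<phi> l / (\<tau> m - \<tau> (l - 1))"] m
        unfolding b_def I_def by (simp add: K1_def if_distrib if_distribR cong: if_cong)
      have Hm: "(\<Sum>l\<in>I. H m l * step \<tau> l * y l) = (\<Sum>l\<in>{1..<m}. C3 * g (\<tau> m - \<tau> (l - 1)) * step \<tau> l * y l)"
        using sum_if_le(2)[of m M "\<lambda>l. C3 * g (\<tau> m - \<tau> (l - 1)) * step \<tau> l * y l"] m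
        unfolding I_def by (simp add: H_def if_distrib if_distribR cong: if_cong)
      have e1: "exp (- \<mu> * \<tau> m) \<le> 1" using \<mu> mono[of 0 m] mesh m by (simp add: I_def)
      have "y m \<le> exp (- \<mu> * \<tau> m) * (C2 * b m + C3 * (\<Sum>l\<in>{1..<m}. step \<tau> l * h (\<tau> m - \<tau> (l - 1)) * Y l))"
        unfolding y_def bm using Y m by (intro mult_left_mono) (auto simp: I_def)
      also have "\<dots> = exp (- \<mu> * \<tau> m) * (C2 * b m)
          + (\<Sum>l\<in>{1..<m}. C3 * step \<tau> l * Y l * (exp (- \<mu> * \<tau> m) * h (\<tau> m - \<tau> (l - 1))))"
        by (simp add: distrib_left sum_distrib_left mult_ac)
      also have "\<dots> \<le> 1 * (C2 * b m) + (\<Sum>l\<in>{1..<m}. C3 * step \<tau> l * Y l * (g (\<tau> m - \<tau> (l - 1)) * exp (- \<mu> * \<tau> l)))"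
      proof (intro add_mono mult_right_mono sum_mono mult_left_mono weight e1)
        show "0 \<le> C2 * b m" using b0[OF m] \<open>0 < C2\<close> by simp
        show "0 \<le> C3 * step \<tau> l * Y l" if "l \<in> {1..<m}" for l
          using that m sp[of l] Y \<open>0 < C3\<close> by (auto simp: I_def)
      qed
      finally show ?thesis unfolding Hm by (simp add: y_def mult_ac)
    qed
    have Xle: "X \<le> (2 * C2 * \<rho>) powr p / 2 * \<Phi> + X / 2"
    proof -
      have "X \<le> (\<Sum>m\<in>I. step \<tau> m * (((2 * (C2 * b m)) powr p + (2 * (\<Sum>l\<in>I. H m l * step \<tau> l * y l)) powr p) / 2))"
        unfolding X_def
      proof (intro sum_mono mult_left_mono)
        fix m assume m: "m \<in> I"
        have H0: "0 \<le> (\<Sum>l\<in>I. H m l * step \<tau> l * y l)"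
          using K10 m y0 sp by (intro sum_nonneg mult_nonneg_nonneg) (auto simp: I_def less_imp_le)
        have "y m powr p \<le> (C2 * b m + (\<Sum>l\<in>I. H m l * step \<tau> l * y l)) powr p"
          using yb[OF m] y0[OF m] p by (intro powr_mono2) auto
        also have "\<dots> \<le> ((2 * (C2 * b m)) powr p + (2 * (\<Sum>l\<in>I. H m l * step \<tau> l * y l)) powr p) / 2"
          using b0[OF m] H0 p \<open>0 < C2\<close> by (intro powr_half_sum_le) auto
        finally show "y m powr p \<le> ((2 * (C2 * b m)) powr p + (2 * (\<Sum>l\<in>I. H m l * step \<tau> l * y l)) powr p) / 2" .
        show "0 \<le> step \<tau> m" using sp m by (auto simp: I_def less_imp_le)
      qed
      also have "\<dots> = (2 * C2) powr p / 2 * (\<Sum>m\<in>I. step \<tau> m * b m powr p)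
          + 2 powr p / 2 * (\<Sum>m\<in>I. step \<tau> m * (\<Sum>l\<in>I. H m l * step \<tau> l * y l) powr p)"
      proof -
        have *: "((2 * (C2 * x)) powr p + (2 * z) powr p) / 2
            = (2 * C2) powr p / 2 * x powr p + 2 powr p / 2 * z powr p" for x z
          by (simp add: powr_mult add_divide_distrib mult.assoc)
        show ?thesis unfolding * by (simp add: distrib_left sum.distrib sum_distrib_left mult.left_commute)
      qed
      also have "\<dots> \<le> (2 * C2) powr p / 2 * (\<rho> powr p * \<Phi>) + 2 powr p / 2 * ((1/4) powr p * X)"
        using B HX by (intro add_mono mult_left_mono) auto
      also have "\<dots> \<le> (2 * C2 * \<rho>) powr p / 2 * \<Phi> + X / 2"
      proof -
        have X0: "0 \<le> X" unfolding X_def using sp by (intro sum_nonneg mult_nonneg_nonneg) (auto simp: I_def less_imp_le)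
        have "2 powr p * (1/4) powr p = (1/2 :: real) powr p" by (simp add: powr_mult[symmetric])
        also have "\<dots> \<le> 1" using p by (intro powr_le1) auto
        finally have "2 powr p * (1/4) powr p * X \<le> 1 * X" using X0 by (intro mult_right_mono) auto
        then show ?thesis by (simp add: powr_mult mult_ac)
      qed
      finally show ?thesis .
    qed
    have \<Phi>0: "0 \<le> \<Phi>" unfolding \<Phi>_def using sp by (intro sum_nonneg mult_nonneg_nonneg) (auto simp: I_def less_imp_le)
    have "(\<Sum>m\<in>I. step \<tau> m * Y m powr p) \<le> (\<Sum>m\<in>I. step \<tau> m * (exp (\<mu> * T) powr p * y m powr p))"
    proof (intro sum_mono mult_left_mono)
      fix m assume m: "m \<in> I"
      have "Y m = exp (\<mu> * \<tau> m) * y m" by (simp add: y_def mult.assoc[symmetric] exp_add[symmetric])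
      also have "\<dots> \<le> exp (\<mu> * T) * y m"
        using mono[of m M] mesh m \<mu> y0[OF m] by (intro mult_right_mono) (auto simp: I_def)
      finally have "Y m powr p \<le> (exp (\<mu> * T) * y m) powr p"
        using Y m p by (intro powr_mono2) (auto simp: I_def)
      then show "Y m powr p \<le> exp (\<mu> * T) powr p * y m powr p" by (simp add: powr_mult)
      show "0 \<le> step \<tau> m" using sp m by (auto simp: I_def less_imp_le)
    qed
    also have "\<dots> = exp (\<mu> * T) powr p * X" by (simp add: X_def sum_distrib_left mult_ac)
    also have "\<dots> \<le> exp (\<mu> * T) powr p * ((2 * C2 * \<rho>) powr p * \<Phi>)"
      using Xle by (intro mult_left_mono) auto
    also have "\<dots> \<le> exp (\<mu> * T) powr p * ((C * L) powr p * \<Phi>)"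
      using \<rho>L \<rho>0 \<open>0 < C2\<close> p \<Phi>0 by (intro mult_left_mono mult_right_mono powr_mono2) (auto simp: C_def)
    also have "\<dots> = (C * exp (\<mu> * T) * L) powr p * \<Phi>" by (simp add: powr_mult mult_ac)
    finally show ?thesis by (simp add: I_def \<Phi>_def L_def K_def)
  qed
  then show ?thesis using \<mu> C by blast
qed

section \<open>Square integrable functions\<close>

lemma L2_measurable: "u \<in> L2 \<Omega> \<Longrightarrow> u \<in> borel_measurable (lebesgue_on \<Omega>)"
  by (simp add: L2_def)

lemma L2_integrable_mult:
  assumes "u \<in> L2 \<Omega>" "v \<in> L2 \<Omega>"
  shows "integrable (lebesgue_on \<Omega>) (\<lambda>x. u x * v x)"
proof (rule Bochner_Integration.integrable_bound)
  show "integrable (lebesgue_on \<Omega>) (\<lambda>x. (u x)\<^sup>2 + (v x)\<^sup>2)"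
    using assms by (intro Bochner_Integration.integrable_add) (auto simp: L2_def)
  show "(\<lambda>x. u x * v x) \<in> borel_measurable (lebesgue_on \<Omega>)"
    using assms by (intro borel_measurable_times) (auto simp: L2_def)
  have "\<bar>a * b\<bar> \<le> a\<^sup>2 + b\<^sup>2" for a b :: real
  proof -
    have "0 \<le> \<bar>a\<bar> * \<bar>b\<bar>" by simp
    then show ?thesis using sum_squares_bound[of "\<bar>a\<bar>" "\<bar>b\<bar>"] by (simp add: abs_mult del: zero_le_mult_iff mult_nonneg_nonneg)
  qed
  then show "AE x in lebesgue_on \<Omega>. norm (u x * v x) \<le> norm ((u x)\<^sup>2 + (v x)\<^sup>2)" by auto
qed

lemma L2_add: "u \<in> L2 \<Omega> \<Longrightarrow> v \<in> L2 \<Omega> \<Longrightarrow> (\<lambda>x. u x + v x) \<in> L2 \<Omega>"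
  using L2_integrable_mult[of u \<Omega> v]
  by (auto simp: L2_def power2_sum mult.assoc intro!: Bochner_Integration.integrable_add integrable_mult_right)

lemma L2_scale: "u \<in> L2 \<Omega> \<Longrightarrow> (\<lambda>x. c * u x) \<in> L2 \<Omega>"
  by (auto simp: L2_def power_mult_distrib intro!: integrable_mult_right)

lemma L2_diff: "u \<in> L2 \<Omega> \<Longrightarrow> v \<in> L2 \<Omega> \<Longrightarrow> (\<lambda>x. u x - v x) \<in> L2 \<Omega>"
  using L2_add[of u \<Omega> "\<lambda>x. -1 * v x"] L2_scale[of v \<Omega> "-1"] by simp

lemma L2_divide: "u \<in> L2 \<Omega> \<Longrightarrow> (\<lambda>x. u x / c) \<in> L2 \<Omega>"
  using L2_scale[of u \<Omega> "1/c"] by simp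

lemma L2_zero: "(\<lambda>x. 0) \<in> L2 \<Omega>"
  by (auto simp: L2_def)

lemma L2_sum: "(\<And>i. i \<in> I \<Longrightarrow> u i \<in> L2 \<Omega>) \<Longrightarrow> (\<lambda>x. \<Sum>i\<in>I. u i x) \<in> L2 \<Omega>"
  by (induction I rule: infinite_finite_induct) (auto intro: L2_add L2_zero)

lemma L2_abs: "u \<in> L2 \<Omega> \<Longrightarrow> (\<lambda>x. \<bar>u x\<bar>) \<in> L2 \<Omega>"
  by (auto simp: L2_def)

lemma L2_bounded_by:
  assumes "v \<in> L2 \<Omega>" "u \<in> borel_measurable (lebesgue_on \<Omega>)" "AE x in lebesgue_on \<Omega>. \<bar>u x\<bar> \<le> \<bar>v x\<bar>"
  shows "u \<in> L2 \<Omega>"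
proof -
  have "integrable (lebesgue_on \<Omega>) (\<lambda>x. (u x)\<^sup>2)"
  proof (rule Bochner_Integration.integrable_bound)
    show "integrable (lebesgue_on \<Omega>) (\<lambda>x. (v x)\<^sup>2)" using assms by (simp add: L2_def)
    show "AE x in lebesgue_on \<Omega>. norm ((u x)\<^sup>2) \<le> norm ((v x)\<^sup>2)"
      using assms(3) by eventually_elim (simp add: abs_le_square_iff)
  qed (use assms in auto)
  then show ?thesis using assms by (simp add: L2_def)
qed

lemma L2_inner_sym: "L2_inner \<Omega> u v = L2_inner \<Omega> v u"
  by (simp add: L2_inner_def mult.commute)

lemma L2_inner_add_left:
  "u \<in> L2 \<Omega> \<Longrightarrow> v \<in> L2 \<Omega> \<Longrightarrow> w \<in> L2 \<Omega> \<Longrightarrow> L2_inner \<Omega> (\<lambda>x. u x + v x) w = L2_inner \<Omega> u w + L2_inner \<Omega> v w"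
  by (simp add: L2_inner_def distrib_right L2_integrable_mult)

lemma L2_inner_diff_left:
  "u \<in> L2 \<Omega> \<Longrightarrow> v \<in> L2 \<Omega> \<Longrightarrow> w \<in> L2 \<Omega> \<Longrightarrow> L2_inner \<Omega> (\<lambda>x. u x - v x) w = L2_inner \<Omega> u w - L2_inner \<Omega> v w"
  by (simp add: L2_inner_def left_diff_distrib L2_integrable_mult)

lemma L2_inner_scale_left: "L2_inner \<Omega> (\<lambda>x. c * u x) w = c * L2_inner \<Omega> u w"
  by (simp add: L2_inner_def mult.assoc)

lemma L2_inner_divide_left: "L2_inner \<Omega> (\<lambda>x. u x / c) w = L2_inner \<Omega> u w / c"
  using L2_inner_scale_left[of \<Omega> "1/c" u w] by simp

lemma L2_inner_diff_right:
  "u \<in> L2 \<Omega> \<Longrightarrow> v \<in> L2 \<Omega> \<Longrightarrow> w \<in> L2 \<Omega> \<Longrightarrow> L2_inner \<Omega> w (\<lambda>x. u x - v x) = L2_inner \<Omega> w u - L2_inner \<Omega> w v"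
  by (simp add: L2_inner_def right_diff_distrib L2_integrable_mult)

lemma L2_inner_zero [simp]: "L2_inner \<Omega> (\<lambda>x. 0) w = 0" "L2_inner \<Omega> w (\<lambda>x. 0) = 0"
  by (simp_all add: L2_inner_def)

lemma L2_inner_sum_left:
  assumes "\<And>i. i \<in> I \<Longrightarrow> u i \<in> L2 \<Omega>" "w \<in> L2 \<Omega>"
  shows "L2_inner \<Omega> (\<lambda>x. \<Sum>i\<in>I. c i * u i x) w = (\<Sum>i\<in>I. c i * L2_inner \<Omega> (u i) w)"
  using assms(1)
proof (induction I rule: infinite_finite_induct)
  case (insert i I)
  then show ?case
    by (simp add: L2_inner_add_left[OF L2_scale L2_sum[where u = "\<lambda>i x. c i * u i x"]] assms
        L2_scale L2_inner_scale_left)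
qed auto

lemma L2_inner_sum_right:
  assumes "\<And>i. i \<in> I \<Longrightarrow> u i \<in> L2 \<Omega>" "w \<in> L2 \<Omega>"
  shows "L2_inner \<Omega> w (\<lambda>x. \<Sum>i\<in>I. c i * u i x) = (\<Sum>i\<in>I. c i * L2_inner \<Omega> w (u i))"
  using L2_inner_sum_left[OF assms] by (simp add: L2_inner_sym)

lemma L2_inner_nonneg: "0 \<le> L2_inner \<Omega> u u"
  by (simp add: L2_inner_def)

lemma L2_norm_nonneg [simp]: "0 \<le> L2_norm \<Omega> u"
  by (simp add: L2_norm_def L2_inner_nonneg)

lemma L2_norm_power2: "(L2_norm \<Omega> u)\<^sup>2 = L2_inner \<Omega> u u"
  by (simp add: L2_norm_def L2_inner_nonneg)

lemma L2_inner_self_diff: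
  assumes "u \<in> L2 \<Omega>" "v \<in> L2 \<Omega>"
  shows "L2_inner \<Omega> (\<lambda>x. u x - s * v x) (\<lambda>x. u x - s * v x)
    = L2_inner \<Omega> u u - 2 * s * L2_inner \<Omega> u v + s\<^sup>2 * L2_inner \<Omega> v v"
proof -
  have w: "(\<lambda>x. u x - s * v x) \<in> L2 \<Omega>" using assms by (intro L2_diff L2_scale)
  have "L2_inner \<Omega> (\<lambda>x. u x - s * v x) (\<lambda>x. u x - s * v x)
      = L2_inner \<Omega> u (\<lambda>x. u x - s * v x) - s * L2_inner \<Omega> v (\<lambda>x. u x - s * v x)"
    using L2_inner_diff_left[OF assms(1) L2_scale[OF assms(2)] w, of s] by (simp add: L2_inner_scale_left)
  also have "L2_inner \<Omega> u (\<lambda>x. u x - s * v x) = L2_inner \<Omega> u u - s * L2_inner \<Omega> u v"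
    using L2_inner_diff_right[OF assms(1) L2_scale[OF assms(2)] assms(1), of s]
    by (simp add: L2_inner_sym[of \<Omega> u "\<lambda>x. s * v x"] L2_inner_scale_left L2_inner_sym[of \<Omega> v u])
  also have "L2_inner \<Omega> v (\<lambda>x. u x - s * v x) = L2_inner \<Omega> u v - s * L2_inner \<Omega> v v"
    using L2_inner_diff_right[OF assms(1) L2_scale[OF assms(2)] assms(2), of s]
    by (simp add: L2_inner_sym[of \<Omega> v "\<lambda>x. s * v x"] L2_inner_scale_left L2_inner_sym[of \<Omega> v u])
  finally show ?thesis by (simp add: power2_eq_square algebra_simps)
qed

lemma L2_Cauchy_Schwarz:
  assumes "u \<in> L2 \<Omega>" "v \<in> L2 \<Omega>"
  shows "\<bar>L2_inner \<Omega> u v\<bar> \<le> L2_norm \<Omega> u * L2_norm \<Omega> v"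
proof -
  define X Y Z where "X = L2_inner \<Omega> u u" and "Y = L2_inner \<Omega> u v" and "Z = L2_inner \<Omega> v v"
  have q: "0 \<le> X - 2 * s * Y + s\<^sup>2 * Z" for s
    unfolding X_def Y_def Z_def L2_inner_self_diff[OF assms, symmetric] by (rule L2_inner_nonneg)
  have "Y\<^sup>2 \<le> X * Z"
  proof (cases "Z = 0")
    case True
    have "Y = 0"
    proof (rule ccontr)
      assume "Y \<noteq> 0"
      then show False using q[of "(X + 1) / (2 * Y)"] True by (simp add: field_simps)
    qed
    with True show ?thesis by simp
  next
    case False
    then have p: "Z > 0" using L2_inner_nonneg[of \<Omega> v] by (simp add: Z_def)
    have "0 \<le> X - Y\<^sup>2 / Z" using q[of "Y / Z"] p by (simp add: power2_eq_square field_simps)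
    then show ?thesis using p by (simp add: field_simps)
  qed
  then show ?thesis unfolding X_def Y_def Z_def L2_norm_def
    using real_sqrt_le_mono by (fastforce simp: real_sqrt_mult)
qed

lemma L2_norm_triangle:
  assumes "u \<in> L2 \<Omega>" "v \<in> L2 \<Omega>"
  shows "L2_norm \<Omega> (\<lambda>x. u x - v x) \<le> L2_norm \<Omega> u + L2_norm \<Omega> v"
proof (rule power2_le_imp_le)
  have "(L2_norm \<Omega> (\<lambda>x. u x - v x))\<^sup>2 = (L2_norm \<Omega> u)\<^sup>2 - 2 * L2_inner \<Omega> u v + (L2_norm \<Omega> v)\<^sup>2"
    using L2_inner_self_diff[OF assms, of 1] by (simp add: L2_norm_power2)
  also have "\<dots> \<le> (L2_norm \<Omega> u + L2_norm \<Omega> v)\<^sup>2"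
    using L2_Cauchy_Schwarz[OF assms] by (simp add: power2_sum)
  finally show "(L2_norm \<Omega> (\<lambda>x. u x - v x))\<^sup>2 \<le> (L2_norm \<Omega> u + L2_norm \<Omega> v)\<^sup>2" .
qed simp

lemma L2_norm_scale: "L2_norm \<Omega> (\<lambda>x. c * u x) = \<bar>c\<bar> * L2_norm \<Omega> u"
  using L2_inner_scale_left[of \<Omega> c u "\<lambda>x. c * u x"] L2_inner_scale_left[of \<Omega> c u u]
  by (simp add: L2_norm_def L2_inner_sym[of \<Omega> u "\<lambda>x. c * u x"] real_sqrt_mult mult.assoc[symmetric])

lemma L2_norm_minus_commute: "L2_norm \<Omega> (\<lambda>x. u x - v x) = L2_norm \<Omega> (\<lambda>x. v x - u x)"
  using L2_norm_scale[of \<Omega> "-1" "\<lambda>x. u x - v x"] by simp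

lemma L2_norm_diff_triangle:
  assumes "u \<in> L2 \<Omega>" "v \<in> L2 \<Omega>" "w \<in> L2 \<Omega>"
  shows "L2_norm \<Omega> (\<lambda>x. u x - v x) \<le> L2_norm \<Omega> (\<lambda>x. u x - w x) + L2_norm \<Omega> (\<lambda>x. w x - v x)"
  using L2_norm_triangle[OF L2_diff[OF assms(1,3)] L2_diff[OF assms(2,3)]]
  by (simp add: L2_norm_minus_commute[of \<Omega> v w])

lemma L2_norm_zero [simp]: "L2_norm \<Omega> (\<lambda>x. 0) = 0"
  by (simp add: L2_norm_def)

lemma L2_norm_eq_0_iff:
  assumes "u \<in> L2 \<Omega>"
  shows "L2_norm \<Omega> u = 0 \<longleftrightarrow> (AE x in lebesgue_on \<Omega>. u x = 0)"
  using integral_nonneg_eq_0_iff_AE[of "lebesgue_on \<Omega>" "\<lambda>x. u x * u x"] L2_integrable_mult[OF assms assms]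
  by (simp add: L2_norm_def L2_inner_def)

lemma L2_inner_cong_AE:
  assumes "u \<in> L2 \<Omega>" "u' \<in> L2 \<Omega>" "v \<in> L2 \<Omega>" "AE x in lebesgue_on \<Omega>. u x = u' x"
  shows "L2_inner \<Omega> u v = L2_inner \<Omega> u' v"
  unfolding L2_inner_def
proof (rule integral_cong_AE)
  show "AE x in lebesgue_on \<Omega>. u x * v x = u' x * v x" using assms(4) by eventually_elim simp
qed (use assms in \<open>auto simp: L2_def\<close>)

text \<open>Completeness of \<open>L\<^sup>2\<close> in the weak form in which a limit of functionals is represented. The increments are summable
  in \<open>L\<^sup>1\<close>, hence pointwise almost everywhere, and the sum of their absolute values is a square
  integrable majorant.\<close>

lemma L2_weak_limit:
  assumes one: "(\<lambda>x. 1) \<in> L2 \<Omega>" and F: "\<And>n. F n \<in> L2 \<Omega>"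
    and cauchy: "\<And>n. L2_norm \<Omega> (\<lambda>x. F (Suc n) x - F n x) \<le> (1/2) ^ n"
  shows "\<exists>G \<in> L2 \<Omega>. \<forall>v \<in> L2 \<Omega>. (\<lambda>n. L2_inner \<Omega> (F n) v) \<longlonglongrightarrow> L2_inner \<Omega> G v"
proof -
  let ?M = "lebesgue_on \<Omega>"
  define d where "d n x = \<bar>F (Suc n) x - F n x\<bar>" for n x
  have d: "d n \<in> L2 \<Omega>" for n unfolding d_def by (intro L2_abs L2_diff F)
  have d0: "0 \<le> d n x" for n x by (simp add: d_def)
  have normd: "L2_norm \<Omega> (d n) \<le> (1/2) ^ n" for n
    using cauchy[of n] by (simp add: d_def[abs_def] L2_norm_def L2_inner_def)
  have intd: "integrable ?M (d n)" for n using L2_integrable_mult[OF d one] by simp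
  have [measurable]: "d n \<in> borel_measurable ?M" "F n \<in> borel_measurable ?M" for n using d F by (auto simp: L2_def)
  have AEsum: "AE x in ?M. summable (\<lambda>n. d n x)"
  proof -
    have "(\<integral>\<^sup>+x. (\<Sum>n. ennreal (d n x)) \<partial>?M) = (\<Sum>n. \<integral>\<^sup>+x. ennreal (d n x) \<partial>?M)"
      by (rule nn_integral_suminf) measurable
    also have "\<dots> = (\<Sum>n. ennreal (\<integral>x. d n x \<partial>?M))"
      using intd d0 by (simp add: nn_integral_eq_integral)
    also have "\<dots> \<le> (\<Sum>n. ennreal ((1/2) ^ n * L2_norm \<Omega> (\<lambda>x. 1)))"
    proof (intro suminf_le ennreal_leI)
      fix n
      have "(\<integral>x. d n x \<partial>?M) = L2_inner \<Omega> (d n) (\<lambda>x. 1)" by (simp add: L2_inner_def)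
      also have "\<dots> \<le> L2_norm \<Omega> (d n) * L2_norm \<Omega> (\<lambda>x. 1)" using L2_Cauchy_Schwarz[OF d one, of n] by linarith
      also have "\<dots> \<le> (1/2) ^ n * L2_norm \<Omega> (\<lambda>x. 1)" using normd by (intro mult_right_mono) auto
      finally show "(\<integral>x. d n x \<partial>?M) \<le> (1/2) ^ n * L2_norm \<Omega> (\<lambda>x. 1)" .
    qed auto
    also have "\<dots> = ennreal (\<Sum>n. (1/2) ^ n * L2_norm \<Omega> (\<lambda>x. 1))"
      by (intro suminf_ennreal2 summable_mult2 summable_geometric) auto
    also have "\<dots> < \<infinity>" by simp
    finally have "AE x in ?M. (\<Sum>n. ennreal (d n x)) \<noteq> \<infinity>"
      by (intro nn_integral_noteq_infinite) auto
    then show ?thesis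
      by eventually_elim (auto intro!: summable_suminf_not_top simp: d0)
  qed
  define S where "S N x = (\<Sum>n<N. d n x)" for N x
  define W where "W x = (\<Sum>n. d n x)" for x
  have [measurable]: "W \<in> borel_measurable ?M" unfolding W_def by measurable
  have S: "S N \<in> L2 \<Omega>" for N unfolding S_def by (intro L2_sum d)
  have normS: "L2_norm \<Omega> (S N) \<le> 2" for N
  proof -
    have "L2_norm \<Omega> (S N) \<le> (\<Sum>n<N. (1/2) ^ n)"
    proof (induction N)
      case 0 then show ?case by (simp add: S_def)
    next
      case (Suc N)
      have "S (Suc N) = (\<lambda>x. S N x - (-1) * d N x)" by (simp add: S_def fun_eq_iff)
      then have "L2_norm \<Omega> (S (Suc N)) \<le> L2_norm \<Omega> (S N) + L2_norm \<Omega> (d N)"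
        using L2_norm_triangle[OF S L2_scale[OF d], of N "-1" N] by (simp only: L2_norm_scale)
      then show ?case using Suc normd[of N] by simp
    qed
    also have "\<dots> \<le> 2" by (simp add: geometric_sum)
    finally show ?thesis .
  qed
  have SW: "AE x in ?M. (\<lambda>N. S N x) \<longlonglongrightarrow> W x"
    using AEsum unfolding S_def W_def by eventually_elim (simp add: summable_LIMSEQ)
  have W: "W \<in> L2 \<Omega>"
  proof -
    let ?I = "\<lambda>N. \<integral>x. (S N x)\<^sup>2 \<partial>?M"
    have I: "?I N = (L2_norm \<Omega> (S N))\<^sup>2" for N
      unfolding L2_norm_power2 L2_inner_def by (simp add: power2_eq_square)
    have mono: "mono (\<lambda>N. (S N x)\<^sup>2)" for x
      by (rule monoI) (auto simp: S_def intro!: power_mono sum_mono2 sum_nonneg d0)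
    have "incseq ?I" 
    proof (rule incseq_SucI)
      show "?I N \<le> ?I (Suc N)" for N
        using S[of N] S[of "Suc N"] monoD[OF mono, of N "Suc N"] by (intro integral_mono) (auto simp: L2_def)
    qed
    moreover have "?I N \<le> 4" for N unfolding I using normS[of N] power_mono[of "L2_norm \<Omega> (S N)" 2 2] by simp
    ultimately obtain l where "?I \<longlonglongrightarrow> l" by (meson incseq_convergent)
    then have "integrable ?M (\<lambda>x. (W x)\<^sup>2)"
    proof (rule integrable_monotone_convergence[rotated 3])
      show "integrable ?M (\<lambda>x. (S N x)\<^sup>2)" for N using S[of N] by (simp add: L2_def)
      show "AE x in ?M. mono (\<lambda>N. (S N x)\<^sup>2)" using mono by simp
      show "AE x in ?M. (\<lambda>N. (S N x)\<^sup>2) \<longlonglongrightarrow> (W x)\<^sup>2" using SW by eventually_elim (rule tendsto_power)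
    qed measurable
    then show ?thesis by (simp add: L2_def)
  qed
  define G where "G x = lim (\<lambda>n. F n x)" for x
  have [measurable]: "G \<in> borel_measurable ?M" unfolding G_def by measurable
  define B where "B x = \<bar>F 0 x\<bar> + W x" for x
  have B: "B \<in> L2 \<Omega>" unfolding B_def by (intro L2_add L2_abs F W)
  have tele: "F n x = F 0 x + (\<Sum>i<n. F (Suc i) x - F i x)" for n x
    using sum_lessThan_telescope[of "\<lambda>i. F i x" n] by simp
  have FB: "AE x in ?M. (\<lambda>n. F n x) \<longlonglongrightarrow> G x \<and> (\<forall>n. \<bar>F n x\<bar> \<le> B x)"
    using AEsum
  proof eventually_elim
    case (elim x)
    have "summable (\<lambda>i. F (Suc i) x - F i x)"
      using elim unfolding d_def by (rule summable_rabs_cancel)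
    then have "(\<lambda>n. F 0 x + (\<Sum>i<n. F (Suc i) x - F i x)) \<longlonglongrightarrow> F 0 x + (\<Sum>i. F (Suc i) x - F i x)"
      by (intro tendsto_add tendsto_const summable_LIMSEQ)
    then have "convergent (\<lambda>n. F n x)" unfolding tele[symmetric] by (rule convergentI)
    moreover have "\<bar>F n x\<bar> \<le> B x" for n
    proof -
      have "\<bar>F n x\<bar> \<le> \<bar>F 0 x\<bar> + (\<Sum>i<n. d i x)"
        unfolding tele[of n] d_def by (rule order_trans[OF abs_triangle_ineq]) (simp add: sum_abs)
      also have "(\<Sum>i<n. d i x) \<le> W x" unfolding W_def using elim d0 by (intro sum_le_suminf) auto
      finally show ?thesis by (simp add: B_def)
    qed
    ultimately show ?case by (simp add: G_def convergent_LIMSEQ_iff)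
  qed
  have G: "G \<in> L2 \<Omega>"
  proof (rule L2_bounded_by[OF B])
    show "AE x in ?M. \<bar>G x\<bar> \<le> \<bar>B x\<bar>"
      using FB
    proof eventually_elim
      case (elim x)
      then have "(\<lambda>n. \<bar>F n x\<bar>) \<longlonglongrightarrow> \<bar>G x\<bar>" by (intro tendsto_rabs) auto
      then have "\<bar>G x\<bar> \<le> B x" using elim by (intro LIMSEQ_le_const2[where X = "\<lambda>n. \<bar>F n x\<bar>"]) auto
      then show ?case by linarith
    qed
  qed measurable
  have "(\<lambda>n. L2_inner \<Omega> (F n) v) \<longlonglongrightarrow> L2_inner \<Omega> G v" if v: "v \<in> L2 \<Omega>" for v
    unfolding L2_inner_def
  proof (rule integral_dominated_convergence[where w = "\<lambda>x. B x * \<bar>v x\<bar>"])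
    have [measurable]: "v \<in> borel_measurable ?M" using v by (simp add: L2_def)
    show "(\<lambda>x. G x * v x) \<in> borel_measurable ?M" "(\<lambda>x. F n x * v x) \<in> borel_measurable ?M" for n
      by measurable
    show "integrable ?M (\<lambda>x. B x * \<bar>v x\<bar>)" by (intro L2_integrable_mult B L2_abs v)
    show "AE x in ?M. (\<lambda>n. F n x * v x) \<longlonglongrightarrow> G x * v x"
      using FB by eventually_elim (auto intro: tendsto_mult)
    show "AE x in ?M. norm (F n x * v x) \<le> B x * \<bar>v x\<bar>" for n
      using FB by eventually_elim (auto simp: abs_mult intro: mult_right_mono)
  qed
  then show ?thesis using G by blast
qed

section \<open>Averages of strongly measurable functions\<close>

lemma borel_measurable_lebesgue_on_AE:
  fixes f g :: "'a::euclidean_space \<Rightarrow> real"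
  assumes S: "S \<in> sets lebesgue" and f: "f \<in> borel_measurable (lebesgue_on S)"
    and eq: "AE x in lebesgue_on S. f x = g x"
  shows "g \<in> borel_measurable (lebesgue_on S)"
proof -
  have "(\<lambda>x. if x \<in> S then f x else 0) \<in> borel_measurable lebesgue"
    using f S by (simp add: borel_measurable_if)
  moreover have "AE x in lebesgue. x \<in> S \<longrightarrow> f x = g x"
    using eq S by (subst (asm) AE_restrict_space_iff) auto
  then have "AE x in lebesgue. (if x \<in> S then f x else 0) = (if x \<in> S then g x else 0)"
    by eventually_elim auto
  ultimately have "(\<lambda>x. if x \<in> S then g x else 0) \<in> borel_measurable lebesgue"
    by (rule borel_measurable_AE)
  then show ?thesis using S by (simp add: borel_measurable_if)
qed

lemma borel_measurable_lebesgue_on_AE_limit: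
  fixes f :: "'a::euclidean_space \<Rightarrow> real"
  assumes S: "S \<in> sets lebesgue" and F[measurable]: "\<And>n. F n \<in> borel_measurable (lebesgue_on S)"
    and lim: "AE x in lebesgue_on S. (\<lambda>n. F n x) \<longlonglongrightarrow> f x"
  shows "f \<in> borel_measurable (lebesgue_on S)"
proof (rule borel_measurable_lebesgue_on_AE[OF S])
  show "(\<lambda>x. lim (\<lambda>n. F n x)) \<in> borel_measurable (lebesgue_on S)" by measurable
  show "AE x in lebesgue_on S. lim (\<lambda>n. F n x) = f x" using lim by eventually_elim (rule limI)
qed


text \<open>On a strongly measurable function every quantity attached to an approximating simple function
  is measurable, because it takes finitely many values.\<close>

lemma finite_range_measurable:
  fixes \<Phi> :: "'b \<Rightarrow> real"
  assumes J: "J \<in> sets lebesgue" and "finite (s ` J)" and s: "\<And>g. {t \<in> J. s t = g} \<in> sets lebesgue"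
  shows "(\<lambda>t. \<Phi> (s t)) \<in> borel_measurable (lebesgue_on J)"
proof -
  have m: "{t \<in> J. s t = g} \<in> sets (lebesgue_on J)" for g
    using s[of g] J by (simp add: sets_restrict_space_iff)
  have "(\<lambda>t. \<Sum>g\<in>s ` J. \<Phi> g * indicator {t \<in> J. s t = g} t) \<in> borel_measurable (lebesgue_on J)"
    using m by (intro borel_measurable_sum borel_measurable_times borel_measurable_indicator) auto
  then show ?thesis
  proof (rule measurable_cong[THEN iffD1, rotated])
    fix t assume "t \<in> space (lebesgue_on J)"
    then have t: "t \<in> J" using J by simp
    have "(\<Sum>g\<in>s ` J. \<Phi> g * indicator {t \<in> J. s t = g} t) = (\<Sum>g\<in>s ` J. if s t = g then \<Phi> g else 0)"
      using t by (intro sum.cong) (auto simp: indicator_def)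
    then show "(\<Sum>g\<in>s ` J. \<Phi> g * indicator {t \<in> J. s t = g} t) = \<Phi> (s t)"
      using t \<open>finite (s ` J)\<close> by simp
  qed
qed

definition simple_L2 :: "(real ^ 'n) set \<Rightarrow> real set \<Rightarrow> (real \<Rightarrow> real ^ 'n \<Rightarrow> real) \<Rightarrow> bool" where
  "simple_L2 \<Omega> J s \<longleftrightarrow> finite (s ` J) \<and> s ` J \<subseteq> L2 \<Omega> \<and> (\<forall>g. {t \<in> J. s t = g} \<in> sets lebesgue)"

lemma simple_L2_measurable:
  assumes "J \<in> sets lebesgue" "simple_L2 \<Omega> J s"
  shows "(\<lambda>t. \<Phi> (s t) :: real) \<in> borel_measurable (lebesgue_on J)"
  by (rule finite_range_measurable[where s = s and \<Phi> = \<Phi>]) (use assms in \<open>auto simp: simple_L2_def\<close>)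

lemma simple_L2_measurable2:
  assumes J: "J \<in> sets lebesgue" and s: "simple_L2 \<Omega> J s" and r: "simple_L2 \<Omega> J r"
  shows "(\<lambda>t. \<Phi> (s t) (r t) :: real) \<in> borel_measurable (lebesgue_on J)"
proof -
  have "(\<lambda>t. (case (s t, r t) of (x, y) \<Rightarrow> \<Phi> x y)) \<in> borel_measurable (lebesgue_on J)"
  proof (rule finite_range_measurable[OF J, where \<Phi> = "\<lambda>(x, y). \<Phi> x y"])
    have "(\<lambda>t. (s t, r t)) ` J \<subseteq> s ` J \<times> r ` J" by auto
    then show "finite ((\<lambda>t. (s t, r t)) ` J)"
      by (rule finite_subset) (use s r in \<open>auto simp: simple_L2_def\<close>)
    fix g :: "(real ^ 'a \<Rightarrow> real) \<times> (real ^ 'a \<Rightarrow> real)"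
    have "{t \<in> J. (s t, r t) = g} = {t \<in> J. s t = fst g} \<inter> {t \<in> J. r t = snd g}" by auto
    then show "{t \<in> J. (s t, r t) = g} \<in> sets lebesgue"
      using s r by (auto simp: simple_L2_def intro: sets.Int)
  qed
  then show ?thesis by simp
qed

text \<open>Where an approximating value is larger than twice the function, it is replaced by \<open>0\<close>. This gives a
  majorant for dominated convergence, and changes nothing in the limit.\<close>

lemma strongly_measurable_L2_truncated:
  assumes J: "J \<in> sets lebesgue" and f2: "AE t in lebesgue_on J. f t \<in> L2 \<Omega>"
    and f: "strongly_measurable_L2 \<Omega> J f" and nf: "(\<lambda>t. L2_norm \<Omega> (f t)) \<in> borel_measurable (lebesgue_on J)"
  shows "\<exists>s. (\<forall>n. simple_L2 \<Omega> J (s n)) \<and> (\<forall>n t. L2_norm \<Omega> (s n t) \<le> 2 * L2_norm \<Omega> (f t)) \<and>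
    (AE t in lebesgue_on J. (\<lambda>n. L2_norm \<Omega> (\<lambda>x. f t x - s n t x)) \<longlonglongrightarrow> 0)"
proof -
  obtain s where s: "\<And>n. simple_L2 \<Omega> J (s n)"
    and lim: "AE t in lebesgue_on J. (\<lambda>n. L2_norm \<Omega> (\<lambda>x. f t x - s n t x)) \<longlonglongrightarrow> 0"
    using f unfolding strongly_measurable_L2_def simple_L2_def by blast
  define r where "r n t = (if L2_norm \<Omega> (s n t) \<le> 2 * L2_norm \<Omega> (f t) then s n t else (\<lambda>x. 0))" for n t
  have "simple_L2 \<Omega> J (r n)" for n
    unfolding simple_L2_def
  proof (intro conjI allI)
    have "r n ` J \<subseteq> insert (\<lambda>x. 0) (s n ` J)" by (auto simp: r_def)
    moreover have "insert (\<lambda>x. 0) (s n ` J) \<subseteq> L2 \<Omega>" "finite (insert (\<lambda>x. 0) (s n ` J))"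
      using s[of n] L2_zero[of \<Omega>] unfolding simple_L2_def by auto
    ultimately show "finite (r n ` J)" "r n ` J \<subseteq> L2 \<Omega>"
      using finite_subset subset_trans by blast+
    fix g
    define A where "A = {t \<in> J. L2_norm \<Omega> (s n t) \<le> 2 * L2_norm \<Omega> (f t)}"
    have "{t \<in> space (lebesgue_on J). L2_norm \<Omega> (s n t) \<le> 2 * L2_norm \<Omega> (f t)} \<in> sets (lebesgue_on J)"
      using simple_L2_measurable[OF J s, of "L2_norm \<Omega>" n] nf by (intro borel_measurable_le) auto
    then have A: "A \<in> sets lebesgue" using J by (simp add: A_def sets_restrict_space_iff)
    have "{t \<in> J. r n t = g} = ({t \<in> J. s n t = g} \<inter> A) \<union> (if g = (\<lambda>x. 0) then J - A else {})"
      by (auto simp: r_def A_def)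
    moreover have "{t \<in> J. s n t = g} \<in> sets lebesgue" using s[of n] by (simp add: simple_L2_def)
    ultimately show "{t \<in> J. r n t = g} \<in> sets lebesgue" using A J by auto
  qed
  moreover have "L2_norm \<Omega> (r n t) \<le> 2 * L2_norm \<Omega> (f t)" for n t by (simp add: r_def)
  moreover have "AE t in lebesgue_on J. (\<lambda>n. L2_norm \<Omega> (\<lambda>x. f t x - r n t x)) \<longlonglongrightarrow> 0"
    using lim f2 AE_space
  proof eventually_elim
    case (elim t)
    have t: "t \<in> J" and ft: "f t \<in> L2 \<Omega>" using elim J by auto
    have st: "s n t \<in> L2 \<Omega>" for n using s[of n] t by (auto simp: simple_L2_def)
    show ?case
    proof (cases "L2_norm \<Omega> (f t) = 0")
      case True
      have "L2_norm \<Omega> (\<lambda>x. f t x - r n t x) = 0" for n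
      proof -
        have "r n t \<in> L2 \<Omega>" "L2_norm \<Omega> (r n t) \<le> 0" using st L2_zero True by (auto simp: r_def)
        then have "L2_norm \<Omega> (\<lambda>x. f t x - r n t x) \<le> 0" using L2_norm_triangle[OF ft] True by fastforce
        then show ?thesis using L2_norm_nonneg[of \<Omega> "\<lambda>x. f t x - r n t x"] by linarith
      qed
      then show ?thesis by simp
    next
      case False
      then have "0 < L2_norm \<Omega> (f t)" using L2_norm_nonneg[of \<Omega> "f t"] by linarith
      with elim(1) have "eventually (\<lambda>n. L2_norm \<Omega> (\<lambda>x. f t x - s n t x) < L2_norm \<Omega> (f t)) sequentially"
        by (intro order_tendstoD) auto
      then have "eventually (\<lambda>n. L2_norm \<Omega> (\<lambda>x. f t x - s n t x) = L2_norm \<Omega> (\<lambda>x. f t x - r n t x)) sequentially"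
      proof eventually_elim
        case (elim n)
        have "L2_norm \<Omega> (s n t) \<le> L2_norm \<Omega> (f t) + L2_norm \<Omega> (\<lambda>x. f t x - s n t x)"
          using L2_norm_triangle[OF ft L2_diff[OF ft st]] by simp
        then have "r n t = s n t" using elim by (simp add: r_def)
        then show ?case by simp
      qed
      with elim(1) show ?thesis by (rule Lim_transform_eventually)
    qed
  qed
  ultimately show ?thesis by blast
qed

lemma simple_L2_integral:
  assumes J: "J \<in> sets lebesgue" "emeasure lebesgue J < \<infinity>" and s: "simple_L2 \<Omega> J s"
  defines "I \<equiv> \<lambda>x. \<Sum>g\<in>s ` J. measure lebesgue {t \<in> J. s t = g} * g x"
  shows "I \<in> L2 \<Omega>" and "v \<in> L2 \<Omega> \<Longrightarrow> integrable (lebesgue_on J) (\<lambda>t. L2_inner \<Omega> (s t) v)"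
    and "v \<in> L2 \<Omega> \<Longrightarrow> (\<integral>t. L2_inner \<Omega> (s t) v \<partial>lebesgue_on J) = L2_inner \<Omega> I v"
proof -
  have fin: "finite (s ` J)" "\<And>g. g \<in> s ` J \<Longrightarrow> g \<in> L2 \<Omega>" using s by (auto simp: simple_L2_def)
  show I: "I \<in> L2 \<Omega>" unfolding I_def by (intro L2_sum L2_scale fin)
  assume v: "v \<in> L2 \<Omega>"
  have m: "{t \<in> J. s t = g} \<in> sets (lebesgue_on J)" for g
    using s J by (simp add: sets_restrict_space_iff simple_L2_def)
  have e: "emeasure (lebesgue_on J) {t \<in> J. s t = g} < \<infinity>" for g
  proof -
    have "emeasure (lebesgue_on J) {t \<in> J. s t = g} = emeasure lebesgue {t \<in> J. s t = g}"
      using J by (intro emeasure_restrict_space) auto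
    also have "\<dots> \<le> emeasure lebesgue J" using J by (intro emeasure_mono) auto
    finally show ?thesis using J(2) by (simp add: order_le_less_trans)
  qed
  have i: "integrable (lebesgue_on J) (indicator {t \<in> J. s t = g} :: real \<Rightarrow> real)" for g
    using m e by (intro integrable_real_indicator)
  have eq: "L2_inner \<Omega> (s t) v = (\<Sum>g\<in>s ` J. L2_inner \<Omega> g v * indicator {t \<in> J. s t = g} t)"
    if t: "t \<in> space (lebesgue_on J)" for t
  proof -
    have "(\<Sum>g\<in>s ` J. L2_inner \<Omega> g v * indicator {t \<in> J. s t = g} t) = (\<Sum>g\<in>s ` J. if s t = g then L2_inner \<Omega> g v else 0)"
      using t J by (intro sum.cong) (auto simp: indicator_def)
    then show ?thesis using t J fin by simp
  qed
  have i2: "integrable (lebesgue_on J) (\<lambda>t. \<Sum>g\<in>s ` J. L2_inner \<Omega> g v * indicator {t \<in> J. s t = g} t)"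
    by (intro Bochner_Integration.integrable_sum integrable_mult_right i)
  then show "integrable (lebesgue_on J) (\<lambda>t. L2_inner \<Omega> (s t) v)"
    by (subst Bochner_Integration.integrable_cong[OF refl eq])
  have "(\<integral>t. L2_inner \<Omega> (s t) v \<partial>lebesgue_on J)
      = (\<integral>t. (\<Sum>g\<in>s ` J. L2_inner \<Omega> g v * indicator {t \<in> J. s t = g} t) \<partial>lebesgue_on J)"
    by (rule Bochner_Integration.integral_cong[OF refl eq])
  also have "\<dots> = (\<Sum>g\<in>s ` J. \<integral>t. L2_inner \<Omega> g v * indicator {t \<in> J. s t = g} t \<partial>lebesgue_on J)"
    by (intro Bochner_Integration.integral_sum integrable_mult_right i)
  also have "\<dots> = (\<Sum>g\<in>s ` J. measure lebesgue {t \<in> J. s t = g} * L2_inner \<Omega> g v)"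
  proof (intro sum.cong refl)
    fix g
    have "measure (lebesgue_on J) {t \<in> J. s t = g} = measure lebesgue {t \<in> J. s t = g}"
      using J by (intro measure_restrict_space) auto
    moreover have "{t \<in> J. s t = g} \<inter> space (lebesgue_on J) = {t \<in> J. s t = g}" using J by auto
    ultimately show "(\<integral>t. L2_inner \<Omega> g v * indicator {t \<in> J. s t = g} t \<partial>lebesgue_on J)
        = measure lebesgue {t \<in> J. s t = g} * L2_inner \<Omega> g v" by simp
  qed
  also have "\<dots> = L2_inner \<Omega> I v" unfolding I_def by (rule L2_inner_sum_left[symmetric]) (use fin v in auto)
  finally show "(\<integral>t. L2_inner \<Omega> (s t) v \<partial>lebesgue_on J) = L2_inner \<Omega> I v" .
qed

lemma LIMSEQ_null_bound:
  fixes f :: "nat \<Rightarrow> real"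
  assumes "\<And>n. \<bar>f n\<bar> \<le> g n" "g \<longlonglongrightarrow> 0"
  shows "f \<longlonglongrightarrow> 0"
  by (rule Lim_null_comparison[OF _ assms(2)]) (simp add: assms(1))

text \<open>Integrals of simple approximations form a Cauchy sequence in \<open>L\<^sup>2\<close>, and their weak limit represents the
  integral.\<close>

lemma strongly_measurable_L2_integral:
  assumes one: "(\<lambda>x. 1) \<in> L2 \<Omega>" and J: "J \<in> sets lebesgue" "emeasure lebesgue J < \<infinity>"
    and f2: "AE t in lebesgue_on J. f t \<in> L2 \<Omega>"
    and f: "strongly_measurable_L2 \<Omega> J f" and nf: "integrable (lebesgue_on J) (\<lambda>t. L2_norm \<Omega> (f t))"
  shows "\<exists>G \<in> L2 \<Omega>. \<forall>v \<in> L2 \<Omega>. integrable (lebesgue_on J) (\<lambda>t. L2_inner \<Omega> (f t) v) \<and>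
    L2_inner \<Omega> G v = (\<integral>t. L2_inner \<Omega> (f t) v \<partial>lebesgue_on J)"
proof -
  let ?M = "lebesgue_on J"
  obtain s where s: "\<And>n. simple_L2 \<Omega> J (s n)" and bd: "\<And>n t. L2_norm \<Omega> (s n t) \<le> 2 * L2_norm \<Omega> (f t)"
    and lim: "AE t in ?M. (\<lambda>n. L2_norm \<Omega> (\<lambda>x. f t x - s n t x)) \<longlonglongrightarrow> 0"
    using strongly_measurable_L2_truncated[OF J(1) f2 f] nf by blast
  have st: "s n t \<in> L2 \<Omega>" if "t \<in> J" for n t using s[of n] that by (auto simp: simple_L2_def)
  have good: "AE t in ?M. t \<in> J \<and> f t \<in> L2 \<Omega> \<and> (\<lambda>n. L2_norm \<Omega> (\<lambda>x. f t x - s n t x)) \<longlonglongrightarrow> 0"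
    using lim f2 AE_space by eventually_elim (use J in auto)
  define e where "e n t = L2_norm \<Omega> (\<lambda>x. f t x - s n t x)" for n t
  have e_le: "AE t in ?M. e n t \<le> 3 * L2_norm \<Omega> (f t)" for n
    using good
  proof eventually_elim
    case (elim t)
    then show ?case using L2_norm_triangle[of "f t" \<Omega> "s n t"] st[of t n] bd[of n t] by (simp add: e_def)
  qed
  have e_meas: "e n \<in> borel_measurable ?M" for n
  proof (rule borel_measurable_lebesgue_on_AE_limit[OF J(1)])
    show "(\<lambda>t. L2_norm \<Omega> (\<lambda>x. s k t x - s n t x)) \<in> borel_measurable ?M" for k
      using simple_L2_measurable2[OF J(1) s s, of "\<lambda>u v. L2_norm \<Omega> (\<lambda>x. u x - v x)" k n] by simp
    show "AE t in ?M. (\<lambda>k. L2_norm \<Omega> (\<lambda>x. s k t x - s n t x)) \<longlonglongrightarrow> e n t"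
      using good
    proof eventually_elim
      case (elim t)
      have "\<bar>L2_norm \<Omega> (\<lambda>x. s k t x - s n t x) - e n t\<bar> \<le> e k t" for k
        using L2_norm_diff_triangle[of "s k t" \<Omega> "s n t" "f t"] L2_norm_diff_triangle[of "f t" \<Omega> "s n t" "s k t"]
          st[of t k] st[of t n] elim by (simp add: e_def L2_norm_minus_commute[of \<Omega> "s k t" "f t"])
      then have "(\<lambda>k. L2_norm \<Omega> (\<lambda>x. s k t x - s n t x) - e n t) \<longlonglongrightarrow> 0"
        by (rule LIMSEQ_null_bound) (use elim in \<open>simp add: e_def\<close>)
      then show ?case by (rule LIM_zero_cancel)
    qed
  qed
  have e_int: "integrable ?M (e n)" for n
  proof (rule Bochner_Integration.integrable_bound)
    show "integrable ?M (\<lambda>t. 3 * L2_norm \<Omega> (f t))" using nf by (rule integrable_mult_right)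
    show "AE t in ?M. norm (e n t) \<le> norm (3 * L2_norm \<Omega> (f t))"
      using e_le[of n] by eventually_elim (simp add: e_def)
  qed (rule e_meas)
  have e_lim: "(\<lambda>n. \<integral>t. e n t \<partial>?M) \<longlonglongrightarrow> (\<integral>t. 0 \<partial>?M)"
  proof (rule integral_dominated_convergence[where w = "\<lambda>t. 3 * L2_norm \<Omega> (f t)"])
    show "integrable ?M (\<lambda>t. 3 * L2_norm \<Omega> (f t))" using nf by (rule integrable_mult_right)
    show "AE t in ?M. (\<lambda>n. e n t) \<longlonglongrightarrow> 0" using good by eventually_elim (simp add: e_def)
    show "AE t in ?M. norm (e n t) \<le> 3 * L2_norm \<Omega> (f t)" for n
      using e_le[of n] by eventually_elim (simp add: e_def)
  qed (auto intro: e_meas)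
  have inner_diff: "\<bar>(\<integral>t. L2_inner \<Omega> (h t) v \<partial>?M) - (\<integral>t. L2_inner \<Omega> (k t) v \<partial>?M)\<bar> \<le> (\<integral>t. b t \<partial>?M) * L2_norm \<Omega> v"
    if i: "integrable ?M (\<lambda>t. L2_inner \<Omega> (h t) v)" "integrable ?M (\<lambda>t. L2_inner \<Omega> (k t) v)" "integrable ?M b"
      and ae: "AE t in ?M. h t \<in> L2 \<Omega> \<and> k t \<in> L2 \<Omega> \<and> L2_norm \<Omega> (\<lambda>x. h t x - k t x) \<le> b t" and v: "v \<in> L2 \<Omega>"
    for h k b v
  proof -
    have "\<bar>(\<integral>t. L2_inner \<Omega> (h t) v \<partial>?M) - (\<integral>t. L2_inner \<Omega> (k t) v \<partial>?M)\<bar>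
        = \<bar>\<integral>t. L2_inner \<Omega> (h t) v - L2_inner \<Omega> (k t) v \<partial>?M\<bar>" using i by simp
    also have "\<dots> \<le> (\<integral>t. \<bar>L2_inner \<Omega> (h t) v - L2_inner \<Omega> (k t) v\<bar> \<partial>?M)"
      using integral_norm_bound[of ?M "\<lambda>t. L2_inner \<Omega> (h t) v - L2_inner \<Omega> (k t) v"] by simp
    also have "\<dots> \<le> (\<integral>t. b t * L2_norm \<Omega> v \<partial>?M)"
    proof (rule integral_mono_AE)
      show "integrable ?M (\<lambda>t. b t * L2_norm \<Omega> v)" using i(3) by (rule integrable_mult_left)
      show "AE t in ?M. \<bar>L2_inner \<Omega> (h t) v - L2_inner \<Omega> (k t) v\<bar> \<le> b t * L2_norm \<Omega> v"
        using ae
      proof eventually_elim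
        case (elim t)
        then have "\<bar>L2_inner \<Omega> (h t) v - L2_inner \<Omega> (k t) v\<bar> \<le> L2_norm \<Omega> (\<lambda>x. h t x - k t x) * L2_norm \<Omega> v"
          using L2_Cauchy_Schwarz[OF L2_diff v, of "h t" "k t"] L2_inner_diff_left[of "h t" \<Omega> "k t" v] v by simp
        also have "\<dots> \<le> b t * L2_norm \<Omega> v" using elim by (intro mult_right_mono) auto
        finally show ?case .
      qed
    qed (use i in auto)
    finally show ?thesis by simp
  qed
  have "\<exists>n. (\<integral>t. e n t \<partial>?M) < (1/2) ^ j / 2" for j :: nat
  proof -
    have "eventually (\<lambda>n. (\<integral>t. e n t \<partial>?M) < (1/2) ^ j / 2) sequentially"
      by (rule order_tendstoD[OF e_lim]) auto
    then show ?thesis by (auto simp: eventually_sequentially)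
  qed
  then obtain r where r: "\<And>j. (\<integral>t. e (r j) t \<partial>?M) < (1/2) ^ j / 2" by metis
  define F where "F j x = (\<Sum>g\<in>s (r j) ` J. measure lebesgue {t \<in> J. s (r j) t = g} * g x)" for j x
  have F: "F j \<in> L2 \<Omega>" and Fi: "v \<in> L2 \<Omega> \<Longrightarrow> integrable ?M (\<lambda>t. L2_inner \<Omega> (s (r j) t) v)"
    and Fv: "v \<in> L2 \<Omega> \<Longrightarrow> L2_inner \<Omega> (F j) v = (\<integral>t. L2_inner \<Omega> (s (r j) t) v \<partial>?M)" for j v
    unfolding F_def using simple_L2_integral[OF J s] by auto
  have cauchy: "L2_norm \<Omega> (\<lambda>x. F (Suc j) x - F j x) \<le> (1/2) ^ j" for j
  proof -
    define D where "D x = F (Suc j) x - F j x" for x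
    have D: "D \<in> L2 \<Omega>" unfolding D_def by (intro L2_diff F)
    have "(L2_norm \<Omega> D)\<^sup>2 = L2_inner \<Omega> (F (Suc j)) D - L2_inner \<Omega> (F j) D"
      unfolding L2_norm_power2 using L2_inner_diff_left[OF F F D, of "Suc j" j] by (simp add: D_def[abs_def])
    also have "\<dots> \<le> (\<integral>t. e (r (Suc j)) t + e (r j) t \<partial>?M) * L2_norm \<Omega> D"
      unfolding Fv[OF D]
    proof (rule order_trans[OF abs_ge_self inner_diff[OF Fi[OF D] Fi[OF D] _ _ D]])
      show "integrable ?M (\<lambda>t. e (r (Suc j)) t + e (r j) t)" using e_int by simp
      show "AE t in ?M. s (r (Suc j)) t \<in> L2 \<Omega> \<and> s (r j) t \<in> L2 \<Omega> \<and>
          L2_norm \<Omega> (\<lambda>x. s (r (Suc j)) t x - s (r j) t x) \<le> e (r (Suc j)) t + e (r j) t"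
        using good
      proof eventually_elim
        case (elim t)
        then show ?case
          using st L2_norm_diff_triangle[of "s (r (Suc j)) t" \<Omega> "s (r j) t" "f t"]
          by (simp add: e_def L2_norm_minus_commute[of \<Omega> "s (r (Suc j)) t" "f t"])
      qed
    qed
    also have "\<dots> \<le> (1/2) ^ j * L2_norm \<Omega> D"
    proof (rule mult_right_mono)
      have "(\<integral>t. e (r (Suc j)) t + e (r j) t \<partial>?M) = (\<integral>t. e (r (Suc j)) t \<partial>?M) + (\<integral>t. e (r j) t \<partial>?M)"
        using e_int by simp
      moreover have "(0::real) < (1/2) ^ j" "(1/2 :: real) ^ Suc j = (1/2) ^ j / 2" by simp_all
      ultimately show "(\<integral>t. e (r (Suc j)) t + e (r j) t \<partial>?M) \<le> (1/2) ^ j"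
        using r[of j] r[of "Suc j"] by linarith
    qed simp
    finally have "L2_norm \<Omega> D * L2_norm \<Omega> D \<le> (1/2) ^ j * L2_norm \<Omega> D" by (simp add: power2_eq_square)
    then have "L2_norm \<Omega> D \<le> (1/2) ^ j"
      using L2_norm_nonneg[of \<Omega> D] by (cases "L2_norm \<Omega> D = 0") (auto simp: mult_le_cancel_right)
    then show ?thesis by (simp add: D_def[abs_def])
  qed
  obtain G where G: "G \<in> L2 \<Omega>" "\<And>v. v \<in> L2 \<Omega> \<Longrightarrow> (\<lambda>n. L2_inner \<Omega> (F n) v) \<longlonglongrightarrow> L2_inner \<Omega> G v"
    using L2_weak_limit[OF one F cauchy] by blast
  show ?thesis
  proof (intro bexI[OF _ G(1)] ballI conjI)
    fix v assume v: "v \<in> L2 \<Omega>"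
    show i: "integrable ?M (\<lambda>t. L2_inner \<Omega> (f t) v)"
    proof (rule Bochner_Integration.integrable_bound)
      show "integrable ?M (\<lambda>t. L2_norm \<Omega> (f t) * L2_norm \<Omega> v)" using nf by (rule integrable_mult_left)
      show "AE t in ?M. norm (L2_inner \<Omega> (f t) v) \<le> norm (L2_norm \<Omega> (f t) * L2_norm \<Omega> v)"
        using f2 by eventually_elim (use L2_Cauchy_Schwarz[OF _ v] in \<open>auto simp: abs_mult\<close>)
      show "(\<lambda>t. L2_inner \<Omega> (f t) v) \<in> borel_measurable ?M"
      proof (rule borel_measurable_lebesgue_on_AE_limit[OF J(1)])
        show "(\<lambda>t. L2_inner \<Omega> (s n t) v) \<in> borel_measurable ?M" for n
          using simple_L2_measurable[OF J(1) s, of "\<lambda>u. L2_inner \<Omega> u v"] .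
        show "AE t in ?M. (\<lambda>n. L2_inner \<Omega> (s n t) v) \<longlonglongrightarrow> L2_inner \<Omega> (f t) v"
          using good
        proof eventually_elim
          case (elim t)
          have "\<bar>L2_inner \<Omega> (s n t) v - L2_inner \<Omega> (f t) v\<bar> \<le> e n t * L2_norm \<Omega> v" for n
            using L2_Cauchy_Schwarz[OF L2_diff v, of "s n t" "f t"] L2_inner_diff_left[of "s n t" \<Omega> "f t" v]
              st elim v by (simp add: e_def L2_norm_minus_commute[of \<Omega> "s n t" "f t"])
          moreover have "(\<lambda>n. e n t * L2_norm \<Omega> v) \<longlonglongrightarrow> 0"
            using elim by (intro tendsto_mult_left_zero) (simp add: e_def)
          ultimately have "(\<lambda>n. L2_inner \<Omega> (s n t) v - L2_inner \<Omega> (f t) v) \<longlonglongrightarrow> 0"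
            by (rule LIMSEQ_null_bound)
          then show ?case by (rule LIM_zero_cancel)
        qed
      qed
    qed
    have "\<bar>L2_inner \<Omega> (F j) v - (\<integral>t. L2_inner \<Omega> (f t) v \<partial>?M)\<bar> \<le> (1/2) ^ j * L2_norm \<Omega> v" for j
    proof -
      have "\<bar>L2_inner \<Omega> (F j) v - (\<integral>t. L2_inner \<Omega> (f t) v \<partial>?M)\<bar> \<le> (\<integral>t. e (r j) t \<partial>?M) * L2_norm \<Omega> v"
        unfolding Fv[OF v]
      proof (rule inner_diff[OF Fi[OF v] i e_int _ v])
        show "AE t in ?M. s (r j) t \<in> L2 \<Omega> \<and> f t \<in> L2 \<Omega> \<and> L2_norm \<Omega> (\<lambda>x. s (r j) t x - f t x) \<le> e (r j) t"
          using good
          by eventually_elim (use st in \<open>auto simp: e_def L2_norm_minus_commute[of \<Omega> "s (r j) _"]\<close>)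
      qed
      also have "\<dots> \<le> (1/2) ^ j * L2_norm \<Omega> v"
      proof (rule mult_right_mono)
        have "(0::real) < (1/2) ^ j" by simp
        then show "(\<integral>t. e (r j) t \<partial>?M) \<le> (1/2) ^ j" using r[of j] by linarith
      qed simp
      finally show ?thesis by simp
    qed
    moreover have "(\<lambda>j. (1/2) ^ j * L2_norm \<Omega> v) \<longlonglongrightarrow> 0"
      by (intro tendsto_mult_left_zero LIMSEQ_realpow_zero) auto
    ultimately have "(\<lambda>j. L2_inner \<Omega> (F j) v - (\<integral>t. L2_inner \<Omega> (f t) v \<partial>?M)) \<longlonglongrightarrow> 0"
      by (rule LIMSEQ_null_bound)
    then have "(\<lambda>j. L2_inner \<Omega> (F j) v) \<longlonglongrightarrow> (\<integral>t. L2_inner \<Omega> (f t) v \<partial>?M)" by (rule LIM_zero_cancel)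
    then show "L2_inner \<Omega> G v = (\<integral>t. L2_inner \<Omega> (f t) v \<partial>?M)"
      using G(2)[OF v] LIMSEQ_unique by blast
  qed
qed

lemma strongly_measurable_L2_subset:
  assumes f: "strongly_measurable_L2 \<Omega> J f" and J: "J \<in> sets lebesgue" and K: "K \<in> sets lebesgue" "K \<subseteq> J"
  shows "strongly_measurable_L2 \<Omega> K f"
proof -
  obtain s where s: "\<And>n. finite (s n ` J) \<and> s n ` J \<subseteq> L2 \<Omega> \<and> (\<forall>g. {t \<in> J. s n t = g} \<in> sets lebesgue)"
    and lim: "AE t in lebesgue_on J. (\<lambda>n. L2_norm \<Omega> (\<lambda>x. f t x - s n t x)) \<longlonglongrightarrow> 0"
    using f unfolding strongly_measurable_L2_def by blast
  have "finite (s n ` K) \<and> s n ` K \<subseteq> L2 \<Omega> \<and> (\<forall>g. {t \<in> K. s n t = g} \<in> sets lebesgue)" for n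
  proof -
    have eq: "{t \<in> K. s n t = g} = {t \<in> J. s n t = g} \<inter> K" for g using K by auto
    have sub: "s n ` K \<subseteq> s n ` J" using K by auto
    have J: "finite (s n ` J)" "s n ` J \<subseteq> L2 \<Omega>" "\<And>g. {t \<in> J. s n t = g} \<in> sets lebesgue"
      using s[of n] by blast+
    show ?thesis
      using finite_subset[OF sub J(1)] subset_trans[OF sub J(2)] sets.Int[OF J(3) K(1)] by (simp add: eq)
  qed
  moreover have "AE t in lebesgue_on K. (\<lambda>n. L2_norm \<Omega> (\<lambda>x. f t x - s n t x)) \<longlonglongrightarrow> 0"
    using lim J K by (auto simp: AE_restrict_space_iff elim!: eventually_mono)
  ultimately show ?thesis unfolding strongly_measurable_L2_def by blast
qed

text \<open>Jensen's inequality for the average over a set of finite measure, by the tangent of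
  \<open>y powr p\<close> at the mean value.\<close>

lemma powr_average_le:
  fixes g :: "'a \<Rightarrow> real"
  assumes p: "1 \<le> p" and k: "0 < k" and M: "finite_measure M" "measure M (space M) = k"
    and g: "\<And>x. 0 \<le> g x" "integrable M g" "integrable M (\<lambda>x. g x powr p)"
  shows "k * ((\<integral>x. g x \<partial>M) / k) powr p \<le> (\<integral>x. g x powr p \<partial>M)"
proof -
  interpret finite_measure M by (rule M)
  define y where "y = (\<integral>x. g x \<partial>M) / k"
  have y0: "0 \<le> y" unfolding y_def using g k by (intro divide_nonneg_pos integral_nonneg_AE) auto
  show ?thesis
  proof (cases "y = 0")
    case True
    then show ?thesis using p unfolding y_def[symmetric] by (simp add: integral_nonneg_AE)
  next
    case False
    then have y: "0 < y" using y0 by simp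
    define D where "D = p * y powr (p - 1)"
    have tangent: "y powr p + D * (z - y) \<le> z powr p" if "0 \<le> z" for z
    proof (cases "z = 0")
      case True
      have "y powr p = y powr (p - 1) * y" using y powr_add[of y "p - 1" 1] by simp
      then have "y powr p + D * (z - y) = (1 - p) * y powr p" using True by (simp add: D_def algebra_simps)
      also have "\<dots> \<le> 0" using p by (intro mult_nonpos_nonneg) auto
      finally show ?thesis using True p by simp
    next
      case False
      have "z powr p - y powr p \<ge> D * (z - y)"
      proof (rule convex_on_imp_above_tangent[OF powr_convex[OF p]])
        show "((\<lambda>x. x powr p) has_real_derivative D) (at y within {0<..})"
          unfolding D_def using y by (auto intro!: derivative_eq_intros)
      qed (use y that False in \<open>auto simp: interior_open\<close>)
      then show ?thesis by simp
    qed
    have "k * y powr p = (\<integral>x. y powr p + D * (g x - y) \<partial>M)"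
      using g M k by (simp add: y_def)
    also have "\<dots> \<le> (\<integral>x. g x powr p \<partial>M)"
      using g tangent by (intro integral_mono) auto
    finally show ?thesis by (simp add: y_def)
  qed
qed

section \<open>Test functions\<close>

text \<open>Iterated derivatives as witnesses make products and compositions a matter of induction.\<close>

primrec diff_times :: "nat \<Rightarrow> (real \<Rightarrow> real) \<Rightarrow> bool" where
  "diff_times 0 h \<longleftrightarrow> True"
| "diff_times (Suc k) h \<longleftrightarrow> (\<exists>h'. (\<forall>x. (h has_real_derivative h' x) (at x)) \<and> diff_times k h')"

lemma diff_times_Suc_imp: "diff_times (Suc k) h \<Longrightarrow> diff_times k h"
  by (induction k arbitrary: h) (simp, metis diff_times.simps(2))

lemma diff_times_add: "diff_times k f \<Longrightarrow> diff_times k g \<Longrightarrow> diff_times k (\<lambda>x. f x + g x)"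
proof (induction k arbitrary: f g)
  case (Suc k)
  obtain f' g' where "\<forall>x. (f has_real_derivative f' x) (at x)" "diff_times k f'"
    "\<forall>x. (g has_real_derivative g' x) (at x)" "diff_times k g'" using Suc.prems by auto
  then show ?case using Suc.IH[of f' g'] by (auto intro!: exI[of _ "\<lambda>x. f' x + g' x"] DERIV_add)
qed simp

lemma diff_times_mult: "diff_times k f \<Longrightarrow> diff_times k g \<Longrightarrow> diff_times k (\<lambda>x. f x * g x)"
proof (induction k arbitrary: f g)
  case (Suc k)
  obtain f' g' where d: "\<forall>x. (f has_real_derivative f' x) (at x)" "diff_times k f'"
    "\<forall>x. (g has_real_derivative g' x) (at x)" "diff_times k g'" using Suc.prems by auto
  have "diff_times k (\<lambda>x. f' x * g x + g' x * f x)"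
    using d Suc.IH[of f' g] Suc.IH[of g' f] Suc.prems[THEN diff_times_Suc_imp] by (intro diff_times_add) auto
  moreover have "\<forall>x. ((\<lambda>x. f x * g x) has_real_derivative f' x * g x + g' x * f x) (at x)"
    using d by (auto intro!: DERIV_mult)
  ultimately show ?case by (auto intro!: exI[of _ "\<lambda>x. f' x * g x + g' x * f x"])
qed simp

lemma diff_times_affine: "diff_times k f \<Longrightarrow> diff_times k (\<lambda>x. f (c * x + d))"
proof (induction k arbitrary: f)
  case (Suc k)
  obtain f' where f': "\<forall>x. (f has_real_derivative f' x) (at x)" "diff_times k f'" using Suc.prems by auto
  have "diff_times k (\<lambda>x::real. c)" by (induction k arbitrary: c) (auto intro!: exI[of _ "\<lambda>x. 0"])
  then have "diff_times k (\<lambda>x. f' (c * x + d) * c)"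
    using Suc.IH[OF f'(2)] by (intro diff_times_mult)
  moreover have "\<forall>x. ((\<lambda>x. f (c * x + d)) has_real_derivative f' (c * x + d) * c) (at x)"
    using f'(1) by (auto intro!: DERIV_chain2[where g = "\<lambda>x. c * x + d"] derivative_eq_intros)
  ultimately show ?case by auto
qed simp

text \<open>The flat function \<open>exp (- 1 / x)\<close> times a polynomial in \<open>1 / x\<close>, a class that contains the derivatives of
  its members.\<close>

definition flat_exp :: "real poly \<Rightarrow> real \<Rightarrow> real" where
  "flat_exp p x = (if x > 0 then poly p (1 / x) * exp (- (1 / x)) else 0)"

lemma poly_exp_tendsto_0: "((\<lambda>y. poly p y * exp (- y)) \<longlongrightarrow> 0) (at_top :: real filter)"
proof -
  have "((\<lambda>y. \<Sum>i\<le>degree p. coeff p i * (y ^ i / exp y)) \<longlongrightarrow> (\<Sum>i\<le>degree p. coeff p i * 0)) (at_top :: real filter)"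
    by (intro tendsto_sum tendsto_mult tendsto_const tendsto_power_div_exp_0)
  then show ?thesis by (simp add: poly_altdef sum_distrib_right sum_divide_distrib exp_minus field_simps)
qed

lemma flat_exp_deriv: "(flat_exp p has_real_derivative flat_exp ([:0, 0, 1:] * (p - pderiv p)) x) (at x)"
proof -
  consider "x > 0" | "x < 0" | "x = 0" by linarith
  then show ?thesis
  proof cases
    case 1
    have "((\<lambda>x. poly p (1 / x) * exp (- (1 / x))) has_real_derivative
        poly (pderiv p) (1 / x) * (- 1 / x\<^sup>2) * exp (- (1 / x)) + exp (- (1 / x)) * (1 / x\<^sup>2) * poly p (1 / x)) (at x)"
      using 1 by (auto intro!: derivative_eq_intros DERIV_chain2[OF poly_DERIV] simp: power2_eq_square)
    moreover have "poly (pderiv p) (1 / x) * (- 1 / x\<^sup>2) * exp (- (1 / x)) + exp (- (1 / x)) * (1 / x\<^sup>2) * poly p (1 / x)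
        = flat_exp ([:0, 0, 1:] * (p - pderiv p)) x"
      using 1 by (simp add: flat_exp_def power2_eq_square field_simps)
    ultimately have "((\<lambda>x. poly p (1 / x) * exp (- (1 / x))) has_real_derivative flat_exp ([:0, 0, 1:] * (p - pderiv p)) x) (at x)"
      by simp
    then show ?thesis
      by (rule has_field_derivative_transform_within_open[of _ _ _ "{0<..}"]) (use 1 in \<open>auto simp: flat_exp_def\<close>)
  next
    case 2
    have "((\<lambda>x. 0) has_real_derivative 0) (at x)" by simp
    then have "(flat_exp p has_real_derivative 0) (at x)"
      by (rule has_field_derivative_transform_within_open[of _ _ _ "{..<0}"]) (use 2 in \<open>auto simp: flat_exp_def\<close>)
    then show ?thesis using 2 by (simp add: flat_exp_def)
  next
    case 3
    have "((\<lambda>h. flat_exp p h / h) \<longlongrightarrow> 0) (at 0)"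
    proof (rule filterlim_split_at)
      have "eventually (\<lambda>h. 0 = flat_exp p h / h) (at_left 0)"
        by (auto simp: eventually_at_left_field flat_exp_def intro!: exI[of _ "-1"])
      then show "((\<lambda>h. flat_exp p h / h) \<longlongrightarrow> 0) (at_left 0)"
        by (rule Lim_transform_eventually[OF tendsto_const])
      have "eventually (\<lambda>y. poly ([:0, 1:] * p) y * exp (- y) = flat_exp p (inverse y) / inverse y) at_top"
        using eventually_gt_at_top[of 0] by eventually_elim (simp add: flat_exp_def field_simps)
      then have "((\<lambda>y. flat_exp p (inverse y) / inverse y) \<longlongrightarrow> 0) at_top"
        by (rule Lim_transform_eventually[OF poly_exp_tendsto_0])
      then show "((\<lambda>h. flat_exp p h / h) \<longlongrightarrow> 0) (at_right 0)"
        by (subst filterlim_at_right_to_top)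
    qed
    then show ?thesis using 3 by (simp add: has_field_derivative_iff flat_exp_def)
  qed
qed

lemma diff_times_flat_exp: "diff_times k (flat_exp p)"
proof (induction k arbitrary: p)
  case (Suc k)
  then show ?case using flat_exp_deriv[of p] by (auto intro!: exI[of _ "flat_exp ([:0, 0, 1:] * (p - pderiv p))"])
qed simp

text \<open>A partial derivative of a product of functions of single coordinates is again such a product.\<close>

lemma C_times_product:
  fixes h :: "'n::finite \<Rightarrow> real \<Rightarrow> real"
  assumes "\<And>i. diff_times (Suc k) (h i)"
  shows "C_times k (\<lambda>x :: real ^ 'n. \<Prod>i\<in>UNIV. h i (x $ i))"
  using assms
proof (induction k arbitrary: h)
  case 0
  have "continuous_on UNIV (h i)" for i
    using 0[of i] by (meson DERIV_isCont continuous_at_imp_continuous_on diff_times.simps(2))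
  then have "continuous_on UNIV (\<lambda>x :: real ^ 'n. h i (x $ i))" for i
    by (rule continuous_on_compose2) (auto intro: continuous_intros)
  then show ?case by (auto intro!: continuous_on_prod)
next
  case (Suc k)
  have "\<forall>i. \<exists>h'. (\<forall>x. (h i has_real_derivative h' x) (at x)) \<and> diff_times (Suc k) h'"
    using Suc.prems by simp
  then obtain h' where h': "\<And>i x. (h i has_real_derivative h' i x) (at x)" "\<And>i. diff_times (Suc k) (h' i)"
    by metis
  have D: "((\<lambda>x :: real ^ 'n. \<Prod>i\<in>UNIV. h i (x $ i)) has_derivative
      (\<lambda>v. \<Sum>i\<in>UNIV. (h' i (x $ i) * v $ i) * (\<Prod>j\<in>UNIV - {i}. h j (x $ j)))) (at x)" for x
  proof (rule has_derivative_prod)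
    fix i
    have "((\<lambda>x :: real ^ 'n. x $ i) has_derivative (\<lambda>v. v $ i)) (at x)"
      by (intro bounded_linear_imp_has_derivative bounded_linear_vec_nth)
    from has_derivative_compose[OF this h'(1)[unfolded has_field_derivative_def]]
    show "((\<lambda>x :: real ^ 'n. h i (x $ i)) has_derivative (\<lambda>v. h' i (x $ i) * v $ i)) (at x)" by simp
  qed
  have P: "partial j (\<lambda>x :: real ^ 'n. \<Prod>i\<in>UNIV. h i (x $ i)) = (\<lambda>x. \<Prod>i\<in>UNIV. (if i = j then h' i else h i) (x $ i))" for j
  proof
    fix x :: "real ^ 'n"
    have "partial j (\<lambda>x :: real ^ 'n. \<Prod>i\<in>UNIV. h i (x $ i)) x
        = (\<Sum>i\<in>UNIV. (h' i (x $ i) * (axis j 1 :: real ^ 'n) $ i) * (\<Prod>j\<in>UNIV - {i}. h j (x $ j)))"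
      unfolding partial_def frechet_derivative_at[OF D, symmetric] ..
    also have "\<dots> = (\<Sum>i\<in>UNIV. if i = j then h' j (x $ j) * (\<Prod>i\<in>UNIV - {j}. h i (x $ i)) else 0)"
      by (intro sum.cong) (auto simp: axis_def)
    also have "\<dots> = h' j (x $ j) * (\<Prod>i\<in>UNIV - {j}. h i (x $ i))" by simp
    also have "\<dots> = (\<Prod>i\<in>UNIV. (if i = j then h' i else h i) (x $ i))"
      by (subst (2) prod.remove[of _ j]) (auto intro!: prod.cong)
    finally show "partial j (\<lambda>x. \<Prod>i\<in>UNIV. h i (x $ i)) x = \<dots>" .
  qed
  have "C_times k (\<lambda>x :: real ^ 'n. \<Prod>i\<in>UNIV. (if i = j then h' i else h i) (x $ i))" for j
  proof (rule Suc.IH)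
    fix i
    show "diff_times (Suc k) (if i = j then h' i else h i)"
      using h'(2)[of i] diff_times_Suc_imp[OF Suc.prems[of i]] by (auto simp del: diff_times.simps)
  qed
  moreover have "(\<lambda>x :: real ^ 'n. \<Prod>i\<in>UNIV. h i (x $ i)) differentiable_on UNIV"
    using D unfolding differentiable_on_def differentiable_def by blast
  ultimately show ?case by (simp add: P)
qed

text \<open>Rescaling one bump gives bounded test functions that converge to the indicator of the box.\<close>

lemma test_functions_approximate_box:
  fixes a b :: "real ^ 'n"
  assumes "cbox a b \<subseteq> \<Omega>" "box a b \<noteq> {}"
  shows "\<exists>\<phi>. (\<forall>n. \<phi> n \<in> test_functions \<Omega>) \<and> (\<forall>n x. \<bar>\<phi> n x\<bar> \<le> 1) \<and>
    (\<forall>x. (\<lambda>n. \<phi> n x) \<longlonglongrightarrow> indicator (box a b) x)"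
proof -
  define \<eta> where "\<eta> n i s = flat_exp 1 (real (Suc n) * s + (- real (Suc n) * (a $ i))) * flat_exp 1 (- real (Suc n) * s + real (Suc n) * (b $ i))"
    for n i s
  define \<phi> where "\<phi> n x = (\<Prod>i\<in>UNIV. \<eta> n i (x $ i))" for n and x :: "real ^ 'n"
  have \<eta>: "\<eta> n i s = (if a $ i < s \<and> s < b $ i then exp (- (1 / (real (Suc n) * (s - a $ i)))) * exp (- (1 / (real (Suc n) * (b $ i - s)))) else 0)"
    for n i s
  proof -
    have "real (Suc n) * s + (- real (Suc n) * (a $ i)) = real (Suc n) * (s - a $ i)"
      "- real (Suc n) * s + real (Suc n) * (b $ i) = real (Suc n) * (b $ i - s)"
      by (simp_all add: algebra_simps)
    then show ?thesis unfolding \<eta>_def flat_exp_def by (simp add: zero_less_mult_iff del: of_nat_Suc)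
  qed
  have smooth: "C_times k (\<phi> n)" for k n
    unfolding \<phi>_def \<eta>_def by (intro C_times_product diff_times_mult diff_times_affine diff_times_flat_exp)
  have box: "x \<in> box a b \<longleftrightarrow> (\<forall>i. a $ i < x $ i \<and> x $ i < b $ i)" for x by (simp add: mem_box_cart)
  have supp: "{x. \<phi> n x \<noteq> 0} = box a b" for n
    by (auto simp: \<phi>_def \<eta> box)
  have "\<phi> n \<in> test_functions \<Omega>" for n
    using assms smooth unfolding test_functions_def by (simp add: supp)
  moreover have "\<bar>\<phi> n x\<bar> \<le> 1" for n x
    unfolding \<phi>_def abs_prod
    by (intro prod_le_1) (auto simp: \<eta> abs_mult intro!: mult_le_one)
  moreover have "(\<lambda>n. \<phi> n x) \<longlonglongrightarrow> indicator (box a b) x" for x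
  proof (cases "x \<in> box a b")
    case True
    have one: "(\<lambda>n. exp (- (1 / (real (Suc n) * r)))) \<longlonglongrightarrow> 1" if "r > 0" for r :: real
    proof -
      have "(\<lambda>n. exp (- (inverse (real (Suc n)) * (1 / r)))) \<longlonglongrightarrow> exp (- (0 * (1 / r)))"
        by (intro tendsto_exp tendsto_minus tendsto_mult tendsto_const LIMSEQ_inverse_real_of_nat)
      then show ?thesis by (simp add: divide_simps del: of_nat_Suc)
    qed
    have "(\<lambda>n. \<phi> n x) \<longlonglongrightarrow> (\<Prod>i\<in>(UNIV :: 'n set). 1 * 1)"
      unfolding \<phi>_def
    proof (rule tendsto_prod)
      fix i
      have "a $ i < x $ i" "x $ i < b $ i" using True by (auto simp: box)
      then show "(\<lambda>n. \<eta> n i (x $ i)) \<longlonglongrightarrow> 1 * 1" by (simp only: \<eta> if_True simp_thms) (intro tendsto_mult one; simp)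
    qed
    then show ?thesis using True by simp
  next
    case False
    then have "\<phi> n x = 0" for n using supp[of n] by blast
    then show ?thesis using False by simp
  qed
  ultimately show ?thesis by blast
qed

lemma zero_test_function: "(\<lambda>x. 0) \<in> test_functions \<Omega>"
proof -
  have "partial i (\<lambda>x :: real ^ 'a. 0) = (\<lambda>x. 0)" for i
    by (rule ext) (simp add: partial_def)
  then have "C_times k (\<lambda>x :: real ^ 'a. 0)" for k by (induction k) (auto simp: differentiable_on_const)
  then show ?thesis by (simp add: test_functions_def)
qed


section \<open>Integration by parts and uniqueness of weak derivatives\<close>

lemma partial_eq:
  assumes "(h has_derivative D) (at x)"
  shows "partial i h x = D (axis i 1)"
  unfolding partial_def using frechet_derivative_at[OF assms] by simp

lemma partial_along_line:
  fixes h :: "real ^ 'n \<Rightarrow> real"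
  assumes "h differentiable_on UNIV"
  shows "((\<lambda>s. h (x + s *\<^sub>R axis i 1)) has_real_derivative partial i h (x + r *\<^sub>R axis i 1)) (at r)"
proof -
  have D: "(h has_derivative frechet_derivative h (at (x + r *\<^sub>R axis i 1))) (at (x + r *\<^sub>R axis i 1))"
    using assms by (simp add: differentiable_on_def frechet_derivative_works)
  interpret bounded_linear "frechet_derivative h (at (x + r *\<^sub>R axis i 1))"
    using D by (rule has_derivative_bounded_linear)
  have "((\<lambda>s. x + s *\<^sub>R axis i 1) has_derivative (\<lambda>s. s *\<^sub>R (axis i 1 :: real ^ 'n))) (at r)"
    by (auto intro!: derivative_eq_intros)
  from has_derivative_compose[OF this D] show ?thesis
    by (simp add: has_field_derivative_def scaleR partial_def mult.commute[of _ "frechet_derivative h _ _"])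
qed

lemma partial_outside_support:
  fixes h :: "real ^ 'n \<Rightarrow> real"
  assumes "x \<notin> closure {x. h x \<noteq> 0}"
  shows "h x = 0" "partial i h x = 0"
proof -
  have x: "x \<in> - closure {x. h x \<noteq> 0}" using assms by simp
  show "h x = 0" using assms closure_subset[of "{x. h x \<noteq> 0}"] by blast
  have "((\<lambda>x :: real ^ 'n. 0 :: real) has_derivative (\<lambda>v. 0)) (at x)" by simp
  then have "(h has_derivative (\<lambda>v. 0)) (at x)"
  proof (rule has_derivative_transform_within_open[where s = "- closure {x. h x \<noteq> 0}"])
    show "0 = h y" if "y \<in> - closure {x. h x \<noteq> 0}" for y
      using that closure_subset[of "{x. h x \<noteq> 0}"] by auto
  qed (use x in auto)
  then show "partial i h x = 0" by (simp add: partial_eq)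
qed

text \<open>Translation invariance of the integral, differentiated.\<close>

lemma integral_partial_eq_0:
  fixes h :: "real ^ 'n \<Rightarrow> real"
  assumes d: "h differentiable_on UNIV" and c: "continuous_on UNIV (partial i h)"
    and supp: "compact (closure {x. h x \<noteq> 0})"
  shows "(\<integral>x. partial i h x \<partial>lborel) = 0"
proof -
  let ?D = "partial i h"
  let ?e = "axis i 1 :: real ^ 'n"
  obtain R where R: "\<And>x. x \<in> closure {x. h x \<noteq> 0} \<Longrightarrow> norm x \<le> R"
    using compact_imp_bounded[OF supp] by (auto simp: bounded_iff)
  have out: "h x = 0" "?D x = 0" if "norm x > R" for x
    using partial_outside_support[of x h] R[of x] that by auto
  have hc: "continuous_on UNIV h" using d by (rule differentiable_imp_continuous_on)
  obtain B where B: "\<And>x. x \<in> cball 0 R \<Longrightarrow> norm (?D x) \<le> B"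
    using compact_imp_bounded[OF compact_continuous_image[OF continuous_on_subset[OF c] compact_cball]]
    unfolding bounded_iff by (metis imageI subset_UNIV)
  define B' where "B' = max B 0"
  have B': "\<bar>?D x\<bar> \<le> B'" for x using B[of x] out(2)[of x] by (cases "norm x \<le> R") (auto simp: B'_def)
  have hi: "integrable lborel h"
  proof -
    have "integrable lborel (\<lambda>x. indicator (cball 0 R) x *\<^sub>R h x)"
      by (rule borel_integrable_compact[of "cball 0 R" h]) (auto intro: continuous_on_subset[OF hc])
    moreover have "(\<lambda>x. indicator (cball 0 R) x *\<^sub>R h x) = h"
      using out(1) by (fastforce simp: indicator_def)
    ultimately show ?thesis by simp
  qed
  have hm: "h \<in> borel_measurable borel" and Dm: "?D \<in> borel_measurable borel"
    using hc c by (auto intro: borel_measurable_continuous_onI)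
  have shift: "integrable lborel (\<lambda>x. h (x + v)) \<and> (\<integral>x. h (x + v) \<partial>lborel) = (\<integral>x. h x \<partial>lborel)" for v
  proof -
    have "integrable (distr lborel borel ((+) v)) h" using hi by (simp add: lborel_distr_plus)
    then have "integrable lborel (\<lambda>x. h (v + x))" by (subst (asm) integrable_distr_eq) (auto simp: hm)
    moreover have "(\<integral>x. h (v + x) \<partial>lborel) = (\<integral>x. h x \<partial>distr lborel borel ((+) v))"
      by (subst integral_distr) (auto simp: hm)
    ultimately show ?thesis by (simp add: lborel_distr_plus add.commute)
  qed
  define q where "q n x = (h (x + inverse (real (Suc n)) *\<^sub>R ?e) - h x) / inverse (real (Suc n))" for n x
  have q_int: "(\<integral>x. q n x \<partial>lborel) = 0" for n
    unfolding q_def using shift[of "inverse (real (Suc n)) *\<^sub>R ?e"] hi by simp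
  have "(\<lambda>n. \<integral>x. q n x \<partial>lborel) \<longlonglongrightarrow> (\<integral>x. ?D x \<partial>lborel)"
  proof (rule integral_dominated_convergence[where w = "\<lambda>x. B' * indicator (cball 0 (R + 1)) x"])
    show "?D \<in> borel_measurable lborel" using Dm by simp
    have "(\<lambda>x. h (x + v)) \<in> borel_measurable borel" for v using hm by measurable
    then show "q n \<in> borel_measurable lborel" for n unfolding q_def using hm by simp
    show "integrable lborel (\<lambda>x. B' * indicator (cball 0 (R + 1)) x :: real)"
      by (intro integrable_mult_right integrable_real_indicator) (use emeasure_bounded_finite[OF bounded_cball] in auto)
    show "AE x in lborel. (\<lambda>n. q n x) \<longlonglongrightarrow> ?D x"
    proof (rule AE_I2)
      fix x :: "real ^ 'n"
      have "((\<lambda>s. (h (x + s *\<^sub>R ?e) - h x) / s) \<longlongrightarrow> ?D x) (at 0)"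
        using partial_along_line[OF d, of x i 0] by (simp add: has_field_derivative_iff)
      moreover have "filterlim (\<lambda>n. inverse (real (Suc n))) (at 0) sequentially"
        by (intro filterlim_atI LIMSEQ_inverse_real_of_nat always_eventually) auto
      ultimately show "(\<lambda>n. q n x) \<longlonglongrightarrow> ?D x" unfolding q_def by (rule filterlim_compose)
    qed
    show "AE x in lborel. norm (q n x) \<le> B' * indicator (cball 0 (R + 1)) x" for n
    proof (rule AE_I2)
      fix x :: "real ^ 'n"
      define r where "r = inverse (real (Suc n))"
      have r: "0 < r" "r \<le> 1" by (auto simp: r_def divide_simps)
      obtain z where z: "h (x + r *\<^sub>R ?e) - h (x + 0 *\<^sub>R ?e) = (r - 0) * ?D (x + z *\<^sub>R ?e)"
        using MVT2[of 0 r "\<lambda>s. h (x + s *\<^sub>R ?e)" "\<lambda>s. ?D (x + s *\<^sub>R ?e)"] partial_along_line[OF d] r by blast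
      then have qz: "q n x = ?D (x + z *\<^sub>R ?e)" unfolding q_def r_def[symmetric] using r by simp
      show "norm (q n x) \<le> B' * indicator (cball 0 (R + 1)) x"
      proof (cases "norm x \<le> R + 1")
        case True then show ?thesis using B' by (simp add: qz)
      next
        case False
        have "norm x \<le> norm (x + r *\<^sub>R ?e) + norm (r *\<^sub>R ?e)"
          by (metis add_diff_cancel_right' norm_triangle_sub norm_triangle_ineq4)
        then have "norm (x + r *\<^sub>R ?e) > R" using False r by (simp add: norm_axis_1)
        then show ?thesis using False out(1)[of x] out(1)[of "x + r *\<^sub>R ?e"] by (simp add: q_def r_def)
      qed
    qed
  qed
  then show ?thesis using q_int LIMSEQ_unique[OF _ tendsto_const] by simp
qed

text \<open>The sets on which \<open>g\<close> integrates to \<open>0\<close> form a Dynkin system; it contains the sets where \<open>g\<close> is positive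
  and where it is negative.\<close>

lemma set_integral_boxes_imp_AE_0:
  fixes g :: "'a::euclidean_space \<Rightarrow> real"
  assumes g: "integrable lborel g" and boxes: "\<And>a b. (\<integral>x. g x * indicator (box a b) x \<partial>lborel) = 0"
    and total: "(\<integral>x. g x \<partial>lborel) = 0"
  shows "AE x in lborel. g x = 0"
proof -
  have gi: "integrable lborel (\<lambda>x. g x * indicator A x)" if "A \<in> sets borel" for A
    using integrable_mult_indicator[of A lborel g] g that by (simp add: mult.commute)
  have zero: "(\<integral>x. g x * indicator A x \<partial>lborel) = 0" if A: "A \<in> sets borel" for A
  proof -
    have A': "A \<in> sigma_sets UNIV (range (\<lambda>(a, b). box a b))" using A unfolding borel_eq_box by simp
    have G: "Int_stable (range (\<lambda>(a, b). box a b :: 'a set))" by (auto simp: Int_stable_def box_Int_box)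
    have P: "range (\<lambda>(a, b). box a b :: 'a set) \<subseteq> Pow UNIV" by simp
    from G P A' show ?thesis
    proof (induction rule: sigma_sets_induct_disjoint)
      case (compl A)
      then have "A \<in> sets borel" by (simp add: borel_eq_box)
      moreover have "(\<lambda>x. g x * indicator (UNIV - A) x) = (\<lambda>x. g x - g x * indicator A x)"
        by (auto simp: indicator_def)
      ultimately show ?case using compl g gi total by simp
    next
      case (union A)
      have A: "A i \<in> sets borel" for i using union(2) by (auto simp: borel_eq_box)
      have "(LINT x:(\<Union>i. A i)|lborel. g x) = (\<Sum>i. (LINT x:(A i)|lborel. g x))"
      proof (rule lebesgue_integral_countable_add)
        show "set_integrable lborel (\<Union>i. A i) g"
          using gi[of "\<Union>i. A i"] A by (simp add: set_integrable_def mult.commute sets.countable_UN)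
      qed (use A union(1) in \<open>auto simp: disjoint_family_on_def\<close>)
      then show ?case using union(3) by (simp add: set_lebesgue_integral_def mult.commute)
    qed (use boxes in auto)
  qed
  have gm: "g \<in> borel_measurable borel" using g by auto
  have "AE x in lborel. g x * indicator {x. g x > 0} x = 0" "AE x in lborel. - (g x * indicator {x. g x < 0} x) = 0"
  proof -
    have S: "{x. g x > 0} \<in> sets borel" "{x. g x < 0} \<in> sets borel" using gm by measurable
    have "AE x in lborel. 0 \<le> g x * indicator {x. g x > 0} x" "AE x in lborel. 0 \<le> - (g x * indicator {x. g x < 0} x)"
      by (auto simp: indicator_def)
    then show "AE x in lborel. g x * indicator {x. g x > 0} x = 0" "AE x in lborel. - (g x * indicator {x. g x < 0} x) = 0"
      using integral_nonneg_eq_0_iff_AE[OF gi[OF S(1)]] zero[OF S(1)]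
        integral_nonneg_eq_0_iff_AE[OF integrable_minus[OF gi[OF S(2)]]] zero[OF S(2)] by simp_all
  qed
  then show ?thesis by eventually_elim (auto simp: indicator_def split: if_splits)
qed


lemma test_functionD:
  assumes "\<phi> \<in> test_functions \<Omega>"
  shows "\<phi> differentiable_on UNIV" "continuous_on UNIV \<phi>" "continuous_on UNIV (partial i \<phi>)"
    "compact (closure {x. \<phi> x \<noteq> 0})" "closure {x. \<phi> x \<noteq> 0} \<subseteq> \<Omega>"
proof -
  have "C_times (Suc 0) \<phi>" "C_times 0 \<phi>" using assms unfolding test_functions_def by blast+
  then show "\<phi> differentiable_on UNIV" "continuous_on UNIV \<phi>" "continuous_on UNIV (partial i \<phi>)"
    by simp_all
qed (use assms in \<open>auto simp: test_functions_def\<close>)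

lemma bounded_one_in_L2:
  assumes "bounded \<Omega>" "open \<Omega>"
  shows "(\<lambda>x. 1) \<in> L2 \<Omega>"
proof -
  have "emeasure (lebesgue_on \<Omega>) (space (lebesgue_on \<Omega>)) < \<infinity>"
    using emeasure_bounded_finite[OF assms(1)] assms(2)
    by (simp add: emeasure_restrict_space)
  then have "integrable (lebesgue_on \<Omega>) (\<lambda>x. 1 :: real)"
    by (intro finite_measure.integrable_const) (auto intro!: finite_measureI)
  then show ?thesis by (simp add: L2_def)
qed

lemma compactly_supported_in_L2:
  fixes h :: "real ^ 'n \<Rightarrow> real"
  assumes \<Omega>: "bounded \<Omega>" "open \<Omega>" and h: "continuous_on UNIV h" and K: "compact K" "\<And>x. x \<notin> K \<Longrightarrow> h x = 0"
  shows "h \<in> L2 \<Omega>"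
proof -
  obtain B where B: "\<And>x. x \<in> K \<Longrightarrow> norm (h x) \<le> B"
    using compact_imp_bounded[OF compact_continuous_image[OF continuous_on_subset[OF h] K(1)]]
    unfolding bounded_iff by (metis imageI subset_UNIV)
  show ?thesis
  proof (rule L2_bounded_by[OF L2_scale[OF bounded_one_in_L2[OF \<Omega>], of "\<bar>B\<bar>"]])
    show "h \<in> borel_measurable (lebesgue_on \<Omega>)"
      using h by (intro continuous_imp_measurable_on_sets_lebesgue) (auto intro: continuous_on_subset simp: \<Omega>)
    have "\<bar>h x\<bar> \<le> \<bar>\<bar>B\<bar> * 1\<bar>" for x using B[of x] K(2)[of x] by (cases "x \<in> K") auto
    then show "AE x in lebesgue_on \<Omega>. \<bar>h x\<bar> \<le> \<bar>\<bar>B\<bar> * 1\<bar>" by simp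
  qed
qed

lemma test_function_in_L2:
  assumes \<Omega>: "bounded \<Omega>" "open \<Omega>" and \<phi>: "\<phi> \<in> test_functions \<Omega>"
  shows "\<phi> \<in> L2 \<Omega>" "partial i \<phi> \<in> L2 \<Omega>"
proof -
  note c = compactly_supported_in_L2[OF \<Omega> _ test_functionD(4)[OF \<phi>]]
  show "\<phi> \<in> L2 \<Omega>" using partial_outside_support(1)[of _ \<phi>] by (rule c[OF test_functionD(2)[OF \<phi>]])
  show "partial i \<phi> \<in> L2 \<Omega>" using partial_outside_support(2)[of _ \<phi>] by (rule c[OF test_functionD(3)[OF \<phi>]])
qed

lemma integral_lebesgue_on_eq_lborel:
  fixes h :: "'a::euclidean_space \<Rightarrow> real"
  assumes "\<Omega> \<in> sets lebesgue" "h \<in> borel_measurable borel" "\<And>x. x \<notin> \<Omega> \<Longrightarrow> h x = 0"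
  shows "(\<integral>x. h x \<partial>lebesgue_on \<Omega>) = (\<integral>x. h x \<partial>lborel)"
proof -
  have "(\<lambda>x. indicator \<Omega> x *\<^sub>R h x) = h" using assms(3) by (fastforce simp: indicator_def)
  then show ?thesis using assms by (simp add: integral_restrict_space integral_completion)
qed

text \<open>The product rule, and the vanishing integral of the derivative of a product of test functions.\<close>

lemma weak_partial_test_function:
  fixes \<Omega> :: "(real ^ 'n) set"
  assumes \<Omega>: "bounded \<Omega>" "open \<Omega>" and \<phi>: "\<phi> \<in> test_functions \<Omega>"
  shows "is_weak_partial \<Omega> i \<phi> (partial i \<phi>)"
  unfolding is_weak_partial_def
proof
  fix \<psi> assume \<psi>: "\<psi> \<in> test_functions \<Omega>"
  note d = test_functionD[OF \<phi>] and e = test_functionD[OF \<psi>]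
  have D: "partial i (\<lambda>x. \<phi> x * \<psi> x) = (\<lambda>x. \<phi> x * partial i \<psi> x + partial i \<phi> x * \<psi> x)"
  proof
    fix x
    have "((\<lambda>x. \<phi> x * \<psi> x) has_derivative
        (\<lambda>v. \<phi> x * frechet_derivative \<psi> (at x) v + frechet_derivative \<phi> (at x) v * \<psi> x)) (at x)"
      using d(1) e(1) by (intro has_derivative_mult) (auto simp: differentiable_on_def frechet_derivative_works)
    then show "partial i (\<lambda>x. \<phi> x * \<psi> x) x = \<phi> x * partial i \<psi> x + partial i \<phi> x * \<psi> x"
      by (subst partial_eq) (auto simp: partial_def)
  qed
  have c: "continuous_on UNIV (partial i (\<lambda>x. \<phi> x * \<psi> x))"
    unfolding D by (intro continuous_intros d e)
  have "closure {x. \<phi> x * \<psi> x \<noteq> 0} \<subseteq> closure {x. \<phi> x \<noteq> 0}" by (intro closure_mono) auto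
  then have "compact (closure {x. \<phi> x * \<psi> x \<noteq> 0})"
    using compact_Int_closed[OF d(4) closed_closure] by (metis Int_absorb1)
  then have "(\<integral>x. partial i (\<lambda>x. \<phi> x * \<psi> x) x \<partial>lborel) = 0"
    using c d(1) e(1) by (intro integral_partial_eq_0) (auto intro: differentiable_on_mult)
  moreover have "(\<integral>x. partial i (\<lambda>x. \<phi> x * \<psi> x) x \<partial>lebesgue_on \<Omega>) = (\<integral>x. partial i (\<lambda>x. \<phi> x * \<psi> x) x \<partial>lborel)"
  proof (rule integral_lebesgue_on_eq_lborel)
    show "partial i (\<lambda>x. \<phi> x * \<psi> x) \<in> borel_measurable borel" using c by (rule borel_measurable_continuous_onI)
    show "partial i (\<lambda>x. \<phi> x * \<psi> x) x = 0" if "x \<notin> \<Omega>" for x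
    proof -
      have "x \<notin> closure {x. \<phi> x \<noteq> 0}" using that d(5) by blast
      from partial_outside_support[OF this] show ?thesis by (simp add: D)
    qed
  qed (use \<Omega> in auto)
  moreover have "(\<integral>x. partial i (\<lambda>x. \<phi> x * \<psi> x) x \<partial>lebesgue_on \<Omega>) = L2_inner \<Omega> \<phi> (partial i \<psi>) + L2_inner \<Omega> (partial i \<phi>) \<psi>"
    unfolding D L2_inner_def
    by (intro Bochner_Integration.integral_add L2_integrable_mult test_function_in_L2 \<Omega> \<phi> \<psi>)
  ultimately show "L2_inner \<Omega> \<phi> (partial i \<psi>) = - L2_inner \<Omega> (partial i \<phi>) \<psi>" by simp
qed

text \<open>The fundamental lemma of the calculus of variations: bumps give the boxes compactly inside
  \<open>\<Omega>\<close>, and these determine a function almost everywhere.\<close>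

lemma L2_orthogonal_to_test_functions:
  fixes \<Omega> :: "(real ^ 'n) set"
  assumes \<Omega>: "bounded \<Omega>" "open \<Omega>" and g: "g \<in> L2 \<Omega>"
    and orth: "\<And>\<phi>. \<phi> \<in> test_functions \<Omega> \<Longrightarrow> L2_inner \<Omega> g \<phi> = 0"
  shows "AE x in lebesgue_on \<Omega>. g x = 0"
proof -
  have \<Omega>m: "\<Omega> \<in> sets lebesgue" using \<Omega> by auto
  have one: "(\<lambda>x. 1) \<in> L2 \<Omega>" by (rule bounded_one_in_L2[OF \<Omega>])
  have gi: "integrable (lebesgue_on \<Omega>) g" using L2_integrable_mult[OF g one] by simp
  have box: "(\<integral>x. g x * indicator (box a b) x \<partial>lebesgue_on \<Omega>) = 0" if ab: "cbox a b \<subseteq> \<Omega>" "box a b \<noteq> {}" for a b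
  proof -
    obtain \<phi> where \<phi>: "\<And>n. \<phi> n \<in> test_functions \<Omega>" "\<And>n x. \<bar>\<phi> n x\<bar> \<le> 1"
      "\<And>x. (\<lambda>n. \<phi> n x) \<longlonglongrightarrow> indicator (box a b) x"
      using test_functions_approximate_box[OF ab] by blast
    have "(\<lambda>n. L2_inner \<Omega> g (\<phi> n)) \<longlonglongrightarrow> (\<integral>x. g x * indicator (box a b) x \<partial>lebesgue_on \<Omega>)"
      unfolding L2_inner_def
    proof (rule integral_dominated_convergence[where w = "\<lambda>x. \<bar>g x\<bar>"])
      show "(\<lambda>x. g x * indicator (box a b) x) \<in> borel_measurable (lebesgue_on \<Omega>)"
        using L2_measurable[OF g] \<Omega>m order_trans[OF box_subset_cbox ab(1)]
        by (intro borel_measurable_times borel_measurable_indicator) (auto simp: sets_restrict_space_iff)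
      show "(\<lambda>x. g x * \<phi> n x) \<in> borel_measurable (lebesgue_on \<Omega>)" for n
        using L2_measurable[OF g] L2_measurable[OF test_function_in_L2(1)[OF \<Omega> \<phi>(1)]] by auto
      show "integrable (lebesgue_on \<Omega>) (\<lambda>x. \<bar>g x\<bar>)" using gi by auto
      show "AE x in lebesgue_on \<Omega>. (\<lambda>n. g x * \<phi> n x) \<longlonglongrightarrow> g x * indicator (box a b) x"
        by (intro AE_I2 tendsto_mult tendsto_const \<phi>(3))
      show "AE x in lebesgue_on \<Omega>. norm (g x * \<phi> n x) \<le> \<bar>g x\<bar>" for n
        using \<phi>(2)[of n] by (intro AE_I2) (auto simp: abs_mult intro: mult_left_le)
    qed
    then show ?thesis using orth[OF \<phi>(1)] by (simp add: LIMSEQ_const_iff)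
  qed
  define G where "G x = (if x \<in> \<Omega> then g x else 0)" for x
  have Gi: "integrable lebesgue G"
  proof -
    have "G = (\<lambda>x. indicator \<Omega> x *\<^sub>R g x)" by (auto simp: G_def indicator_def)
    moreover have "\<Omega> \<inter> space lebesgue \<in> sets lebesgue" using \<Omega>m by simp
    ultimately show ?thesis using integrable_restrict_space[of \<Omega> lebesgue g] gi by metis
  qed
  obtain G' where G': "G' \<in> borel_measurable lborel" "AE x in lborel. G x = G' x"
    using completion_ex_borel_measurable_real[of G lborel] Gi by auto
  have AEG: "AE x in lebesgue. G x = G' x" using G'(2) by (rule AE_completion)
  have G'm: "G' \<in> borel_measurable lebesgue" by (rule measurable_completion[OF G'(1)])
  have Gm: "G \<in> borel_measurable lebesgue" by (rule borel_measurable_integrable[OF Gi])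
  have "integrable lebesgue G'" by (rule integrable_cong_AE_imp[OF Gi G'm AEG])
  then have G'i: "integrable lborel G'" using integrable_completion[OF G'(1)] by blast
  have loc: "AE x in lborel. x \<in> cbox c d \<longrightarrow> G x = 0" if cd: "cbox c d \<subseteq> \<Omega>" for c d
  proof -
    define F where "F x = indicator (box c d) x * G' x" for x
    have Fi: "integrable lborel F"
      unfolding F_def using integrable_mult_indicator[OF _ G'i, of "box c d"] by simp
    have *: "(\<integral>x. F x * indicator (box a b) x \<partial>lborel) = 0" for a b
    proof -
      obtain p q where pq: "box c d \<inter> box a b = box p q" by (rule that[OF box_Int_box])
      have "(\<integral>x. F x * indicator (box a b) x \<partial>lborel) = (\<integral>x. G' x * indicator (box p q) x \<partial>lborel)"
        by (simp only: F_def pq[symmetric] indicator_inter_arith mult_ac)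
      also have "\<dots> = (\<integral>x. G' x * indicator (box p q) x \<partial>lebesgue)"
        using G'(1) by (intro integral_completion[symmetric]) auto
      also have "\<dots> = (\<integral>x. G x * indicator (box p q) x \<partial>lebesgue)"
      proof (rule integral_cong_AE)
        have b: "box p q \<in> sets lebesgue" by simp
        show "(\<lambda>x. G' x * indicator (box p q) x) \<in> borel_measurable lebesgue"
          "(\<lambda>x. G x * indicator (box p q) x) \<in> borel_measurable lebesgue"
          by (intro borel_measurable_times G'm Gm borel_measurable_indicator b)+
        show "AE x in lebesgue. G' x * indicator (box p q) x = G x * indicator (box p q) x"
          using AEG by eventually_elim simp
      qed
      also have "\<dots> = (\<integral>x. g x * indicator (box p q) x \<partial>lebesgue_on \<Omega>)"
      proof -
        have "indicator \<Omega> x *\<^sub>R (g x * indicator (box p q) x) = G x * indicator (box p q) x" for x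
          by (simp add: G_def indicator_def)
        then show ?thesis using \<Omega>m by (simp only: integral_restrict_space sets.Int_space_eq2)
      qed
      also have "\<dots> = 0"
      proof (cases "box p q = {}")
        case False
        have "cbox p q \<subseteq> cbox c d"
        proof -
          have "box p q \<subseteq> cbox c d" using pq box_subset_cbox[of c d] by blast
          from closure_minimal[OF this closed_cbox] show ?thesis by (simp only: closure_box[OF False])
        qed
        then show ?thesis using box[of p q] False cd by blast
      qed simp
      finally show ?thesis .
    qed
    have "AE x in lborel. F x = 0"
    proof (rule set_integral_boxes_imp_AE_0[OF Fi *])
      have "F = (\<lambda>x. F x * indicator (box c d) x)" by (auto simp: F_def indicator_def)
      then show "(\<integral>x. F x \<partial>lborel) = 0" using *[of c d] by simp
    qed
    moreover have "AE x in lborel. x \<notin> cbox c d - box c d"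
    proof (rule AE_not_in)
      have "negligible (cbox c d - box c d)" by (rule negligible_frontier_interval)
      then have "emeasure lebesgue (cbox c d - box c d) = 0" by (simp add: negligible_iff_null_sets null_sets_def)
      then show "cbox c d - box c d \<in> null_sets lborel" by (auto simp: null_sets_def)
    qed
    ultimately show ?thesis using G'(2) by eventually_elim (auto simp: F_def indicator_def split: if_splits)
  qed
  obtain \<D> where \<D>: "countable \<D>" "\<D> \<subseteq> Pow \<Omega>" "\<And>X. X \<in> \<D> \<Longrightarrow> \<exists>a b. X = cbox a b" "\<Union>\<D> = \<Omega>"
    by (rule open_countable_Union_open_cbox[OF \<Omega>(2)]) (rule that, assumption+)
  have "AE x in lborel. \<forall>X\<in>\<D>. x \<in> X \<longrightarrow> G x = 0"
    unfolding AE_ball_countable[OF \<D>(1)]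
  proof
    fix X assume "X \<in> \<D>"
    then obtain a b where "X = cbox a b" "cbox a b \<subseteq> \<Omega>" using \<D>(2,3) by blast
    then show "AE x in lborel. x \<in> X \<longrightarrow> G x = 0" using loc by simp
  qed
  then have "AE x in lebesgue. \<forall>X\<in>\<D>. x \<in> X \<longrightarrow> G x = 0" by (rule AE_completion)
  then have "AE x in lebesgue. x \<in> \<Omega> \<longrightarrow> g x = 0"
  proof eventually_elim
    case (elim x)
    show ?case
    proof
      assume x: "x \<in> \<Omega>"
      then obtain X where "X \<in> \<D>" "x \<in> X" using \<D>(4) by blast
      then have "G x = 0" using elim by blast
      then show "g x = 0" using x by (simp add: G_def)
    qed
  qed
  then show ?thesis using \<Omega>m by (simp add: AE_restrict_space_iff)
qed

lemma weak_partialD: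
  assumes "u \<in> H1 \<Omega>"
  shows "weak_partial \<Omega> i u \<in> L2 \<Omega>" "is_weak_partial \<Omega> i u (weak_partial \<Omega> i u)"
proof -
  have "\<exists>g. g \<in> L2 \<Omega> \<and> is_weak_partial \<Omega> i u g" using assms by (auto simp: H1_def)
  from someI_ex[OF this] show "weak_partial \<Omega> i u \<in> L2 \<Omega>" "is_weak_partial \<Omega> i u (weak_partial \<Omega> i u)"
    by (auto simp: weak_partial_def)
qed

text \<open>Weak differentiation passes from the combination of the functions to that of the gradients by testing,
  and test functions determine the latter. So the degenerate directions of the Gram form of the functions
  are degenerate for the forms built from their gradients.\<close>

lemma weak_partial_combination_null:
  assumes \<Omega>: "bounded \<Omega>" "open \<Omega>" and u: "\<And>j. j \<in> I \<Longrightarrow> u j \<in> H1 \<Omega>"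
    and null: "AE x in lebesgue_on \<Omega>. (\<Sum>j\<in>I. c j * u j x) = 0"
  shows "AE x in lebesgue_on \<Omega>. (\<Sum>j\<in>I. c j * weak_partial \<Omega> i (u j) x) = 0"
proof (rule L2_orthogonal_to_test_functions[OF \<Omega>])
  have u2: "u j \<in> L2 \<Omega>" "weak_partial \<Omega> i (u j) \<in> L2 \<Omega>" if "j \<in> I" for j
    using u[OF that] weak_partialD[OF u[OF that]] by (auto simp: H1_def)
  show "(\<lambda>x. \<Sum>j\<in>I. c j * weak_partial \<Omega> i (u j) x) \<in> L2 \<Omega>" by (intro L2_sum L2_scale u2)
  fix \<phi> assume \<phi>: "\<phi> \<in> test_functions \<Omega>"
  note t = test_function_in_L2[OF \<Omega> \<phi>]
  have "L2_inner \<Omega> (\<lambda>x. \<Sum>j\<in>I. c j * weak_partial \<Omega> i (u j) x) \<phi> = (\<Sum>j\<in>I. c j * L2_inner \<Omega> (weak_partial \<Omega> i (u j)) \<phi>)"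
    by (intro L2_inner_sum_left u2 t)
  also have "\<dots> = (\<Sum>j\<in>I. - (c j * L2_inner \<Omega> (u j) (partial i \<phi>)))"
    using weak_partialD(2)[OF u] \<phi> by (intro sum.cong) (auto simp: is_weak_partial_def)
  also have "\<dots> = - L2_inner \<Omega> (\<lambda>x. \<Sum>j\<in>I. c j * u j x) (partial i \<phi>)"
    by (subst L2_inner_sum_left) (auto intro: u2 t simp: sum_negf)
  also have "L2_inner \<Omega> (\<lambda>x. \<Sum>j\<in>I. c j * u j x) (partial i \<phi>) = L2_inner \<Omega> (\<lambda>x. 0) (partial i \<phi>)"
    by (intro L2_inner_cong_AE L2_sum L2_scale u2 t L2_zero null)
  finally show "L2_inner \<Omega> (\<lambda>x. \<Sum>j\<in>I. c j * weak_partial \<Omega> i (u j) x) \<phi> = 0" by simp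
qed

lemma test_functions_subset_H10:
  assumes \<Omega>: "bounded \<Omega>" "open \<Omega>"
  shows "test_functions \<Omega> \<subseteq> H10 \<Omega>"
proof
  fix \<phi> assume \<phi>: "\<phi> \<in> test_functions \<Omega>"
  have H1: "\<psi> \<in> H1 \<Omega>" if "\<psi> \<in> test_functions \<Omega>" for \<psi>
    using test_function_in_L2[OF \<Omega> that] weak_partial_test_function[OF \<Omega> that] by (auto simp: H1_def)
  have z: "(\<lambda>x. 0) \<in> H1 \<Omega>" by (rule H1[OF zero_test_function])
  have "AE x in lebesgue_on \<Omega>. weak_partial \<Omega> i (\<lambda>x. 0) x = 0" for i
    using weak_partial_combination_null[OF \<Omega>, of "{0::nat}" "\<lambda>_ x. 0" "\<lambda>_. 1" i] z by simp
  then have "L2_norm \<Omega> (weak_partial \<Omega> i (\<lambda>x. 0)) = 0" for i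
    using L2_norm_eq_0_iff[OF weak_partialD(1)[OF z]] by blast
  then have "H1_norm \<Omega> (\<lambda>x. \<phi> x - \<phi> x) = 0" by (simp add: H1_norm_def)
  then show "\<phi> \<in> H10 \<Omega>" unfolding H10_def using H1[OF \<phi>] \<phi> by (auto intro!: exI[of _ "\<lambda>n. \<phi>"])
qed

text \<open>Test functions belong to \<open>H10\<close> and separate the elements of \<open>L\<^sup>2\<close>.\<close>

lemma represents_L2_unique:
  assumes \<Omega>: "bounded \<Omega>" "open \<Omega>" and "represents_L2 \<Omega> F g" "represents_L2 \<Omega> F g'"
  shows "AE x in lebesgue_on \<Omega>. g x = g' x"
proof -
  have g: "g \<in> L2 \<Omega>" "g' \<in> L2 \<Omega>" and eq: "\<And>v. v \<in> H10 \<Omega> \<Longrightarrow> L2_inner \<Omega> g v = L2_inner \<Omega> g' v"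
    using assms(3,4) unfolding represents_L2_def by auto
  have "AE x in lebesgue_on \<Omega>. g x - g' x = 0"
  proof (rule L2_orthogonal_to_test_functions[OF \<Omega> L2_diff[OF g]])
    fix \<phi> assume \<phi>: "\<phi> \<in> test_functions \<Omega>"
    then have "\<phi> \<in> H10 \<Omega>" using test_functions_subset_H10[OF \<Omega>] by blast
    then show "L2_inner \<Omega> (\<lambda>x. g x - g' x) \<phi> = 0"
      using eq L2_inner_diff_left[OF g test_function_in_L2(1)[OF \<Omega> \<phi>]] by simp
  qed
  then show ?thesis by eventually_elim simp
qed

section \<open>The form at a fixed time\<close>

text \<open>Fubini's theorem for null sets, carried over to the completion.\<close>

lemma AE_lebesgue_on_product:
  fixes S :: "'a::euclidean_space set" and \<Omega> :: "'b::euclidean_space set"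
  assumes "open S" "open \<Omega>" and P: "AE (t, x) in lebesgue_on (S \<times> \<Omega>). P t x"
  shows "AE t in lborel. t \<in> S \<longrightarrow> (AE x in lebesgue_on \<Omega>. P t x)"
proof -
  have m: "S \<times> \<Omega> \<in> sets lebesgue" "\<Omega> \<in> sets lebesgue"
    using assms open_Times[of S \<Omega>] by auto
  have "AE z in lebesgue. z \<in> S \<times> \<Omega> \<longrightarrow> (case z of (t, x) \<Rightarrow> P t x)"
    using P m by (simp add: AE_restrict_space_iff)
  then have "AE z in lborel \<Otimes>\<^sub>M lborel. z \<in> S \<times> \<Omega> \<longrightarrow> (case z of (t, x) \<Rightarrow> P t x)"
    unfolding lborel_prod by (simp only: AE_completion_iff)
  then have "AE t in lborel. AE x in lborel. (t, x) \<in> S \<times> \<Omega> \<longrightarrow> P t x"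
    using lborel_pair.AE_pair by fastforce
  then show ?thesis
  proof eventually_elim
    case (elim t)
    show ?case
    proof
      assume "t \<in> S"
      then have "AE x in lborel. x \<in> \<Omega> \<longrightarrow> P t x" using elim by auto
      then have "AE x in lebesgue. x \<in> \<Omega> \<longrightarrow> P t x" by (rule AE_completion)
      then show "AE x in lebesgue_on \<Omega>. P t x" using m by (simp add: AE_restrict_space_iff)
    qed
  qed
qed

text \<open>A Lebesgue measurable function agrees almost everywhere with a Borel one, whose sections are all
  measurable; by Fubini the exceptional set has null sections at almost every time.\<close>

lemma borel_measurable_sections:
  fixes S :: "'a::euclidean_space set" and \<Omega> :: "'b::euclidean_space set" and f :: "'a \<Rightarrow> 'b \<Rightarrow> real"
  assumes "open S" "open \<Omega>" and f: "(\<lambda>(t, x). f t x) \<in> borel_measurable (lebesgue_on (S \<times> \<Omega>))"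
  shows "AE t in lborel. t \<in> S \<longrightarrow> f t \<in> borel_measurable (lebesgue_on \<Omega>)"
proof -
  have m: "S \<times> \<Omega> \<in> sets lebesgue" "\<Omega> \<in> sets lebesgue"
    using assms open_Times[of S \<Omega>] by auto
  define F where "F z = (if z \<in> S \<times> \<Omega> then (case z of (t, x) \<Rightarrow> f t x) else 0)" for z
  have "F \<in> borel_measurable lebesgue" unfolding F_def using f m by (simp add: borel_measurable_if)
  then obtain F' where F': "F' \<in> borel_measurable lborel" "AE z in lborel. F z = F' z"
    using completion_ex_borel_measurable_real by blast
  have "AE z in lborel \<Otimes>\<^sub>M lborel. F z = F' z" unfolding lborel_prod by (rule F'(2))
  then have "AE t in lborel. AE x in lborel. F (t, x) = F' (t, x)" by (rule lborel_pair.AE_pair)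
  then show ?thesis
  proof eventually_elim
    case (elim t)
    show ?case
    proof
      assume t: "t \<in> S"
      have "F' \<in> borel_measurable (lborel \<Otimes>\<^sub>M lborel)" using F'(1) by (simp add: lborel_prod)
      then have "(\<lambda>x. F' (t, x)) \<in> borel_measurable lborel"
        by (rule measurable_compose[rotated]) auto
      then have "(\<lambda>x. F' (t, x)) \<in> borel_measurable lebesgue" by (rule measurable_completion)
      then have "(\<lambda>x. F' (t, x)) \<in> borel_measurable (lebesgue_on \<Omega>)" by (rule measurable_restrict_space1)
      moreover have "AE x in lebesgue. F (t, x) = F' (t, x)" using elim by (rule AE_completion)
      then have "AE x in lebesgue_on \<Omega>. F' (t, x) = f t x"
        using m t by (simp add: AE_restrict_space_iff) (auto simp: F_def elim!: eventually_mono)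
      ultimately show "f t \<in> borel_measurable (lebesgue_on \<Omega>)"
        by (rule borel_measurable_lebesgue_on_AE[OF m(2)])
    qed
  qed
qed

lemma AE_open_interval_dense:
  fixes a b t :: real
  assumes "a < b" "t \<in> {a..b}" and P: "AE s in lborel. s \<in> {a<..<b} \<longrightarrow> P s"
  shows "\<exists>s. (\<forall>n. s n \<in> {a<..<b} \<and> P (s n)) \<and> s \<longlonglongrightarrow> t"
proof -
  have "\<exists>s. s \<in> {a<..<b} \<and> P s \<and> \<bar>s - t\<bar> < \<epsilon>" if "0 < \<epsilon>" for \<epsilon>
  proof (rule ccontr)
    assume no: "\<not> ?thesis"
    define l r where "l = max a (t - \<epsilon>)" and "r = min b (t + \<epsilon>)"
    have lr: "l < r" using assms that by (auto simp: l_def r_def)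
    have "AE s in lborel. s \<notin> {l<..<r}"
      using P
    proof eventually_elim
      case (elim s)
      show ?case
      proof
        assume "s \<in> {l<..<r}"
        then have "s \<in> {a<..<b}" "\<bar>s - t\<bar> < \<epsilon>" by (auto simp: l_def r_def abs_less_iff)
        then show False using elim no by blast
      qed
    qed
    then have "emeasure lborel {l<..<r} = 0"
      using AE_iff_null_sets[of "{l<..<r}" lborel] by (auto simp: null_sets_def)
    then show False using lr by simp
  qed
  then have "\<forall>n. \<exists>s. s \<in> {a<..<b} \<and> P s \<and> \<bar>s - t\<bar> < inverse (real (Suc n))" by simp
  then obtain s where s: "\<And>n. s n \<in> {a<..<b} \<and> P (s n) \<and> \<bar>s n - t\<bar> < inverse (real (Suc n))" by metis
  have "(\<lambda>n. s n - t) \<longlonglongrightarrow> 0"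
    by (rule LIMSEQ_null_bound[OF _ LIMSEQ_inverse_real_of_nat]) (use s in \<open>auto intro: less_imp_le\<close>)
  then have "s \<longlonglongrightarrow> t" by (rule LIM_zero_cancel)
  then show ?thesis using s by blast
qed

text \<open>The pointwise conditions on the coefficients hold for almost every time by Fubini, and pass to
  every time by continuity.\<close>

lemma coefficients_at_every_time:
  fixes \<Omega> :: "(real ^ 'n) set" and a :: "'n \<Rightarrow> 'n \<Rightarrow> real \<Rightarrow> real ^ 'n \<Rightarrow> real"
  assumes \<Omega>: "open \<Omega>" and "T > 0" and adm: "admissible_coefficients \<Omega> T a \<alpha> \<omega>"
  shows "\<exists>B. \<forall>t\<in>{0..T}. (\<forall>i j. a i j t \<in> borel_measurable (lebesgue_on \<Omega>)) \<and>
    (AE x in lebesgue_on \<Omega>. (\<forall>i j. \<bar>a i j t x\<bar> \<le> B \<and> a i j t x = a j i t x) \<and>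
       (\<forall>\<xi> :: real ^ 'n. \<alpha> * (norm \<xi>)\<^sup>2 \<le> (\<Sum>i\<in>UNIV. \<Sum>j\<in>UNIV. a i j t x * \<xi> $ i * \<xi> $ j)))"
proof -
  let ?M = "lebesgue_on \<Omega>"
  let ?I = "{0<..<T}"
  have \<Omega>m: "\<Omega> \<in> sets lebesgue" using \<Omega> by auto
  have "\<forall>i. \<forall>j. \<exists>B. AE (t, x) in lebesgue_on (?I \<times> \<Omega>). \<bar>a i j t x\<bar> \<le> B"
    using adm by (auto simp: admissible_coefficients_def)
  then obtain b where b: "\<And>i j. AE (t, x) in lebesgue_on (?I \<times> \<Omega>). \<bar>a i j t x\<bar> \<le> b i j" by metis
  define B where "B = (\<Sum>i\<in>UNIV. \<Sum>j\<in>UNIV. \<bar>b i j\<bar>)"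
  have bB: "b i j \<le> B" for i j
  proof -
    have "b i j \<le> (\<Sum>j\<in>UNIV. \<bar>b i j\<bar>)"
      using member_le_sum[of j UNIV "\<lambda>j. \<bar>b i j\<bar>"] abs_ge_self[of "b i j"] by simp
    also have "\<dots> \<le> B" unfolding B_def by (rule member_le_sum) (auto intro: sum_nonneg)
    finally show ?thesis .
  qed
  define Q where "Q t x \<longleftrightarrow> (\<forall>i j. \<bar>a i j t x\<bar> \<le> B \<and> a i j t x = a j i t x) \<and>
       (\<forall>\<xi> :: real ^ 'n. \<alpha> * (norm \<xi>)\<^sup>2 \<le> (\<Sum>i\<in>UNIV. \<Sum>j\<in>UNIV. a i j t x * \<xi> $ i * \<xi> $ j))" for t x
  have good: "AE t in lborel. t \<in> ?I \<longrightarrow> (\<forall>i j. a i j t \<in> borel_measurable ?M) \<and> (AE x in ?M. Q t x)"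
  proof -
    have "AE t in lborel. t \<in> ?I \<longrightarrow> a i j t \<in> borel_measurable ?M" for i j
      using adm by (intro borel_measurable_sections \<Omega>) (auto simp: admissible_coefficients_def)
    then have 1: "AE t in lborel. \<forall>i j. t \<in> ?I \<longrightarrow> a i j t \<in> borel_measurable ?M"
      by (intro eventually_all_finite)
    have "AE z in lebesgue_on (?I \<times> \<Omega>). \<bar>a i j (fst z) (snd z)\<bar> \<le> b i j"
      "AE z in lebesgue_on (?I \<times> \<Omega>). a i j (fst z) (snd z) = a j i (fst z) (snd z)" for i j
      using adm b[of i j] by (auto simp: admissible_coefficients_def case_prod_unfold)
    then have "AE z in lebesgue_on (?I \<times> \<Omega>). \<forall>i j. \<bar>a i j (fst z) (snd z)\<bar> \<le> b i j"
      "AE z in lebesgue_on (?I \<times> \<Omega>). \<forall>i j. a i j (fst z) (snd z) = a j i (fst z) (snd z)"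
      by (intro eventually_all_finite; blast)+
    moreover have "AE z in lebesgue_on (?I \<times> \<Omega>). \<forall>\<xi> :: real ^ 'n.
        (\<Sum>i\<in>UNIV. \<Sum>j\<in>UNIV. a i j (fst z) (snd z) * \<xi> $ i * \<xi> $ j) \<ge> \<alpha> * (norm \<xi>)\<^sup>2"
      using adm by (auto simp: admissible_coefficients_def case_prod_unfold)
    ultimately have "AE z in lebesgue_on (?I \<times> \<Omega>). Q (fst z) (snd z)"
      by eventually_elim (auto simp: Q_def intro: order_trans[OF _ bB])
    then have "AE (t, x) in lebesgue_on (?I \<times> \<Omega>). Q t x" by (simp add: case_prod_unfold)
    then have "AE t in lborel. t \<in> ?I \<longrightarrow> (AE x in ?M. Q t x)"
      by (intro AE_lebesgue_on_product \<Omega>) auto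
    with 1 show ?thesis by eventually_elim auto
  qed
  have cont: "AE x in ?M. \<forall>i j. continuous_on {0..T} (\<lambda>t. a i j t x)"
    using adm by (intro eventually_all_finite) (auto simp: admissible_coefficients_def)
  have "(\<forall>i j. a i j t \<in> borel_measurable ?M) \<and> (AE x in ?M. Q t x)" if t: "t \<in> {0..T}" for t
  proof -
    obtain s where s: "\<And>n. s n \<in> ?I" "\<And>n i j. a i j (s n) \<in> borel_measurable ?M"
      "\<And>n. AE x in ?M. Q (s n) x" and st: "s \<longlonglongrightarrow> t"
      using AE_open_interval_dense[OF \<open>T > 0\<close> t good] by blast
    have lim: "AE x in ?M. \<forall>i j. (\<lambda>n. a i j (s n) x) \<longlonglongrightarrow> a i j t x"
      using cont
    proof eventually_elim
      case (elim x)
      show ?case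
      proof (intro allI)
        fix i j
        show "(\<lambda>n. a i j (s n) x) \<longlonglongrightarrow> a i j t x"
        proof (rule continuous_on_tendsto_compose[OF _ st t, of "\<lambda>t. a i j t x"])
          show "eventually (\<lambda>n. s n \<in> {0..T}) sequentially" using s(1) by (auto intro: always_eventually less_imp_le)
        qed (use elim in blast)
      qed
    qed
    have m: "a i j t \<in> borel_measurable ?M" for i j
    proof (rule borel_measurable_lebesgue_on_AE_limit[OF \<Omega>m s(2)])
      show "AE x in ?M. (\<lambda>n. a i j (s n) x) \<longlonglongrightarrow> a i j t x" using lim by eventually_elim blast
    qed
    have "AE x in ?M. \<forall>n. Q (s n) x" using s(3) by (simp add: AE_all_countable)
    then have "AE x in ?M. Q t x"
      using lim
    proof eventually_elim
      case (elim x)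
      have "\<bar>a i j t x\<bar> \<le> B" for i j
      proof (rule LIMSEQ_le_const2)
        show "(\<lambda>n. \<bar>a i j (s n) x\<bar>) \<longlonglongrightarrow> \<bar>a i j t x\<bar>" using elim by (intro tendsto_rabs) blast
      qed (use elim in \<open>auto simp: Q_def\<close>)
      moreover have "a i j t x = a j i t x" for i j
      proof (rule LIMSEQ_unique)
        show "(\<lambda>n. a i j (s n) x) \<longlonglongrightarrow> a i j t x" using elim by blast
        have "(\<lambda>n. a i j (s n) x) = (\<lambda>n. a j i (s n) x)" using elim by (auto simp: Q_def)
        then show "(\<lambda>n. a i j (s n) x) \<longlonglongrightarrow> a j i t x" using elim by simp
      qed
      moreover have "\<alpha> * (norm \<xi>)\<^sup>2 \<le> (\<Sum>i\<in>UNIV. \<Sum>j\<in>UNIV. a i j t x * \<xi> $ i * \<xi> $ j)" for \<xi> :: "real ^ 'n"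
      proof (rule LIMSEQ_le_const)
        show "(\<lambda>n. \<Sum>i\<in>UNIV. \<Sum>j\<in>UNIV. a i j (s n) x * \<xi> $ i * \<xi> $ j)
            \<longlonglongrightarrow> (\<Sum>i\<in>UNIV. \<Sum>j\<in>UNIV. a i j t x * \<xi> $ i * \<xi> $ j)"
          using elim by (intro tendsto_sum tendsto_mult tendsto_const) blast
      qed (use elim in \<open>auto simp: Q_def\<close>)
      ultimately show ?case by (simp add: Q_def)
    qed
    with m show ?thesis by blast
  qed
  then show ?thesis unfolding Q_def by blast
qed


text \<open>The form as a function of two vector fields, so that gradients of linear combinations never
  have to be identified.\<close>

definition field_form ::
    "(real ^ 'n) set \<Rightarrow> ('n \<Rightarrow> 'n \<Rightarrow> real \<Rightarrow> real ^ 'n \<Rightarrow> real) \<Rightarrow> real \<Rightarrow>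
     ('n \<Rightarrow> real ^ 'n \<Rightarrow> real) \<Rightarrow> ('n \<Rightarrow> real ^ 'n \<Rightarrow> real) \<Rightarrow> real" where
  "field_form \<Omega> a t p q = (\<integral>x. (\<Sum>i\<in>UNIV. \<Sum>j\<in>UNIV. a i j t x * p i x * q j x) \<partial>lebesgue_on \<Omega>)"

lemma form_a_eq_field_form:
  "form_a \<Omega> a t u v = field_form \<Omega> a t (\<lambda>i. weak_partial \<Omega> i u) (\<lambda>i. weak_partial \<Omega> i v)"
  by (simp add: form_a_def field_form_def)

text \<open>The sum of the norms of the components: products of two such norms bound the double sum in the form.\<close>

definition field_norm :: "(real ^ 'n) set \<Rightarrow> ('n \<Rightarrow> real ^ 'n \<Rightarrow> real) \<Rightarrow> real" where
  "field_norm \<Omega> p = (\<Sum>i\<in>UNIV. L2_norm \<Omega> (p i))"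

definition elliptic_at ::
    "(real ^ 'n) set \<Rightarrow> ('n \<Rightarrow> 'n \<Rightarrow> real \<Rightarrow> real ^ 'n \<Rightarrow> real) \<Rightarrow> real \<Rightarrow> real \<Rightarrow> real \<Rightarrow> bool" where
  "elliptic_at \<Omega> a \<alpha> B t \<longleftrightarrow> (\<forall>i j. a i j t \<in> borel_measurable (lebesgue_on \<Omega>)) \<and>
    (AE x in lebesgue_on \<Omega>. (\<forall>i j. \<bar>a i j t x\<bar> \<le> B \<and> a i j t x = a j i t x) \<and>
       (\<forall>\<xi> :: real ^ 'n. \<alpha> * (norm \<xi>)\<^sup>2 \<le> (\<Sum>i\<in>UNIV. \<Sum>j\<in>UNIV. a i j t x * \<xi> $ i * \<xi> $ j)))"

lemma field_norm_nonneg [simp]: "0 \<le> field_norm \<Omega> p"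
  by (simp add: field_norm_def sum_nonneg)

lemma elliptic_term_integrable:
  assumes e: "elliptic_at \<Omega> a \<alpha> B t" and p: "p \<in> L2 \<Omega>" "q \<in> L2 \<Omega>"
  shows "integrable (lebesgue_on \<Omega>) (\<lambda>x. a i j t x * p x * q x)"
proof (rule Bochner_Integration.integrable_bound)
  show "integrable (lebesgue_on \<Omega>) (\<lambda>x. B * (\<bar>p x\<bar> * \<bar>q x\<bar>))"
    by (intro integrable_mult_right L2_integrable_mult L2_abs p)
  show "(\<lambda>x. a i j t x * p x * q x) \<in> borel_measurable (lebesgue_on \<Omega>)"
    using e p by (intro borel_measurable_times) (auto simp: elliptic_at_def L2_def)
  have "AE x in lebesgue_on \<Omega>. \<bar>a i j t x\<bar> \<le> B"
    using e unfolding elliptic_at_def by (auto elim!: eventually_mono)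
  then show "AE x in lebesgue_on \<Omega>. norm (a i j t x * p x * q x) \<le> norm (B * (\<bar>p x\<bar> * \<bar>q x\<bar>))"
  proof eventually_elim
    case (elim x)
    have "\<bar>a i j t x\<bar> * (\<bar>p x\<bar> * \<bar>q x\<bar>) \<le> \<bar>B\<bar> * (\<bar>p x\<bar> * \<bar>q x\<bar>)"
      using elim by (intro mult_right_mono) auto
    then show ?case by (simp add: abs_mult mult.assoc)
  qed
qed

lemma field_form_sum:
  assumes e: "elliptic_at \<Omega> a \<alpha> B t" and P: "\<And>k i. k \<in> K \<Longrightarrow> P k i \<in> L2 \<Omega>"
  shows "field_form \<Omega> a t (\<lambda>i x. \<Sum>k\<in>K. c k * P k i x) (\<lambda>i x. \<Sum>k\<in>K. d k * P k i x)
    = (\<Sum>k\<in>K. \<Sum>l\<in>K. c k * d l * field_form \<Omega> a t (P k) (P l))"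
proof -
  have int: "integrable (lebesgue_on \<Omega>) (\<lambda>x. \<Sum>i\<in>UNIV. \<Sum>j\<in>UNIV. a i j t x * P k i x * P l j x)"
    if "k \<in> K" "l \<in> K" for k l
    using that by (intro Bochner_Integration.integrable_sum elliptic_term_integrable[OF e] P)
  have pt: "(\<Sum>i\<in>UNIV. \<Sum>j\<in>UNIV. a i j t x * (\<Sum>k\<in>K. c k * P k i x) * (\<Sum>k\<in>K. d k * P k j x))
      = (\<Sum>k\<in>K. \<Sum>l\<in>K. c k * d l * (\<Sum>i\<in>UNIV. \<Sum>j\<in>UNIV. a i j t x * P k i x * P l j x))" for x
  proof -
    have "(\<Sum>i\<in>UNIV. \<Sum>j\<in>UNIV. a i j t x * (\<Sum>k\<in>K. c k * P k i x) * (\<Sum>k\<in>K. d k * P k j x))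
        = (\<Sum>i\<in>UNIV. \<Sum>j\<in>UNIV. \<Sum>k\<in>K. \<Sum>l\<in>K. c k * d l * (a i j t x * P k i x * P l j x))"
      by (simp add: sum_distrib_left sum_distrib_right mult_ac)
    also have "\<dots> = (\<Sum>i\<in>UNIV. \<Sum>k\<in>K. \<Sum>l\<in>K. \<Sum>j\<in>UNIV. c k * d l * (a i j t x * P k i x * P l j x))"
      by (intro sum.cong refl) (subst sum.swap, intro sum.cong refl, subst sum.swap, rule refl)
    also have "\<dots> = (\<Sum>k\<in>K. \<Sum>l\<in>K. \<Sum>i\<in>UNIV. \<Sum>j\<in>UNIV. c k * d l * (a i j t x * P k i x * P l j x))"
      by (subst sum.swap, intro sum.cong refl, subst sum.swap, rule refl)
    finally show ?thesis by (simp add: sum_distrib_left)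
  qed
  have "field_form \<Omega> a t (\<lambda>i x. \<Sum>k\<in>K. c k * P k i x) (\<lambda>i x. \<Sum>k\<in>K. d k * P k i x)
      = (\<integral>x. (\<Sum>k\<in>K. \<Sum>l\<in>K. c k * d l * (\<Sum>i\<in>UNIV. \<Sum>j\<in>UNIV. a i j t x * P k i x * P l j x)) \<partial>lebesgue_on \<Omega>)"
    unfolding field_form_def pt ..
  also have "\<dots> = (\<Sum>k\<in>K. \<integral>x. (\<Sum>l\<in>K. c k * d l * (\<Sum>i\<in>UNIV. \<Sum>j\<in>UNIV. a i j t x * P k i x * P l j x)) \<partial>lebesgue_on \<Omega>)"
    by (intro Bochner_Integration.integral_sum Bochner_Integration.integrable_sum integrable_mult_right int)
  also have "\<dots> = (\<Sum>k\<in>K. \<Sum>l\<in>K. \<integral>x. c k * d l * (\<Sum>i\<in>UNIV. \<Sum>j\<in>UNIV. a i j t x * P k i x * P l j x) \<partial>lebesgue_on \<Omega>)"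
    by (intro sum.cong refl Bochner_Integration.integral_sum integrable_mult_right int)
  finally show ?thesis by (simp add: field_form_def)
qed

lemma field_form_sym:
  assumes e: "elliptic_at \<Omega> a \<alpha> B t" and p: "\<And>i. p i \<in> L2 \<Omega>" "\<And>i. q i \<in> L2 \<Omega>"
  shows "field_form \<Omega> a t p q = field_form \<Omega> a t q p"
  unfolding field_form_def
proof (rule integral_cong_AE)
  show "(\<lambda>x. \<Sum>i\<in>UNIV. \<Sum>j\<in>UNIV. a i j t x * p i x * q j x) \<in> borel_measurable (lebesgue_on \<Omega>)"
    "(\<lambda>x. \<Sum>i\<in>UNIV. \<Sum>j\<in>UNIV. a i j t x * q i x * p j x) \<in> borel_measurable (lebesgue_on \<Omega>)"
    by (intro borel_measurable_sum borel_measurable_integrable elliptic_term_integrable[OF e] p)+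
  have "AE x in lebesgue_on \<Omega>. \<forall>i j. a i j t x = a j i t x"
    using e unfolding elliptic_at_def by (auto elim!: eventually_mono)
  then show "AE x in lebesgue_on \<Omega>. (\<Sum>i\<in>UNIV. \<Sum>j\<in>UNIV. a i j t x * p i x * q j x)
      = (\<Sum>i\<in>UNIV. \<Sum>j\<in>UNIV. a i j t x * q i x * p j x)"
  proof eventually_elim
    case (elim x)
    have "a i j t x * p i x * q j x = a j i t x * q j x * p i x" for i j using elim by simp
    then show ?case by (simp only:) (rule sum.swap)
  qed
qed

lemma field_form_coercive:
  fixes p :: "'n::finite \<Rightarrow> real ^ 'n \<Rightarrow> real"
  assumes e: "elliptic_at \<Omega> a \<alpha> B t" and p: "\<And>i. p i \<in> L2 \<Omega>" and \<alpha>: "0 < \<alpha>"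
  shows "\<alpha> / real CARD('n) * (field_norm \<Omega> p)\<^sup>2 \<le> field_form \<Omega> a t p p"
proof -
  have "\<alpha> * (\<Sum>i\<in>UNIV. L2_inner \<Omega> (p i) (p i)) = (\<integral>x. \<alpha> * (\<Sum>i\<in>UNIV. p i x * p i x) \<partial>lebesgue_on \<Omega>)"
    unfolding L2_inner_def
    by (subst Bochner_Integration.integral_sum[symmetric]) (auto intro: L2_integrable_mult p)
  also have "\<dots> \<le> field_form \<Omega> a t p p"
    unfolding field_form_def
  proof (rule integral_mono_AE)
    show "integrable (lebesgue_on \<Omega>) (\<lambda>x. \<alpha> * (\<Sum>i\<in>UNIV. p i x * p i x))"
      by (intro integrable_mult_right Bochner_Integration.integrable_sum L2_integrable_mult p)
    show "integrable (lebesgue_on \<Omega>) (\<lambda>x. \<Sum>i\<in>UNIV. \<Sum>j\<in>UNIV. a i j t x * p i x * p j x)"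
      by (intro Bochner_Integration.integrable_sum elliptic_term_integrable[OF e] p)
    have "AE x in lebesgue_on \<Omega>. \<forall>\<xi> :: real ^ 'n. \<alpha> * (norm \<xi>)\<^sup>2 \<le> (\<Sum>i\<in>UNIV. \<Sum>j\<in>UNIV. a i j t x * \<xi> $ i * \<xi> $ j)"
      using e unfolding elliptic_at_def by (auto elim!: eventually_mono)
    then show "AE x in lebesgue_on \<Omega>. \<alpha> * (\<Sum>i\<in>UNIV. p i x * p i x) \<le> (\<Sum>i\<in>UNIV. \<Sum>j\<in>UNIV. a i j t x * p i x * p j x)"
    proof eventually_elim
      case (elim x)
      have "(norm (\<chi> i. p i x))\<^sup>2 = (\<Sum>i\<in>UNIV. p i x * p i x)"
        by (simp add: power2_norm_eq_inner inner_vec_def)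
      then show ?case using elim[rule_format, of "\<chi> i. p i x"] by simp
    qed
  qed
  finally have 1: "\<alpha> * (\<Sum>i\<in>UNIV. (L2_norm \<Omega> (p i))\<^sup>2) \<le> field_form \<Omega> a t p p"
    by (simp add: L2_norm_power2)
  \<comment> \<open>The Cauchy-Schwarz inequality for the sum over the components costs the factor \<open>CARD('n)\<close>.\<close>
  have "(field_norm \<Omega> p)\<^sup>2 \<le> real CARD('n) * (\<Sum>i\<in>UNIV. (L2_norm \<Omega> (p i))\<^sup>2)"
    using sum_squared_le_sum_of_squares[of "\<lambda>i. L2_norm \<Omega> (p i)" "UNIV :: 'n set"] unfolding field_norm_def
    by (simp add: mult.commute)
  then have "\<alpha> / real CARD('n) * (field_norm \<Omega> p)\<^sup>2
      \<le> \<alpha> / real CARD('n) * (real CARD('n) * (\<Sum>i\<in>UNIV. (L2_norm \<Omega> (p i))\<^sup>2))"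
    using \<alpha> by (intro mult_left_mono) auto
  also have "\<dots> = \<alpha> * (\<Sum>i\<in>UNIV. (L2_norm \<Omega> (p i))\<^sup>2)" by simp
  finally show ?thesis using 1 by linarith
qed

lemma field_form_time_difference:
  fixes p :: "'n::finite \<Rightarrow> real ^ 'n \<Rightarrow> real"
  assumes e: "elliptic_at \<Omega> a \<alpha> B t" "elliptic_at \<Omega> a \<alpha> B s"
    and p: "\<And>i. p i \<in> L2 \<Omega>" "\<And>i. q i \<in> L2 \<Omega>"
    and w: "\<And>i j. AE x in lebesgue_on \<Omega>. \<bar>a i j t x - a i j s x\<bar> \<le> w"
  shows "\<bar>field_form \<Omega> a t p q - field_form \<Omega> a s p q\<bar> \<le> \<bar>w\<bar> * field_norm \<Omega> p * field_norm \<Omega> q"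
proof -
  let ?M = "lebesgue_on \<Omega>"
  note i = elliptic_term_integrable[OF e(1)] elliptic_term_integrable[OF e(2)]
  have split: "field_form \<Omega> a r p q = (\<Sum>i\<in>UNIV. \<Sum>j\<in>UNIV. \<integral>x. a i j r x * p i x * q j x \<partial>?M)"
    if "elliptic_at \<Omega> a \<alpha> B r" for r
    unfolding field_form_def
    by (subst Bochner_Integration.integral_sum, (intro Bochner_Integration.integrable_sum elliptic_term_integrable[OF that] p),
        intro sum.cong refl Bochner_Integration.integral_sum elliptic_term_integrable[OF that] p)
  have summand: "\<bar>(\<integral>x. a i j t x * p i x * q j x \<partial>?M) - (\<integral>x. a i j s x * p i x * q j x \<partial>?M)\<bar>
      \<le> \<bar>w\<bar> * (L2_norm \<Omega> (p i) * L2_norm \<Omega> (q j))" for i j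
  proof -
    have "\<bar>(\<integral>x. a i j t x * p i x * q j x \<partial>?M) - (\<integral>x. a i j s x * p i x * q j x \<partial>?M)\<bar>
        = \<bar>\<integral>x. a i j t x * p i x * q j x - a i j s x * p i x * q j x \<partial>?M\<bar>"
      using i p by simp
    also have "\<dots> \<le> (\<integral>x. \<bar>a i j t x * p i x * q j x - a i j s x * p i x * q j x\<bar> \<partial>?M)"
      using integral_norm_bound[of ?M "\<lambda>x. a i j t x * p i x * q j x - a i j s x * p i x * q j x"] by simp
    also have "\<dots> \<le> (\<integral>x. \<bar>w\<bar> * (\<bar>p i x\<bar> * \<bar>q j x\<bar>) \<partial>?M)"
    proof (rule integral_mono_AE)
      show "integrable ?M (\<lambda>x. \<bar>a i j t x * p i x * q j x - a i j s x * p i x * q j x\<bar>)"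
        by (intro integrable_abs Bochner_Integration.integrable_diff i p)
      show "integrable ?M (\<lambda>x. \<bar>w\<bar> * (\<bar>p i x\<bar> * \<bar>q j x\<bar>))"
        by (intro integrable_mult_right L2_integrable_mult L2_abs p)
      show "AE x in ?M. \<bar>a i j t x * p i x * q j x - a i j s x * p i x * q j x\<bar> \<le> \<bar>w\<bar> * (\<bar>p i x\<bar> * \<bar>q j x\<bar>)"
        using w[of i j]
      proof eventually_elim
        case (elim x)
        have "\<bar>a i j t x * p i x * q j x - a i j s x * p i x * q j x\<bar> = \<bar>a i j t x - a i j s x\<bar> * (\<bar>p i x\<bar> * \<bar>q j x\<bar>)"
          by (simp add: left_diff_distrib[symmetric] abs_mult mult.assoc)
        also have "\<dots> \<le> \<bar>w\<bar> * (\<bar>p i x\<bar> * \<bar>q j x\<bar>)" using elim by (intro mult_right_mono) auto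
        finally show ?case .
      qed
    qed
    also have "\<dots> = \<bar>w\<bar> * L2_inner \<Omega> (\<lambda>x. \<bar>p i x\<bar>) (\<lambda>x. \<bar>q j x\<bar>)" by (simp add: L2_inner_def)
    also have "\<dots> \<le> \<bar>w\<bar> * (L2_norm \<Omega> (\<lambda>x. \<bar>p i x\<bar>) * L2_norm \<Omega> (\<lambda>x. \<bar>q j x\<bar>))"
      using L2_Cauchy_Schwarz[OF L2_abs[OF p(1)] L2_abs[OF p(2)], of i j] by (intro mult_left_mono) auto
    also have "L2_norm \<Omega> (\<lambda>x. \<bar>p i x\<bar>) = L2_norm \<Omega> (p i)" by (simp add: L2_norm_def L2_inner_def)
    also have "L2_norm \<Omega> (\<lambda>x. \<bar>q j x\<bar>) = L2_norm \<Omega> (q j)" by (simp add: L2_norm_def L2_inner_def)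
    finally show ?thesis .
  qed
  have "\<bar>field_form \<Omega> a t p q - field_form \<Omega> a s p q\<bar>
      = \<bar>\<Sum>i\<in>UNIV. \<Sum>j\<in>UNIV. (\<integral>x. a i j t x * p i x * q j x \<partial>?M) - (\<integral>x. a i j s x * p i x * q j x \<partial>?M)\<bar>"
    by (simp add: split[OF e(1)] split[OF e(2)] sum_subtractf)
  also have "\<dots> \<le> (\<Sum>i\<in>UNIV. \<Sum>j\<in>UNIV. \<bar>w\<bar> * (L2_norm \<Omega> (p i) * L2_norm \<Omega> (q j)))"
    by (intro order_trans[OF sum_abs] sum_mono summand)
  also have "\<dots> = \<bar>w\<bar> * field_norm \<Omega> p * field_norm \<Omega> q"
  proof -
    have "field_norm \<Omega> p * field_norm \<Omega> q = (\<Sum>i\<in>UNIV. \<Sum>j\<in>UNIV. L2_norm \<Omega> (p i) * L2_norm \<Omega> (q j))"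
      unfolding field_norm_def by (rule sum_product)
    then show ?thesis by (simp add: sum_distrib_left mult.assoc)
  qed
  finally show ?thesis .
qed

lemma field_form_continuous:
  fixes p :: "'n::finite \<Rightarrow> real ^ 'n \<Rightarrow> real"
  assumes e: "\<And>t. t \<in> {0..T} \<Longrightarrow> elliptic_at \<Omega> a \<alpha> B t"
    and c: "\<And>i j. AE x in lebesgue_on \<Omega>. continuous_on {0..T} (\<lambda>t. a i j t x)"
    and p: "\<And>i. p i \<in> L2 \<Omega>" "\<And>i. q i \<in> L2 \<Omega>"
  shows "continuous_on {0..T} (\<lambda>t. field_form \<Omega> a t p q)"
  unfolding continuous_on_sequentially
proof (intro allI ballI impI, elim conjE)
  let ?M = "lebesgue_on \<Omega>"
  fix s t assume t: "t \<in> {0..T}" and s: "\<forall>n. s n \<in> {0..T}" "s \<longlonglongrightarrow> t"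
  have cont: "AE x in ?M. \<forall>i j. continuous_on {0..T} (\<lambda>t. a i j t x)"
    by (intro eventually_all_finite c)
  have bd: "AE x in ?M. \<forall>i j. \<bar>a i j r x\<bar> \<le> B" if "r \<in> {0..T}" for r
    using e[OF that] unfolding elliptic_at_def by (auto elim!: eventually_mono)
  have "(\<lambda>n. field_form \<Omega> a (s n) p q) \<longlonglongrightarrow> field_form \<Omega> a t p q"
    unfolding field_form_def
  proof (rule integral_dominated_convergence[where w = "\<lambda>x. \<Sum>i\<in>UNIV. \<Sum>j\<in>UNIV. \<bar>B\<bar> * (\<bar>p i x\<bar> * \<bar>q j x\<bar>)"])
    show "(\<lambda>x. \<Sum>i\<in>UNIV. \<Sum>j\<in>UNIV. a i j t x * p i x * q j x) \<in> borel_measurable ?M"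
      by (intro borel_measurable_sum borel_measurable_integrable elliptic_term_integrable[OF e[OF t]] p)
    show "(\<lambda>x. \<Sum>i\<in>UNIV. \<Sum>j\<in>UNIV. a i j (s n) x * p i x * q j x) \<in> borel_measurable ?M" for n
      using s(1) by (intro borel_measurable_sum borel_measurable_integrable elliptic_term_integrable[OF e] p) auto
    show "integrable ?M (\<lambda>x. \<Sum>i\<in>UNIV. \<Sum>j\<in>UNIV. \<bar>B\<bar> * (\<bar>p i x\<bar> * \<bar>q j x\<bar>))"
      by (intro Bochner_Integration.integrable_sum integrable_mult_right L2_integrable_mult L2_abs p)
    show "AE x in ?M. (\<lambda>n. \<Sum>i\<in>UNIV. \<Sum>j\<in>UNIV. a i j (s n) x * p i x * q j x)
        \<longlonglongrightarrow> (\<Sum>i\<in>UNIV. \<Sum>j\<in>UNIV. a i j t x * p i x * q j x)"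
      using cont
    proof eventually_elim
      case (elim x)
      have "(\<lambda>n. a i j (s n) x) \<longlonglongrightarrow> a i j t x" for i j
        by (rule continuous_on_tendsto_compose[OF _ s(2) t, of "\<lambda>t. a i j t x"])
          (use elim s(1) in \<open>auto intro: always_eventually\<close>)
      then show ?case by (intro tendsto_sum tendsto_mult tendsto_const)
    qed
    show "AE x in ?M. norm (\<Sum>i\<in>UNIV. \<Sum>j\<in>UNIV. a i j (s n) x * p i x * q j x)
        \<le> (\<Sum>i\<in>UNIV. \<Sum>j\<in>UNIV. \<bar>B\<bar> * (\<bar>p i x\<bar> * \<bar>q j x\<bar>))" for n
      using bd[OF s(1)[rule_format, of n]]
    proof eventually_elim
      case (elim x)
      have "norm (a i j (s n) x * p i x * q j x) \<le> \<bar>B\<bar> * (\<bar>p i x\<bar> * \<bar>q j x\<bar>)" for i j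
      proof -
        have "\<bar>a i j (s n) x\<bar> \<le> \<bar>B\<bar>" using elim by (meson abs_ge_self order_trans)
        then have "\<bar>a i j (s n) x\<bar> * (\<bar>p i x\<bar> * \<bar>q j x\<bar>) \<le> \<bar>B\<bar> * (\<bar>p i x\<bar> * \<bar>q j x\<bar>)"
          by (rule mult_right_mono) simp
        then show ?thesis by (simp add: abs_mult mult.assoc)
      qed
      then show ?case by (intro sum_norm_le)
    qed
  qed
  then show "((\<lambda>t. field_form \<Omega> a t p q) \<circ> s) \<longlonglongrightarrow> field_form \<Omega> a t p q" by (simp add: o_def)
qed

section \<open>Averages over the cells of a mesh\<close>

definition cell_average :: "(nat \<Rightarrow> real) \<Rightarrow> nat \<Rightarrow> (real \<Rightarrow> real) \<Rightarrow> real" where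
  "cell_average \<tau> m \<phi> = 1 / step \<tau> m * (\<integral>t. \<phi> t \<partial>lebesgue_on (cell \<tau> m))"

lemma avg_A_eq_cell_average: "avg_A \<Omega> a \<tau> m u v = cell_average \<tau> m (\<lambda>t. form_a \<Omega> a t u v)"
  by (simp add: avg_A_def cell_average_def op_A_def)

lemma measure_lebesgue_on_cell:
  assumes "0 < step \<tau> m"
  shows "finite_measure (lebesgue_on (cell \<tau> m))" "measure (lebesgue_on (cell \<tau> m)) (space (lebesgue_on (cell \<tau> m))) = step \<tau> m"
proof -
  have s: "cell \<tau> m \<in> sets lebesgue" by (simp add: cell_def)
  have "emeasure lebesgue (cell \<tau> m) = ennreal (step \<tau> m)"
    using assms by (simp add: cell_def step_def)
  then have e: "emeasure (lebesgue_on (cell \<tau> m)) (space (lebesgue_on (cell \<tau> m))) = ennreal (step \<tau> m)"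
    using s by (simp add: emeasure_restrict_space)
  then show "finite_measure (lebesgue_on (cell \<tau> m))" by (intro finite_measureI) simp
  show "measure (lebesgue_on (cell \<tau> m)) (space (lebesgue_on (cell \<tau> m))) = step \<tau> m"
    unfolding measure_def e using assms by simp
qed

lemma integrable_lebesgue_on_subset:
  fixes g :: "'a::euclidean_space \<Rightarrow> real"
  assumes g: "integrable (lebesgue_on J) g" and "J \<in> sets lebesgue" "K \<in> sets lebesgue" "K \<subseteq> J"
  shows "integrable (lebesgue_on K) g"
proof -
  have "set_integrable lebesgue J g" using g assms(2) by (simp add: integrable_restrict_space set_integrable_def)
  then have "set_integrable lebesgue K g" by (rule set_integrable_subset) (use assms in auto)
  then show ?thesis using assms(3) by (simp add: integrable_restrict_space set_integrable_def)
qed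

lemma integrable_on_cell:
  fixes \<phi> :: "real \<Rightarrow> real"
  assumes \<phi>: "continuous_on {0..T} \<phi>" and c: "cell \<tau> m \<subseteq> {0..T}"
  shows "integrable (lebesgue_on (cell \<tau> m)) \<phi>"
proof (rule integrable_lebesgue_on_subset[of "{0..T}"])
  have "\<phi> absolutely_integrable_on {0..T}"
    using \<phi> by (rule absolutely_integrable_continuous_real)
  then show "integrable (lebesgue_on {0..T}) \<phi>"
    by (simp add: integrable_restrict_space set_integrable_def)
qed (use c in \<open>auto simp: cell_def\<close>)

lemma cell_average_bounds:
  fixes \<phi> :: "real \<Rightarrow> real"
  assumes k: "0 < step \<tau> m" and i: "integrable (lebesgue_on (cell \<tau> m)) \<phi>"
  shows "(\<And>t. t \<in> cell \<tau> m \<Longrightarrow> \<phi> t \<le> c) \<Longrightarrow> cell_average \<tau> m \<phi> \<le> c"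
    and "(\<And>t. t \<in> cell \<tau> m \<Longrightarrow> c \<le> \<phi> t) \<Longrightarrow> c \<le> cell_average \<tau> m \<phi>"
proof -
  interpret finite_measure "lebesgue_on (cell \<tau> m)" by (rule measure_lebesgue_on_cell(1)[OF k])
  have sp: "space (lebesgue_on (cell \<tau> m)) = cell \<tau> m" by (simp add: space_restrict_space)
  have c: "(\<integral>t. c \<partial>lebesgue_on (cell \<tau> m)) = step \<tau> m * c"
    using measure_lebesgue_on_cell(2)[OF k] by simp
  show "cell_average \<tau> m \<phi> \<le> c" if "\<And>t. t \<in> cell \<tau> m \<Longrightarrow> \<phi> t \<le> c"
  proof -
    have "(\<integral>t. \<phi> t \<partial>lebesgue_on (cell \<tau> m)) \<le> (\<integral>t. c \<partial>lebesgue_on (cell \<tau> m))"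
      by (intro integral_mono i) (use that sp in auto)
    then show ?thesis using k unfolding c cell_average_def by (simp add: field_simps)
  qed
  show "c \<le> cell_average \<tau> m \<phi>" if "\<And>t. t \<in> cell \<tau> m \<Longrightarrow> c \<le> \<phi> t"
  proof -
    have "(\<integral>t. c \<partial>lebesgue_on (cell \<tau> m)) \<le> (\<integral>t. \<phi> t \<partial>lebesgue_on (cell \<tau> m))"
      by (intro integral_mono i) (use that sp in auto)
    then show ?thesis using k unfolding c cell_average_def by (simp add: field_simps)
  qed
qed

lemma cell_average_difference:
  fixes \<phi> :: "real \<Rightarrow> real"
  assumes k: "0 < step \<tau> m" "0 < step \<tau> l"
    and i: "integrable (lebesgue_on (cell \<tau> m)) \<phi>" "integrable (lebesgue_on (cell \<tau> l)) \<phi>"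
    and d: "\<And>t s. t \<in> cell \<tau> m \<Longrightarrow> s \<in> cell \<tau> l \<Longrightarrow> \<bar>\<phi> t - \<phi> s\<bar> \<le> E"
  shows "\<bar>cell_average \<tau> m \<phi> - cell_average \<tau> l \<phi>\<bar> \<le> E"
proof -
  have 1: "\<bar>\<phi> t - cell_average \<tau> l \<phi>\<bar> \<le> E" if t: "t \<in> cell \<tau> m" for t
  proof -
    have "\<phi> t - E \<le> \<phi> s" "\<phi> s \<le> \<phi> t + E" if "s \<in> cell \<tau> l" for s using d[OF t that] by linarith+
    then have "\<phi> t - E \<le> cell_average \<tau> l \<phi>" "cell_average \<tau> l \<phi> \<le> \<phi> t + E"
      using cell_average_bounds[OF k(2) i(2)] by blast+
    then show ?thesis by linarith
  qed
  have "\<phi> t \<le> cell_average \<tau> l \<phi> + E" "cell_average \<tau> l \<phi> - E \<le> \<phi> t" if "t \<in> cell \<tau> m" for t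
    using 1[OF that] by linarith+
  then have "cell_average \<tau> m \<phi> \<le> cell_average \<tau> l \<phi> + E" "cell_average \<tau> l \<phi> - E \<le> cell_average \<tau> m \<phi>"
    using cell_average_bounds[OF k(1) i(1)] by blast+
  then show ?thesis by linarith
qed

lemma cell_average_double_sum:
  fixes \<phi> :: "'i \<Rightarrow> 'i \<Rightarrow> real \<Rightarrow> real"
  assumes "\<And>k l. k \<in> K \<Longrightarrow> l \<in> K \<Longrightarrow> integrable (lebesgue_on (cell \<tau> m)) (\<phi> k l)"
  shows "cell_average \<tau> m (\<lambda>t. \<Sum>k\<in>K. \<Sum>l\<in>K. c k l * \<phi> k l t) = (\<Sum>k\<in>K. \<Sum>l\<in>K. c k l * cell_average \<tau> m (\<phi> k l))"
proof -
  have "(\<integral>t. (\<Sum>k\<in>K. \<Sum>l\<in>K. c k l * \<phi> k l t) \<partial>lebesgue_on (cell \<tau> m))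
      = (\<Sum>k\<in>K. \<integral>t. (\<Sum>l\<in>K. c k l * \<phi> k l t) \<partial>lebesgue_on (cell \<tau> m))"
    by (intro Bochner_Integration.integral_sum Bochner_Integration.integrable_sum integrable_mult_right assms)
  also have "\<dots> = (\<Sum>k\<in>K. \<Sum>l\<in>K. \<integral>t. c k l * \<phi> k l t \<partial>lebesgue_on (cell \<tau> m))"
    by (intro sum.cong refl Bochner_Integration.integral_sum integrable_mult_right assms)
  finally show ?thesis by (simp add: cell_average_def sum_distrib_left mult.left_commute)
qed

section \<open>The equations on the single cells\<close>

lemma cell_disjoint:
  assumes mesh: "\<forall>m\<in>{1..M}. \<tau> (m - 1) < \<tau> m" and "m \<in> {1..M}" "l \<in> {1..M}" "t \<in> cell \<tau> m" "t \<in> cell \<tau> l"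
  shows "m = l"
proof (rule ccontr)
  assume "m \<noteq> l"
  then consider "m \<le> l - 1" | "l \<le> m - 1" by linarith
  then show False
  proof cases
    case 1
    have "\<tau> m \<le> \<tau> (l - 1)" using mesh_mono[OF mesh 1] assms by auto
    then show False using assms by (auto simp: cell_def)
  next
    case 2
    have "\<tau> l \<le> \<tau> (m - 1)" using mesh_mono[OF mesh 2] assms by auto
    then show False using assms by (auto simp: cell_def)
  qed
qed

lemma form_a_zero_right:
  assumes \<Omega>: "bounded \<Omega>" "open \<Omega>"
  shows "form_a \<Omega> a t w (\<lambda>x. 0) = 0"
proof -
  have z: "(\<lambda>x. 0) \<in> H1 \<Omega>"
    using test_functions_subset_H10[OF \<Omega>] zero_test_function[of \<Omega>] by (auto simp: H10_def)
  have "AE x in lebesgue_on \<Omega>. weak_partial \<Omega> i (\<lambda>x. 0) x = 0" for i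
    using weak_partial_combination_null[OF \<Omega>, of "{0::nat}" "\<lambda>_ x. 0" "\<lambda>_. 1" i] z by simp
  then have "AE x in lebesgue_on \<Omega>. \<forall>i. weak_partial \<Omega> i (\<lambda>x. 0) x = 0" by (rule eventually_all_finite)
  then show ?thesis unfolding form_a_def by (intro integral_eq_zero_AE) (auto elim!: eventually_mono)
qed

lemma Lp_L2_norm_integrable:
  assumes p: "1 \<le> p" and J: "J \<in> sets lebesgue" "emeasure lebesgue J < \<infinity>" and f: "f \<in> Lp_L2 p J \<Omega>"
  shows "integrable (lebesgue_on J) (\<lambda>t. L2_norm \<Omega> (f t))"
proof (rule Bochner_Integration.integrable_bound)
  have i: "integrable (lebesgue_on J) (\<lambda>t. L2_norm \<Omega> (f t) powr p)" using f by (simp add: Lp_L2_def)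
  have "finite_measure (lebesgue_on J)"
    using J by (intro finite_measureI) (simp add: emeasure_restrict_space)
  then show "integrable (lebesgue_on J) (\<lambda>t. 1 + L2_norm \<Omega> (f t) powr p)"
    using i by (intro Bochner_Integration.integrable_add finite_measure.integrable_const)
  have "(\<lambda>t. (L2_norm \<Omega> (f t) powr p) powr (1 / p)) \<in> borel_measurable (lebesgue_on J)"
    by (intro powr_real_measurable borel_measurable_integrable[OF i] borel_measurable_const)
  then show "(\<lambda>t. L2_norm \<Omega> (f t)) \<in> borel_measurable (lebesgue_on J)"
    using p by (simp add: powr_powr)
  have "y \<le> 1 + y powr p" if "0 \<le> y" for y :: real
  proof (cases "y \<le> 1")
    case False
    then have "y powr 1 \<le> y powr p" using p by (intro powr_mono) auto
    then show ?thesis using False by simp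
  qed (use powr_ge_zero[of y p] in linarith)
  then show "AE t in lebesgue_on J. norm (L2_norm \<Omega> (f t)) \<le> norm (1 + L2_norm \<Omega> (f t) powr p)"
    by (intro AE_I2) simp
qed

text \<open>A test function that vanishes outside one cell isolates its equation; the right-hand side is the mean of
  \<open>f\<close> over the cell, to which Jensen's inequality applies. The convention \<open>U 0 = 0\<close> expresses the initial
  value. The last cell contains the end point \<open>T\<close>, which is outside the open time interval; a single point
  is negligible.\<close>

lemma dG0_cell_equations:
  fixes \<Omega> :: "(real ^ 'n) set"
  assumes \<Omega>: "bounded \<Omega>" "open \<Omega>" and mesh: "\<tau> 0 = 0" "\<tau> M = T" "\<forall>m\<in>{1..M}. \<tau> (m - 1) < \<tau> m"
    and p: "1 \<le> p" and f: "f \<in> Lp_L2 p {0<..<T} \<Omega>" and dG: "dG0_solution \<Omega> T a \<tau> M f (\<lambda>x. 0) u"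
  defines "U \<equiv> \<lambda>m. if m = 0 then (\<lambda>x. 0) else val \<tau> u m"
  shows "\<exists>F. \<forall>m\<in>{1..M}. F m \<in> L2 \<Omega> \<and>
      (\<forall>v\<in>H10 \<Omega>. L2_inner \<Omega> (\<lambda>x. U m x - U (m - 1) x) v + step \<tau> m * avg_A \<Omega> a \<tau> m (U m) v
         = step \<tau> m * L2_inner \<Omega> (F m) v) \<and>
      step \<tau> m * L2_norm \<Omega> (F m) powr p
        \<le> (\<integral>t. indicator (cell \<tau> m) t * L2_norm \<Omega> (f t) powr p \<partial>lebesgue_on {0<..<T})"
proof -
  note mono = mesh_mono[OF mesh(3)]
  let ?J = "{0<..<T}"
  have Jm: "?J \<in> sets lebesgue" by simp
  have Jf: "emeasure lebesgue ?J < \<infinity>" using emeasure_lborel_box_finite[of 0 T] by (simp add: box_real)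
  have one: "(\<lambda>x. 1) \<in> L2 \<Omega>" by (rule bounded_one_in_L2[OF \<Omega>])
  have uX: "u \<in> X0 \<Omega> \<tau> M" using dG by (simp add: dG0_solution_def)
  have zH: "(\<lambda>x. 0) \<in> H10 \<Omega>" using test_functions_subset_H10[OF \<Omega>] zero_test_function by blast
  have f2: "AE t in lebesgue_on ?J. f t \<in> L2 \<Omega>" and fs: "strongly_measurable_L2 \<Omega> ?J f"
    and fp: "integrable (lebesgue_on ?J) (\<lambda>t. L2_norm \<Omega> (f t) powr p)"
    using f by (auto simp: Lp_L2_def)
  have fi: "integrable (lebesgue_on ?J) (\<lambda>t. L2_norm \<Omega> (f t))"
    by (rule Lp_L2_norm_integrable[OF p Jm Jf f])
  have cells: "\<exists>F. F \<in> L2 \<Omega> \<and>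
      (\<forall>v\<in>H10 \<Omega>. L2_inner \<Omega> (\<lambda>x. U m x - U (m - 1) x) v + step \<tau> m * avg_A \<Omega> a \<tau> m (U m) v
         = step \<tau> m * L2_inner \<Omega> F v) \<and>
      step \<tau> m * L2_norm \<Omega> F powr p
        \<le> (\<integral>t. indicator (cell \<tau> m) t * L2_norm \<Omega> (f t) powr p \<partial>lebesgue_on ?J)"
    if m: "m \<in> {1..M}" for m
  proof -
    define K where "K = cell \<tau> m \<inter> ?J"
    have k: "0 < step \<tau> m" using mesh(3) m by (simp add: step_def)
    have Km: "K \<in> sets lebesgue" "K \<subseteq> ?J" by (auto simp: K_def cell_def)
    have cellT: "t \<in> ?J \<or> t = T" if "t \<in> cell \<tau> m" for t
    proof -
      have "m - 1 \<le> M" "m \<le> M" using m by auto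
      then have "0 \<le> \<tau> (m - 1)" "\<tau> m \<le> T" using mono[of 0 "m-1"] mono[of m M] mesh(1,2) by auto
      then show ?thesis using that by (auto simp: cell_def)
    qed
    have restr: "(\<integral>t. indicator (cell \<tau> m) t * \<phi> t \<partial>lebesgue_on ?J) = (\<integral>t. \<phi> t \<partial>lebesgue_on K)" for \<phi> :: "real \<Rightarrow> real"
    proof -
      have "(\<lambda>t. indicator ?J t *\<^sub>R (indicator (cell \<tau> m) t * \<phi> t)) = (\<lambda>t. indicator K t *\<^sub>R \<phi> t)"
        by (auto simp: K_def indicator_def)
      then show ?thesis using Km(1) by (simp add: integral_restrict_space)
    qed
    have KC: "(\<integral>t. \<phi> t \<partial>lebesgue_on K) = (\<integral>t. \<phi> t \<partial>lebesgue_on (cell \<tau> m))" for \<phi> :: "real \<Rightarrow> real"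
    proof -
      have "(\<integral>t. indicator K t *\<^sub>R \<phi> t \<partial>lebesgue) = (\<integral>t. indicator (cell \<tau> m) t *\<^sub>R \<phi> t \<partial>lebesgue)"
        by (rule integral_discrete_difference[where X = "{T}"]) (use cellT in \<open>auto simp: K_def indicator_def\<close>)
      then show ?thesis using Km(1) by (simp add: integral_restrict_space cell_def)
    qed
    have Kf: "emeasure lebesgue K < \<infinity>"
      using emeasure_mono[of K ?J lebesgue] Km Jf by (auto intro: le_less_trans)
    have Kmeas: "finite_measure (lebesgue_on K)" "measure (lebesgue_on K) (space (lebesgue_on K)) = step \<tau> m"
    proof -
      have e: "emeasure (lebesgue_on K) (space (lebesgue_on K)) = emeasure lebesgue K"
        using Km by (simp add: emeasure_restrict_space)
      then show fm: "finite_measure (lebesgue_on K)" using Kf by (intro finite_measureI) simp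
      have "measure (lebesgue_on K) (space (lebesgue_on K)) = (\<integral>t. 1 \<partial>lebesgue_on K)" by simp
      also have "\<dots> = step \<tau> m" unfolding KC using measure_lebesgue_on_cell(2)[OF k] by simp
      finally show "measure (lebesgue_on K) (space (lebesgue_on K)) = step \<tau> m" .
    qed
    have f2K: "AE t in lebesgue_on K. f t \<in> L2 \<Omega>"
      using f2 Km by (auto simp: AE_restrict_space_iff elim!: eventually_mono)
    have fiK: "integrable (lebesgue_on K) (\<lambda>t. L2_norm \<Omega> (f t))"
      by (rule integrable_lebesgue_on_subset[OF fi Jm Km])
    have fpK: "integrable (lebesgue_on K) (\<lambda>t. L2_norm \<Omega> (f t) powr p)"
      by (rule integrable_lebesgue_on_subset[OF fp Jm Km])
    obtain G where G: "G \<in> L2 \<Omega>" "\<And>v. v \<in> L2 \<Omega> \<Longrightarrow> integrable (lebesgue_on K) (\<lambda>t. L2_inner \<Omega> (f t) v)"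
      "\<And>v. v \<in> L2 \<Omega> \<Longrightarrow> L2_inner \<Omega> G v = (\<integral>t. L2_inner \<Omega> (f t) v \<partial>lebesgue_on K)"
      using strongly_measurable_L2_integral[OF one Km(1) Kf f2K strongly_measurable_L2_subset[OF fs Jm Km] fiK] by blast
    have normG: "L2_norm \<Omega> G \<le> (\<integral>t. L2_norm \<Omega> (f t) \<partial>lebesgue_on K)"
    proof -
      have "L2_norm \<Omega> G * L2_norm \<Omega> G = (\<integral>t. L2_inner \<Omega> (f t) G \<partial>lebesgue_on K)"
        using G(3)[OF G(1)] L2_norm_power2[of \<Omega> G] by (simp add: power2_eq_square)
      also have "\<dots> \<le> (\<integral>t. L2_norm \<Omega> (f t) * L2_norm \<Omega> G \<partial>lebesgue_on K)"
      proof (rule integral_mono_AE[OF G(2)[OF G(1)] integrable_mult_left[OF fiK]])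
        show "AE t in lebesgue_on K. L2_inner \<Omega> (f t) G \<le> L2_norm \<Omega> (f t) * L2_norm \<Omega> G"
          using f2K by eventually_elim (use L2_Cauchy_Schwarz[OF _ G(1)] abs_ge_self order_trans in blast)
      qed
      also have "\<dots> = (\<integral>t. L2_norm \<Omega> (f t) \<partial>lebesgue_on K) * L2_norm \<Omega> G" by simp
      finally have *: "L2_norm \<Omega> G * L2_norm \<Omega> G \<le> (\<integral>t. L2_norm \<Omega> (f t) \<partial>lebesgue_on K) * L2_norm \<Omega> G" .
      show ?thesis
      proof (cases "L2_norm \<Omega> G = 0")
        case True
        then show ?thesis by (simp add: integral_nonneg_AE)
      next
        case False
        then have "0 < L2_norm \<Omega> G" using L2_norm_nonneg[of \<Omega> G] by linarith
        with * show ?thesis by (rule mult_right_le_imp_le)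
      qed
    qed
    define F where "F x = G x / step \<tau> m" for x
    have F: "F \<in> L2 \<Omega>" unfolding F_def by (rule L2_divide[OF G(1)])
    have "step \<tau> m * L2_norm \<Omega> F powr p \<le> step \<tau> m * ((\<integral>t. L2_norm \<Omega> (f t) \<partial>lebesgue_on K) / step \<tau> m) powr p"
    proof (intro mult_left_mono powr_mono2)
      have "L2_norm \<Omega> F = L2_norm \<Omega> G / step \<tau> m"
        using L2_norm_scale[of \<Omega> "1 / step \<tau> m" G] k by (simp add: F_def[abs_def])
      then show "L2_norm \<Omega> F \<le> (\<integral>t. L2_norm \<Omega> (f t) \<partial>lebesgue_on K) / step \<tau> m"
        using normG k by (simp add: divide_right_mono)
    qed (use p k in auto)
    also have "\<dots> \<le> (\<integral>t. L2_norm \<Omega> (f t) powr p \<partial>lebesgue_on K)"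
      by (rule powr_average_le[OF p k Kmeas _ fiK fpK]) simp
    finally have normF: "step \<tau> m * L2_norm \<Omega> F powr p \<le> (\<integral>t. indicator (cell \<tau> m) t * L2_norm \<Omega> (f t) powr p \<partial>lebesgue_on ?J)"
      unfolding restr .
    have "L2_inner \<Omega> (\<lambda>x. U m x - U (m - 1) x) v + step \<tau> m * avg_A \<Omega> a \<tau> m (U m) v = step \<tau> m * L2_inner \<Omega> F v"
      if v: "v \<in> H10 \<Omega>" for v
    proof -
      have v2: "v \<in> L2 \<Omega>" using v by (simp add: H10_def H1_def)
      define \<phi> where "\<phi> t = (if t \<in> cell \<tau> m then v else (\<lambda>x. 0))" for t
      have own: "\<tau> l \<in> cell \<tau> l" if "l \<in> {1..M}" for l using mesh(3) that by (simp add: cell_def)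
      have \<phi>X: "\<phi> \<in> X0 \<Omega> \<tau> M"
        unfolding X0_def
      proof (intro CollectI ballI)
        fix l assume l: "l \<in> {1..M}"
        show "\<exists>w\<in>H10 \<Omega>. \<forall>t\<in>cell \<tau> l. \<phi> t = w"
        proof (cases "l = m")
          case True then show ?thesis using v by (auto simp: \<phi>_def)
        next
          case False
          then have "\<forall>t\<in>cell \<tau> l. \<phi> t = (\<lambda>x. 0)" using cell_disjoint[OF mesh(3) m l] by (auto simp: \<phi>_def)
          then show ?thesis using zH by blast
        qed
      qed
      have val\<phi>: "val \<tau> \<phi> l = (if l = m then v else (\<lambda>x. 0))" if "l \<in> {1..M}" for l
        using own[OF that] cell_disjoint[OF mesh(3) m that] by (auto simp: val_def \<phi>_def)
      have eq: "(\<integral>t. form_a \<Omega> a t (u t) (\<phi> t) \<partial>lebesgue_on ?J)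
        + (\<Sum>l=2..M. L2_inner \<Omega> (\<lambda>x. val \<tau> u l x - val \<tau> u (l - 1) x) (val \<tau> \<phi> l))
        + L2_inner \<Omega> (val \<tau> u 1) (val \<tau> \<phi> 1)
        = (\<integral>t. L2_inner \<Omega> (f t) (\<phi> t) \<partial>lebesgue_on ?J) + L2_inner \<Omega> (\<lambda>x. 0) (val \<tau> \<phi> 1)"
        using dG \<phi>X by (auto simp: dG0_solution_def)
      have "form_a \<Omega> a t (u t) (\<phi> t) = indicator (cell \<tau> m) t * form_a \<Omega> a t (U m) v" for t
      proof (cases "t \<in> cell \<tau> m")
        case True
        obtain w where w: "\<forall>t\<in>cell \<tau> m. u t = w" using uX m unfolding X0_def by blast
        then have "u t = U m" using True own[OF m] m by (auto simp: U_def val_def)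
        then show ?thesis using True by (simp add: \<phi>_def)
      next
        case False then show ?thesis by (simp add: \<phi>_def form_a_zero_right[OF \<Omega>])
      qed
      then have e1: "(\<integral>t. form_a \<Omega> a t (u t) (\<phi> t) \<partial>lebesgue_on ?J) = step \<tau> m * avg_A \<Omega> a \<tau> m (U m) v"
        using k by (simp add: restr KC avg_A_def op_A_def)
      have "L2_inner \<Omega> (f t) (\<phi> t) = indicator (cell \<tau> m) t * L2_inner \<Omega> (f t) v" for t
        by (simp add: \<phi>_def)
      then have e2: "(\<integral>t. L2_inner \<Omega> (f t) (\<phi> t) \<partial>lebesgue_on ?J) = step \<tau> m * L2_inner \<Omega> F v"
        using k G(3)[OF v2] by (simp add: restr F_def[abs_def] L2_inner_divide_left)
      have e3: "(\<Sum>l=2..M. L2_inner \<Omega> (\<lambda>x. val \<tau> u l x - val \<tau> u (l - 1) x) (val \<tau> \<phi> l))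
          + L2_inner \<Omega> (val \<tau> u 1) (val \<tau> \<phi> 1) = L2_inner \<Omega> (\<lambda>x. U m x - U (m - 1) x) v"
      proof -
        have "(\<Sum>l=2..M. L2_inner \<Omega> (\<lambda>x. val \<tau> u l x - val \<tau> u (l - 1) x) (val \<tau> \<phi> l))
            = (\<Sum>l=2..M. if l = m then L2_inner \<Omega> (\<lambda>x. val \<tau> u m x - val \<tau> u (m - 1) x) v else 0)"
          by (intro sum.cong refl) (auto simp: val\<phi>)
        also have "\<dots> = (if m \<in> {2..M} then L2_inner \<Omega> (\<lambda>x. val \<tau> u m x - val \<tau> u (m - 1) x) v else 0)"
          by simp
        finally have s: "(\<Sum>l=2..M. L2_inner \<Omega> (\<lambda>x. val \<tau> u l x - val \<tau> u (l - 1) x) (val \<tau> \<phi> l)) = \<dots>" .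
        show ?thesis
        proof (cases "m = 1")
          case True then show ?thesis using s m val\<phi>[of 1] by (simp add: U_def)
        next
          case False
          then have "m \<in> {2..M}" "m \<noteq> 0" "m - 1 \<noteq> 0" using m by auto
          then show ?thesis using s m val\<phi>[of 1] False by (simp add: U_def)
        qed
      qed
      show ?thesis using eq e3 unfolding e1 e2 by simp
    qed
    then show ?thesis using F normF by blast
  qed
  show ?thesis by (rule bchoice, rule ballI) (rule cells)
qed

section \<open>Gram forms\<close>

text \<open>The spans of the discrete solution are handled through coefficient vectors, on which both the
  inner product and the averaged forms are total bilinear forms.\<close>

definition gram_form :: "nat set \<Rightarrow> (nat \<Rightarrow> nat \<Rightarrow> real) \<Rightarrow> (nat \<Rightarrow> real) \<Rightarrow> (nat \<Rightarrow> real) \<Rightarrow> real" where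
  "gram_form I G c d = (\<Sum>i\<in>I. \<Sum>j\<in>I. c i * d j * G i j)"

lemma semi_inner_gram_form:
  assumes sym: "\<And>i j. i \<in> I \<Longrightarrow> j \<in> I \<Longrightarrow> G i j = G j i" and pos: "\<And>c. 0 \<le> gram_form I G c c"
  shows "semi_inner (gram_form I G)"
  unfolding semi_inner_def bilinear_def
proof (intro conjI allI pos)
  show "linear (\<lambda>y. gram_form I G x y)" for x
    by (rule linearI) (simp_all add: gram_form_def scaleR_fun_def sum_distrib_left sum.distrib algebra_simps)
  show "linear (\<lambda>x. gram_form I G x y)" for y
    by (rule linearI) (simp_all add: gram_form_def scaleR_fun_def sum_distrib_left sum.distrib algebra_simps)
  show "gram_form I G x y = gram_form I G y x" for x y
    unfolding gram_form_def
    by (subst sum.swap) (auto intro!: sum.cong simp: sym)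
qed

definition unit_vector :: "nat set \<Rightarrow> nat \<Rightarrow> nat \<Rightarrow> real" where
  "unit_vector I i = (\<lambda>j. if j = i \<and> i \<in> I then 1 else 0)"

lemma gram_form_unit_vector:
  assumes "finite I" "i \<in> I"
  shows "gram_form I G (unit_vector I i) d = (\<Sum>j\<in>I. d j * G i j)"
proof -
  have "gram_form I G (unit_vector I i) d = (\<Sum>k\<in>I. if k = i then (\<Sum>j\<in>I. d j * G i j) else 0)"
    unfolding gram_form_def by (intro sum.cong) (auto simp: unit_vector_def assms(2))
  then show ?thesis using assms by simp
qed

section \<open>The estimate at a single time level\<close>

text \<open>All takes place in the span \<open>W\<close> of the discrete solution. If \<open>\<gamma>\<close> represents \<open>A\<^sub>m u\<^sub>m\<close> on \<open>W\<close>, then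
  \<open>implicit_Euler_duality\<close> bounds \<open>\<gamma>\<close>, while the difference of \<open>A\<^sub>m u\<^sub>m\<close> and \<open>F\<^sub>m\<close> is a difference quotient of the solution and
  lies in \<open>W\<close>. Pairing \<open>A\<^sub>m u\<^sub>m\<close> with itself therefore involves \<open>F\<^sub>m\<close> and \<open>\<gamma>\<close> only. The gradient of \<open>u\<^sub>l\<close> is
  controlled by \<open>\<langle>A\<^sub>l u\<^sub>l, u\<^sub>l\<rangle>\<close>, which is why the norms of \<open>A\<^sub>l u\<^sub>l\<close> and \<open>u\<^sub>l\<close> appear on the right.\<close>

lemma discrete_solution_estimate:
  fixes \<Omega> :: "(real ^ 'n) set"
  assumes \<Omega>: "bounded \<Omega>" "open \<Omega>" and \<alpha>: "0 < \<alpha>" and \<kappa>: "0 < \<kappa>"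
    and mesh: "\<tau> 0 = 0" "\<tau> M = T" "\<forall>m\<in>{1..M}. \<tau> (m - 1) < \<tau> m"
    and ratio: "\<forall>m\<in>{1..M - 1}. 1 / \<kappa> \<le> step \<tau> m / step \<tau> (m + 1) \<and> step \<tau> m / step \<tau> (m + 1) \<le> \<kappa>"
    and ell: "\<And>t. t \<in> {0..T} \<Longrightarrow> elliptic_at \<Omega> a \<alpha> B t"
    and cont: "\<And>i j. AE x in lebesgue_on \<Omega>. continuous_on {0..T} (\<lambda>t. a i j t x)"
    and w: "\<And>i j t s. t \<in> {0..T} \<Longrightarrow> s \<in> {0..T} \<Longrightarrow> AE x in lebesgue_on \<Omega>. \<bar>a i j t x - a i j s x\<bar> \<le> \<omega> \<bar>t - s\<bar>"
    and \<omega>: "\<And>t. t \<in> {0..T} \<Longrightarrow> 0 \<le> \<omega> t" "mono_on {0..T} \<omega>"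
    and U: "\<And>l. l \<in> {1..M} \<Longrightarrow> U l \<in> H10 \<Omega>" "U 0 = (\<lambda>x. 0)"
    and F: "\<And>l. l \<in> {1..M} \<Longrightarrow> F l \<in> L2 \<Omega>"
    and eq: "\<And>l v. l \<in> {1..M} \<Longrightarrow> v \<in> H10 \<Omega> \<Longrightarrow>
      L2_inner \<Omega> (\<lambda>x. U l x - U (l - 1) x) v + step \<tau> l * avg_A \<Omega> a \<tau> l (U l) v = step \<tau> l * L2_inner \<Omega> (F l) v"
    and m: "m \<in> {1..M}"
  defines "g \<equiv> \<lambda>l x. F l x - (U l x - U (l - 1) x) / step \<tau> l"
  defines "C \<equiv> real CARD('n) / \<alpha> * sqrt (1 + \<kappa>)"
  shows "represents_L2 \<Omega> (avg_A \<Omega> a \<tau> m (U m)) (g m)"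
    and "L2_norm \<Omega> (U m) \<le> (\<Sum>l=1..m. step \<tau> l * L2_norm \<Omega> (F l))"
    and "L2_norm \<Omega> (g m) \<le> 2 * ((\<Sum>l=1..m. step \<tau> l * L2_norm \<Omega> (F l) / (\<tau> m - \<tau> (l - 1)))
      + C * (\<Sum>l\<in>{1..<m}. step \<tau> l * (\<omega> (\<tau> m - \<tau> (l - 1)) * (\<tau> m - \<tau> (l - 1)) powr (-3/2))
               * (L2_norm \<Omega> (g l) + L2_norm \<Omega> (U l))) + L2_norm \<Omega> (F m))"
proof -
  note mono = mesh_mono[OF mesh(3)] and smono = mesh_strict_mono[OF mesh(3)]
  have k: "0 < step \<tau> l" if "l \<in> {1..M}" for l using mesh(3) that by (simp add: step_def)
  have tr: "\<tau> l \<in> {0..T}" if "l \<le> M" for l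
    using mono[of 0 l] mono[of l M] that mesh(1,2) by auto
  have cellT: "cell \<tau> l \<subseteq> {0..T}" if "l \<in> {1..M}" for l
  proof -
    have "l - 1 \<le> M" "l \<le> M" using that by auto
    then have "0 \<le> \<tau> (l - 1)" "\<tau> l \<le> T" using tr by auto
    then show ?thesis by (auto simp: cell_def)
  qed
  have UH1: "U l \<in> H1 \<Omega>" if "l \<in> {1..M}" for l using U(1)[OF that] by (simp add: H10_def)
  have U2: "U l \<in> L2 \<Omega>" if "l \<le> M" for l
    using UH1[of l] U(2) L2_zero that by (cases "l = 0") (auto simp: H1_def)
  have W2: "weak_partial \<Omega> i (U l) \<in> L2 \<Omega>" if "l \<in> {1..M}" for i l
    by (rule weak_partialD(1)[OF UH1[OF that]])
  have g2: "g l \<in> L2 \<Omega>" if "l \<in> {1..M}" for l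
    unfolding g_def using that by (intro L2_diff L2_divide F U2) auto
  have rep: "avg_A \<Omega> a \<tau> l (U l) v = L2_inner \<Omega> (g l) v" if l: "l \<in> {1..M}" and v: "v \<in> H10 \<Omega>" for l v
  proof -
    have v2: "v \<in> L2 \<Omega>" using v by (simp add: H10_def H1_def)
    have d2: "(\<lambda>x. U l x - U (l - 1) x) \<in> L2 \<Omega>" using l by (intro L2_diff U2) auto
    have "L2_inner \<Omega> (g l) v = L2_inner \<Omega> (F l) v - L2_inner \<Omega> (\<lambda>x. U l x - U (l - 1) x) v / step \<tau> l"
      unfolding g_def using L2_inner_diff_left[OF F[OF l] L2_divide[OF d2] v2, of "step \<tau> l"]
      by (simp add: L2_inner_divide_left)
    then have "step \<tau> l * L2_inner \<Omega> (g l) v = step \<tau> l * avg_A \<Omega> a \<tau> l (U l) v"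
      using eq[OF l v] k[OF l] by (simp add: right_diff_distrib)
    then show ?thesis using k[OF l] by simp
  qed
  show "represents_L2 \<Omega> (avg_A \<Omega> a \<tau> m (U m)) (g m)"
    unfolding represents_L2_def using g2 rep m by blast
  define I where "I = {1..M}"
  have I: "finite I" by (simp add: I_def)
  define P where "P c i x = (\<Sum>l\<in>I. c l * weak_partial \<Omega> i (U l) x)" for c :: "nat \<Rightarrow> real" and i x
  have P2: "P c i \<in> L2 \<Omega>" for c i unfolding P_def by (intro L2_sum L2_scale W2) (simp add: I_def)
  define ip where "ip = gram_form I (\<lambda>i j. L2_inner \<Omega> (U i) (U j))"
  define am where "am l = gram_form I (\<lambda>i j. avg_A \<Omega> a \<tau> l (U i) (U j))" for l
  define comb where "comb c x = (\<Sum>l\<in>I. c l * U l x)" for c :: "nat \<Rightarrow> real" and x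
  have comb2: "comb c \<in> L2 \<Omega>" for c unfolding comb_def by (intro L2_sum L2_scale U2) (simp add: I_def)
  have comb_inner: "L2_inner \<Omega> h (comb c) = (\<Sum>l\<in>I. c l * L2_inner \<Omega> h (U l))" if "h \<in> L2 \<Omega>" for h c
    unfolding comb_def by (rule L2_inner_sum_right) (auto simp: I_def U2 that)
  have ip_eq: "ip c d = L2_inner \<Omega> (comb c) (comb d)" for c d
  proof -
    have "L2_inner \<Omega> (comb c) (U j) = (\<Sum>i\<in>I. c i * L2_inner \<Omega> (U i) (U j))" if "j \<in> I" for j
      unfolding comb_def by (rule L2_inner_sum_left) (use that in \<open>auto simp: I_def U2\<close>)
    then have "L2_inner \<Omega> (comb c) (comb d) = (\<Sum>j\<in>I. \<Sum>i\<in>I. c i * d j * L2_inner \<Omega> (U i) (U j))"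
      by (simp add: comb_inner[OF comb2] sum_distrib_left mult_ac)
    moreover have "ip c d = (\<Sum>j\<in>I. \<Sum>i\<in>I. c i * d j * L2_inner \<Omega> (U i) (U j))"
      unfolding ip_def gram_form_def by (rule sum.swap)
    ultimately show ?thesis by (rule trans[OF _ sym, rotated])
  qed
  have ip: "semi_inner ip" unfolding ip_def
  proof (rule semi_inner_gram_form)
    show "0 \<le> gram_form I (\<lambda>i j. L2_inner \<Omega> (U i) (U j)) c c" for c
      unfolding ip_def[symmetric] ip_eq by (rule L2_inner_nonneg)
  qed (rule L2_inner_sym)
  have ip_norm: "sqrt (ip c c) = L2_norm \<Omega> (comb c)" for c by (simp add: ip_eq L2_norm_def)
  have fcont: "continuous_on {0..T} (\<lambda>t. field_form \<Omega> a t p q)" if "\<And>i. p i \<in> L2 \<Omega>" "\<And>i. q i \<in> L2 \<Omega>" for p q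
    by (rule field_form_continuous[OF ell cont that])
  have fint: "integrable (lebesgue_on (cell \<tau> l)) (\<lambda>t. field_form \<Omega> a t p q)"
    if "l \<in> I" "\<And>i. p i \<in> L2 \<Omega>" "\<And>i. q i \<in> L2 \<Omega>" for l p q
    using integrable_on_cell[OF fcont[OF that(2,3)] cellT] that(1) by (simp add: I_def)
  have am_eq: "am l c d = cell_average \<tau> l (\<lambda>t. field_form \<Omega> a t (P c) (P d))" if l: "l \<in> I" for l c d
  proof -
    have "cell_average \<tau> l (\<lambda>t. field_form \<Omega> a t (P c) (P d))
        = cell_average \<tau> l (\<lambda>t. \<Sum>i\<in>I. \<Sum>j\<in>I. c i * d j *
            field_form \<Omega> a t (\<lambda>n. weak_partial \<Omega> n (U i)) (\<lambda>n. weak_partial \<Omega> n (U j)))"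
      unfolding cell_average_def
    proof (intro arg_cong2[where f = "(*)"] refl Bochner_Integration.integral_cong)
      fix t assume "t \<in> space (lebesgue_on (cell \<tau> l))"
      then have "t \<in> {0..T}" using cellT[of l] l by (auto simp: I_def space_restrict_space)
      from field_form_sum[OF ell[OF this], of I "\<lambda>l n. weak_partial \<Omega> n (U l)" c d] W2
      show "field_form \<Omega> a t (P c) (P d) = (\<Sum>i\<in>I. \<Sum>j\<in>I. c i * d j *
            field_form \<Omega> a t (\<lambda>n. weak_partial \<Omega> n (U i)) (\<lambda>n. weak_partial \<Omega> n (U j)))"
        by (simp add: P_def[abs_def] I_def)
    qed
    also have "\<dots> = (\<Sum>i\<in>I. \<Sum>j\<in>I. c i * d j * cell_average \<tau> l
        (\<lambda>t. field_form \<Omega> a t (\<lambda>n. weak_partial \<Omega> n (U i)) (\<lambda>n. weak_partial \<Omega> n (U j))))"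
      by (rule cell_average_double_sum) (intro fint l W2; simp add: I_def)
    finally show ?thesis by (simp add: am_def gram_form_def avg_A_eq_cell_average form_a_eq_field_form)
  qed
  define D where "D = real CARD('n) / \<alpha>"
  have D: "0 < D" using \<alpha> by (simp add: D_def)
  have coer: "(field_norm \<Omega> (P c))\<^sup>2 \<le> D * am l c c" if l: "l \<in> I" for l c
  proof -
    have "\<alpha> / real CARD('n) * (field_norm \<Omega> (P c))\<^sup>2 \<le> am l c c"
      unfolding am_eq[OF l]
    proof (rule cell_average_bounds(2))
      show "0 < step \<tau> l" using k l by (simp add: I_def)
      show "integrable (lebesgue_on (cell \<tau> l)) (\<lambda>t. field_form \<Omega> a t (P c) (P c))" by (intro fint l P2)
      show "\<alpha> / real CARD('n) * (field_norm \<Omega> (P c))\<^sup>2 \<le> field_form \<Omega> a t (P c) (P c)" if "t \<in> cell \<tau> l" for t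
      proof (rule field_form_coercive[OF _ P2 \<alpha>])
        show "elliptic_at \<Omega> a \<alpha> B t" using cellT[of l] that l by (intro ell) (auto simp: I_def)
      qed
    qed
    then show ?thesis using \<alpha> by (simp add: D_def field_simps)
  qed
  have am_nonneg: "0 \<le> am l c c" if "l \<in> I" for l c
    using order_trans[OF zero_le_power2 coer[OF that, of c]] D by (simp add: zero_le_mult_iff)
  have am: "semi_inner (am l)" if l: "l \<in> I" for l
    unfolding am_def
  proof (rule semi_inner_gram_form)
    show "0 \<le> gram_form I (\<lambda>i j. avg_A \<Omega> a \<tau> l (U i) (U j)) c c" for c
      using am_nonneg[OF l] by (simp add: am_def)
    fix i j assume ij: "i \<in> I" "j \<in> I"
    show "avg_A \<Omega> a \<tau> l (U i) (U j) = avg_A \<Omega> a \<tau> l (U j) (U i)"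
      unfolding avg_A_eq_cell_average form_a_eq_field_form cell_average_def
    proof (intro arg_cong2[where f = "(*)"] refl Bochner_Integration.integral_cong field_form_sym)
      show "elliptic_at \<Omega> a \<alpha> B t" if "t \<in> space (lebesgue_on (cell \<tau> l))" for t
        using that cellT[of l] l by (intro ell) (auto simp: I_def space_restrict_space)
    qed (use W2 ij in \<open>auto simp: I_def\<close>)
  qed
  have am_diff: "\<bar>am m' c d - am l c d\<bar> \<le> \<omega> (\<tau> m' - \<tau> (l - 1)) * field_norm \<Omega> (P c) * field_norm \<Omega> (P d)"
    if ml: "m' \<in> I" "l \<in> I" "l < m'" for m' l c d
    unfolding am_eq[OF ml(1)] am_eq[OF ml(2)]
  proof (rule cell_average_difference)
    show "0 < step \<tau> m'" "0 < step \<tau> l" using k ml by (auto simp: I_def)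
    show "integrable (lebesgue_on (cell \<tau> m')) (\<lambda>t. field_form \<Omega> a t (P c) (P d))"
      "integrable (lebesgue_on (cell \<tau> l)) (\<lambda>t. field_form \<Omega> a t (P c) (P d))" by (intro fint ml P2)+
    fix t s assume ts: "t \<in> cell \<tau> m'" "s \<in> cell \<tau> l"
    have r: "t \<in> {0..T}" "s \<in> {0..T}"
      using ts cellT[OF ml(1)[unfolded I_def]] cellT[OF ml(2)[unfolded I_def]] by blast+
    have "\<tau> l \<le> \<tau> (m' - 1)" using mono[of l "m' - 1"] ml by (auto simp: I_def)
    then have ts2: "\<bar>t - s\<bar> \<le> \<tau> m' - \<tau> (l - 1)" using ts by (auto simp: cell_def)
    have "m' \<le> M" "l - 1 \<le> M" using ml by (auto simp: I_def)
    then have "\<tau> m' \<in> {0..T}" "\<tau> (l - 1) \<in> {0..T}" using tr by blast+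
    then have "\<bar>t - s\<bar> \<in> {0..T}" "\<tau> m' - \<tau> (l - 1) \<in> {0..T}" using ts2 by auto
    then have \<omega>le: "\<omega> \<bar>t - s\<bar> \<le> \<omega> (\<tau> m' - \<tau> (l - 1))" "0 \<le> \<omega> \<bar>t - s\<bar>"
      using mono_onD[OF \<omega>(2) _ _ ts2] \<omega>(1) by auto
    have "\<bar>field_form \<Omega> a t (P c) (P d) - field_form \<Omega> a s (P c) (P d)\<bar> \<le> \<bar>\<omega> \<bar>t - s\<bar>\<bar> * field_norm \<Omega> (P c) * field_norm \<Omega> (P d)"
      by (rule field_form_time_difference[OF ell[OF r(1)] ell[OF r(2)] _ _ w[OF r]]) (rule P2)+
    also have "\<dots> \<le> \<omega> (\<tau> m' - \<tau> (l - 1)) * field_norm \<Omega> (P c) * field_norm \<Omega> (P d)"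
      using \<omega>le by (intro mult_right_mono) auto
    finally show "\<bar>field_form \<Omega> a t (P c) (P d) - field_form \<Omega> a s (P c) (P d)\<bar>
      \<le> \<omega> (\<tau> m' - \<tau> (l - 1)) * field_norm \<Omega> (P c) * field_norm \<Omega> (P d)" .
  qed
  have null: "am l v v = 0" if l: "l \<in> I" and v: "ip v v = 0" for l v
  proof -
    have "L2_norm \<Omega> (comb v) = 0" using ip_norm[of v] v by simp
    then have AE0: "AE x in lebesgue_on \<Omega>. (\<Sum>l\<in>I. v l * U l x) = 0"
      using L2_norm_eq_0_iff[OF comb2] unfolding comb_def by blast
    have "AE x in lebesgue_on \<Omega>. P v i x = 0" for i
      unfolding P_def by (rule weak_partial_combination_null[OF \<Omega> _ AE0]) (simp add: UH1 I_def)
    then have "AE x in lebesgue_on \<Omega>. \<forall>i. P v i x = 0" by (rule eventually_all_finite)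
    then have "field_form \<Omega> a t (P v) (P v) = 0" for t
      unfolding field_form_def by (intro integral_eq_zero_AE) (auto elim!: eventually_mono)
    then show ?thesis unfolding am_eq[OF l] cell_average_def by simp
  qed
  let ?e = "unit_vector I"
  define Wsp where "Wsp = span (?e ` I)"
  define e where "e l = (if l \<in> I then ?e l else 0)" for l
  have eW: "e l \<in> Wsp" for l by (auto simp: e_def Wsp_def intro: span_base span_zero)
  have e0: "e 0 = 0" by (simp add: e_def I_def)
  have comb_e: "comb (e l) = U l" if "l \<le> M" for l
  proof (cases "l = 0")
    case True then show ?thesis using U(2) by (simp add: comb_def[abs_def] e0)
  next
    case False
    then have l: "l \<in> I" using that by (simp add: I_def)
    have "comb (e l) x = (\<Sum>j\<in>I. if j = l then U l x else 0)" for x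
      unfolding comb_def using l by (intro sum.cong) (auto simp: e_def unit_vector_def)
    then show ?thesis using l I by auto
  qed
  have Pe: "P (e l) = (\<lambda>i. weak_partial \<Omega> i (U l))" if l: "l \<in> I" for l
  proof (intro ext)
    fix i x
    have "P (e l) i x = (\<Sum>j\<in>I. if j = l then weak_partial \<Omega> i (U l) x else 0)"
      unfolding P_def using l by (intro sum.cong) (auto simp: e_def unit_vector_def)
    then show "P (e l) i x = weak_partial \<Omega> i (U l) x" using l I by simp
  qed
  have ip_e: "ip (e l) v = L2_inner \<Omega> (U l) (comb v)" if "l \<le> M" for l v using ip_eq comb_e[OF that] by simp
  have am_e: "am n (e l) v = (\<Sum>j\<in>I. v j * avg_A \<Omega> a \<tau> n (U l) (U j))" if "l \<in> I" for n l v
    unfolding am_def using that by (simp add: e_def gram_form_unit_vector[OF I])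
  have am_rep: "am l (e l) v = L2_inner \<Omega> (g l) (comb v)" if l: "l \<in> I" for l v
    using rep U(1) l g2 by (simp add: am_e[OF l] comb_inner I_def)
  define N where "N l = field_norm \<Omega> (P (e l))" for l
  have N0: "0 \<le> N l" for l by (simp add: N_def)
  have N_le: "N l \<le> sqrt D * (L2_norm \<Omega> (g l) + L2_norm \<Omega> (U l))" if l: "l \<in> I" for l
  proof -
    have lM: "l \<le> M" "l \<in> {1..M}" using l by (auto simp: I_def)
    have "(N l)\<^sup>2 \<le> D * am l (e l) (e l)" unfolding N_def by (rule coer[OF l])
    also have "am l (e l) (e l) = L2_inner \<Omega> (g l) (U l)" using am_rep[OF l, of "e l"] comb_e[OF lM(1)] by simp
    also have "\<dots> \<le> L2_norm \<Omega> (g l) * L2_norm \<Omega> (U l)"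
      using L2_Cauchy_Schwarz[OF g2[OF lM(2)] U2[OF lM(1)]] by linarith
    also have "\<dots> \<le> (L2_norm \<Omega> (g l) + L2_norm \<Omega> (U l))\<^sup>2"
      by (simp add: power2_eq_square distrib_left distrib_right)
    finally have "(N l)\<^sup>2 \<le> (sqrt D * (L2_norm \<Omega> (g l) + L2_norm \<Omega> (U l)))\<^sup>2"
      using D by (simp add: power_mult_distrib)
    then show ?thesis by (rule power2_le_imp_le) (use D in auto)
  qed
  show "L2_norm \<Omega> (U m) \<le> (\<Sum>l=1..m. step \<tau> l * L2_norm \<Omega> (F l))"
  proof -
    have "L2_norm \<Omega> (U n) \<le> (\<Sum>l=1..n. step \<tau> l * L2_norm \<Omega> (F l))" if "n \<le> M" for n
      using that
    proof (induction n)
      case 0 then show ?case using U(2) by simp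
    next
      case (Suc n)
      let ?u = "U (Suc n)"
      have n: "Suc n \<in> {1..M}" "n \<le> M" "Suc n \<le> M" using Suc.prems by auto
      have "0 \<le> am (Suc n) (e (Suc n)) (e (Suc n))" using n by (intro am_nonneg) (simp add: I_def)
      then have "0 \<le> avg_A \<Omega> a \<tau> (Suc n) ?u ?u"
        using am_rep[of "Suc n" "e (Suc n)"] rep[OF n(1) U(1)[OF n(1)]] comb_e[OF n(3)] n by (simp add: I_def)
      then have pos: "0 \<le> step \<tau> (Suc n) * avg_A \<Omega> a \<tau> (Suc n) ?u ?u" using k[OF n(1)] by simp
      have "L2_inner \<Omega> (\<lambda>x. ?u x - U n x) ?u = L2_inner \<Omega> ?u ?u - L2_inner \<Omega> (U n) ?u"
        by (intro L2_inner_diff_left U2 n)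
      then have "L2_inner \<Omega> ?u ?u \<le> L2_inner \<Omega> (U n) ?u + step \<tau> (Suc n) * L2_inner \<Omega> (F (Suc n)) ?u"
        using eq[OF n(1) U(1)[OF n(1)]] pos by simp
      also have "\<dots> \<le> L2_norm \<Omega> (U n) * L2_norm \<Omega> ?u + step \<tau> (Suc n) * (L2_norm \<Omega> (F (Suc n)) * L2_norm \<Omega> ?u)"
        using L2_Cauchy_Schwarz[OF U2[OF n(2)] U2[OF n(3)]] L2_Cauchy_Schwarz[OF F[OF n(1)] U2[OF n(3)]] k[OF n(1)]
        by (intro add_mono mult_left_mono) auto
      also have "\<dots> = (L2_norm \<Omega> (U n) + step \<tau> (Suc n) * L2_norm \<Omega> (F (Suc n))) * L2_norm \<Omega> ?u"
        by (simp add: distrib_right)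
      finally have *: "L2_norm \<Omega> ?u * L2_norm \<Omega> ?u \<le> (L2_norm \<Omega> (U n) + step \<tau> (Suc n) * L2_norm \<Omega> (F (Suc n))) * L2_norm \<Omega> ?u"
        using L2_norm_power2[of \<Omega> ?u] by (simp add: power2_eq_square)
      have "L2_norm \<Omega> ?u \<le> L2_norm \<Omega> (U n) + step \<tau> (Suc n) * L2_norm \<Omega> (F (Suc n))"
      proof (cases "L2_norm \<Omega> ?u = 0")
        case True
        have "0 \<le> step \<tau> (Suc n) * L2_norm \<Omega> (F (Suc n))" using k[OF n(1)] by simp
        then show ?thesis using True L2_norm_nonneg[of \<Omega> "U n"] by linarith
      next
        case False
        then have "0 < L2_norm \<Omega> ?u" using L2_norm_nonneg[of \<Omega> ?u] by linarith
        with * show ?thesis by (rule mult_right_le_imp_le)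
      qed
      then show ?case using Suc.IH[OF n(2)] by simp
    qed
    then show ?thesis using m by simp
  qed
  have mI: "m \<in> I" "1 \<le> m" "m \<le> M" using m by (auto simp: I_def)
  \<comment> \<open>The equation on cell \<open>l\<close> with the form of cell \<open>m\<close>; the difference of the two forms goes to the right.\<close>
  define FF where "FF l v = L2_inner \<Omega> (F l) (comb v) + (am m (e l) v - am l (e l) v)" for l v
  define q where "q l = (if 1 \<le> l \<and> l < m then \<omega> (\<tau> m - \<tau> (l - 1)) * N l * sqrt D else 0)" for l
  have St: "(\<Sum>j=l..m. step \<tau> j) = \<tau> m - \<tau> (l - 1)" if "1 \<le> l" "l \<le> m" for l by (rule sum_step[OF that])
  have \<omega>0: "0 \<le> \<omega> (\<tau> m - \<tau> (l - 1))" "0 < \<tau> m - \<tau> (l - 1)" if "1 \<le> l" "l \<le> m" for l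
  proof -
    have "l - 1 < m" "l - 1 \<le> M" using that mI by auto
    then show "0 < \<tau> m - \<tau> (l - 1)" using smono mI by simp
    then show "0 \<le> \<omega> (\<tau> m - \<tau> (l - 1))"
      using tr[OF mI(3)] tr[OF \<open>l - 1 \<le> M\<close>] by (intro \<omega>(1)) auto
  qed
  have "\<exists>\<gamma>\<in>Wsp. (\<forall>v\<in>Wsp. ip \<gamma> v = am m (e m) v) \<and> sqrt (ip \<gamma> \<gamma>) \<le>
    (\<Sum>l=1..m. step \<tau> l * (L2_norm \<Omega> (F l) / (\<Sum>j=l..m. step \<tau> j) + q l * sqrt ((1 + \<kappa>) / (\<Sum>j=l..m. step \<tau> j) ^ 3)))"
  proof (rule implicit_Euler_duality[where G = "?e ` I" and u = e and k = "step \<tau>" and F = FF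
        and p = "\<lambda>l. L2_norm \<Omega> (F l)" and q = q and a = "am m"])
    show "semi_inner ip" "semi_inner (am m)" "Wsp = span (?e ` I)" "1 \<le> m" "0 < \<kappa>" "e 0 = 0"
      by (fact ip am[OF mI(1)] Wsp_def mI(2) \<kappa> e0)+
    show "e l \<in> Wsp" for l by (rule eW)
    show "finite (?e ` I)" using I by simp
    show "am m v v = 0" if "ip v v = 0" for v using null[OF mI(1) that] .
    show "0 < step \<tau> l" if "1 \<le> l" "l \<le> m" for l using k[of l] that mI by simp
    show "step \<tau> l \<le> \<kappa> * step \<tau> (Suc l) \<and> step \<tau> (Suc l) \<le> \<kappa> * step \<tau> l" if l: "1 \<le> l" "l < m" for l
    proof -
      have "l \<in> {1..M-1}" "Suc l \<in> {1..M}" using l mI by auto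
      then have "1 / \<kappa> \<le> step \<tau> l / step \<tau> (Suc l)" "step \<tau> l / step \<tau> (Suc l) \<le> \<kappa>" "0 < step \<tau> (Suc l)"
        using ratio k by force+
      then show ?thesis using \<kappa> by (simp add: field_simps)
    qed
    show "ip (e l - e (l - 1)) v + step \<tau> l * am m (e l) v = step \<tau> l * FF l v" if l: "1 \<le> l" "l \<le> m" for l v
    proof -
      have lI: "l \<in> I" "l \<in> {1..M}" "l \<le> M" "l - 1 \<le> M" using l mI by (auto simp: I_def)
      have d2: "(\<lambda>x. U l x - U (l - 1) x) \<in> L2 \<Omega>" by (intro L2_diff U2 lI)
      have "L2_inner \<Omega> (\<lambda>x. U l x - U (l - 1) x) (comb v) + step \<tau> l * am l (e l) v = step \<tau> l * L2_inner \<Omega> (F l) (comb v)"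
      proof -
        have "(\<Sum>j\<in>I. v j * (L2_inner \<Omega> (\<lambda>x. U l x - U (l - 1) x) (U j) + step \<tau> l * avg_A \<Omega> a \<tau> l (U l) (U j)))
            = (\<Sum>j\<in>I. v j * (step \<tau> l * L2_inner \<Omega> (F l) (U j)))"
          using eq[OF lI(2) U(1)] by (intro sum.cong) (auto simp: I_def)
        then show ?thesis
          unfolding comb_inner[OF d2] comb_inner[OF F[OF lI(2)]] am_e[OF lI(1)]
          by (simp add: distrib_left sum.distrib sum_distrib_left mult_ac)
      qed
      moreover have "ip (e l - e (l - 1)) v = L2_inner \<Omega> (\<lambda>x. U l x - U (l - 1) x) (comb v)"
        using L2_inner_diff_left[OF U2 U2 comb2, of l "l - 1" v] lI
        by (simp add: semi_inner_simps[OF ip] ip_e)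
      ultimately show ?thesis by (simp add: FF_def algebra_simps)
    qed
    show "\<bar>FF l v\<bar> \<le> L2_norm \<Omega> (F l) * sqrt (ip v v) + q l * sqrt (am m v v)" if l: "1 \<le> l" "l \<le> m" for l v
    proof -
      have lI: "l \<in> I" "l \<in> {1..M}" using l mI by (auto simp: I_def)
      have 1: "\<bar>L2_inner \<Omega> (F l) (comb v)\<bar> \<le> L2_norm \<Omega> (F l) * sqrt (ip v v)"
        unfolding ip_norm by (rule L2_Cauchy_Schwarz[OF F[OF lI(2)] comb2])
      have 2: "\<bar>am m (e l) v - am l (e l) v\<bar> \<le> q l * sqrt (am m v v)"
      proof (cases "l = m")
        case True then show ?thesis by (simp add: q_def)
      next
        case False
        then have lm: "l < m" using l by simp
        have "field_norm \<Omega> (P v) \<le> sqrt D * sqrt (am m v v)"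
          using real_sqrt_le_mono[OF coer[OF mI(1), of v]] by (simp add: real_sqrt_mult)
        then have "\<omega> (\<tau> m - \<tau> (l - 1)) * N l * field_norm \<Omega> (P v) \<le> \<omega> (\<tau> m - \<tau> (l - 1)) * N l * (sqrt D * sqrt (am m v v))"
          using \<omega>0(1)[OF l] N0 by (intro mult_left_mono) auto
        then show ?thesis using am_diff[OF mI(1) lI(1) lm, of "e l" v] lm l by (simp add: q_def N_def mult_ac)
      qed
      show ?thesis unfolding FF_def using 1 2 abs_triangle_ineq[of "L2_inner \<Omega> (F l) (comb v)" "am m (e l) v - am l (e l) v"]
        by linarith
    qed
    show "0 \<le> q l" for l using \<omega>0(1)[of l] N0[of l] D by (auto simp: q_def)
    show "q m = 0" by (simp add: q_def)
  qed simp
  then obtain \<gamma> where \<gamma>: "\<And>v. v \<in> Wsp \<Longrightarrow> ip \<gamma> v = am m (e m) v"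
    and \<gamma>le: "sqrt (ip \<gamma> \<gamma>) \<le> (\<Sum>l=1..m. step \<tau> l * (L2_norm \<Omega> (F l) / (\<Sum>j=l..m. step \<tau> j)
      + q l * sqrt ((1 + \<kappa>) / (\<Sum>j=l..m. step \<tau> j) ^ 3)))" by blast
  define X where "X = (\<Sum>l=1..m. step \<tau> l * L2_norm \<Omega> (F l) / (\<tau> m - \<tau> (l - 1)))
      + C * (\<Sum>l\<in>{1..<m}. step \<tau> l * (\<omega> (\<tau> m - \<tau> (l - 1)) * (\<tau> m - \<tau> (l - 1)) powr (-3/2))
               * (L2_norm \<Omega> (g l) + L2_norm \<Omega> (U l)))"
  have \<gamma>X: "sqrt (ip \<gamma> \<gamma>) \<le> X"
  proof -
    have "step \<tau> l * (L2_norm \<Omega> (F l) / (\<Sum>j=l..m. step \<tau> j) + q l * sqrt ((1 + \<kappa>) / (\<Sum>j=l..m. step \<tau> j) ^ 3))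
        \<le> step \<tau> l * L2_norm \<Omega> (F l) / (\<tau> m - \<tau> (l - 1)) + (if l < m then C * (step \<tau> l *
            (\<omega> (\<tau> m - \<tau> (l - 1)) * (\<tau> m - \<tau> (l - 1)) powr (-3/2)) * (L2_norm \<Omega> (g l) + L2_norm \<Omega> (U l))) else 0)"
      if l: "l \<in> {1..m}" for l
    proof -
      define s where "s = \<tau> m - \<tau> (l - 1)"
      have l': "1 \<le> l" "l \<le> m" "l \<in> I" using l mI by (auto simp: I_def)
      have s: "0 < s" "0 \<le> \<omega> s" "(\<Sum>j=l..m. step \<tau> j) = s" using \<omega>0[OF l'(1,2)] St[OF l'(1,2)] by (auto simp: s_def)
      have sq: "sqrt ((1 + \<kappa>) / s ^ 3) = sqrt (1 + \<kappa>) * s powr (-3/2)"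
      proof -
        have "(s ^ 3) powr (1/2) = sqrt (s ^ 3)" by (rule powr_half_sqrt) (use s in simp)
        moreover have "s powr 3 = s ^ 3" using s by (simp add: powr_numeral)
        moreover have "(s powr 3) powr (1/2) = s powr (3/2)" by (simp add: powr_powr)
        ultimately have "sqrt (s ^ 3) = s powr (3/2)" by metis
        moreover have "s powr (-3/2) = 1 / s powr (3/2)" using powr_minus_divide[of s "3/2"] by simp
        ultimately show ?thesis by (simp add: real_sqrt_divide)
      qed
      have "q l * sqrt ((1 + \<kappa>) / s ^ 3) \<le> (if l < m then C * (\<omega> s * s powr (-3/2) * (L2_norm \<Omega> (g l) + L2_norm \<Omega> (U l))) else 0)"
      proof (cases "l < m")
        case True
        have "\<omega> s * N l * sqrt D \<le> \<omega> s * (sqrt D * (L2_norm \<Omega> (g l) + L2_norm \<Omega> (U l))) * sqrt D"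
          using N_le[OF l'(3)] s D by (intro mult_right_mono mult_left_mono) auto
        also have "\<dots> = D * (\<omega> s * (L2_norm \<Omega> (g l) + L2_norm \<Omega> (U l)))"
        proof -
          have "\<omega> s * (sqrt D * (L2_norm \<Omega> (g l) + L2_norm \<Omega> (U l))) * sqrt D
              = (sqrt D * sqrt D) * (\<omega> s * (L2_norm \<Omega> (g l) + L2_norm \<Omega> (U l)))" by (simp only: mult_ac)
          then show ?thesis using D by simp
        qed
        finally have "\<omega> s * N l * sqrt D * (sqrt (1 + \<kappa>) * s powr (-3/2))
            \<le> D * (\<omega> s * (L2_norm \<Omega> (g l) + L2_norm \<Omega> (U l))) * (sqrt (1 + \<kappa>) * s powr (-3/2))"
          using \<kappa> by (intro mult_right_mono) auto
        moreover have "q l = \<omega> s * N l * sqrt D" using True l' by (simp add: q_def s_def)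
        ultimately show ?thesis using True by (simp add: sq C_def D_def[symmetric] mult_ac)
      qed (simp add: q_def)
      then have "step \<tau> l * (q l * sqrt ((1 + \<kappa>) / s ^ 3))
          \<le> step \<tau> l * (if l < m then C * (\<omega> s * s powr (-3/2) * (L2_norm \<Omega> (g l) + L2_norm \<Omega> (U l))) else 0)"
        using k[of l] l' by (intro mult_left_mono) (auto simp: I_def)
      then show ?thesis unfolding s(3) s_def[symmetric] by (simp add: distrib_left mult_ac split: if_splits)
    qed
    then have "sqrt (ip \<gamma> \<gamma>) \<le> (\<Sum>l=1..m. step \<tau> l * L2_norm \<Omega> (F l) / (\<tau> m - \<tau> (l - 1)) + (if l < m then C * (step \<tau> l *
            (\<omega> (\<tau> m - \<tau> (l - 1)) * (\<tau> m - \<tau> (l - 1)) powr (-3/2)) * (L2_norm \<Omega> (g l) + L2_norm \<Omega> (U l))) else 0))"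
      by (intro order_trans[OF \<gamma>le] sum_mono)
    also have "\<dots> = X"
      unfolding X_def sum.distrib using sum_if_le(2)[of m m] mI by (simp add: sum_distrib_left)
    finally show ?thesis .
  qed
  define x \<phi> where "x = L2_norm \<Omega> (g m)" and "\<phi> = L2_norm \<Omega> (F m)"
  have nn: "0 \<le> x" "0 \<le> \<phi>" "0 \<le> X"
    using \<gamma>X semi_inner_nonneg[OF ip, of \<gamma>] by (auto simp: x_def \<phi>_def intro: order_trans[OF real_sqrt_ge_zero])
  have x2: "x * x \<le> x * \<phi> + X * (\<phi> + x)"
  proof -
    \<comment> \<open>Coefficients of the difference quotient, which equals \<open>F m - g m\<close>.\<close>
    define \<delta> where "\<delta> = (1 / step \<tau> m) *\<^sub>R (e m - e (m - 1))"
    have \<delta>W: "\<delta> \<in> Wsp" unfolding \<delta>_def using eW by (auto simp: Wsp_def intro!: span_scale span_diff)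
    have m1: "m - 1 \<le> M" using mI by simp
    have comb\<delta>: "comb \<delta> = (\<lambda>x. (U m x - U (m - 1) x) / step \<tau> m)"
    proof
      fix y
      have "comb \<delta> y = (1 / step \<tau> m) * (comb (e m) y - comb (e (m - 1)) y)"
        unfolding comb_def \<delta>_def by (simp add: scaleR_fun_def sum_distrib_left sum_subtractf algebra_simps)
      then show "comb \<delta> y = (U m y - U (m - 1) y) / step \<tau> m" unfolding comb_e[OF mI(3)] comb_e[OF m1] by simp
    qed
    have gF: "g m = (\<lambda>x. F m x - comb \<delta> x)" unfolding g_def comb\<delta> ..
    have "x * x = L2_inner \<Omega> (g m) (g m)" using L2_norm_power2[of \<Omega> "g m"] by (simp add: x_def power2_eq_square)
    also have "\<dots> = L2_inner \<Omega> (g m) (F m) - L2_inner \<Omega> (g m) (comb \<delta>)"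
      using L2_inner_diff_right[OF F[OF m] comb2[of \<delta>] g2[OF m]] by (simp add: gF)
    also have "L2_inner \<Omega> (g m) (comb \<delta>) = ip \<gamma> \<delta>" using \<gamma>[OF \<delta>W] am_rep[OF mI(1)] by simp
    finally have 1: "x * x \<le> x * \<phi> + \<bar>ip \<gamma> \<delta>\<bar>"
      using L2_Cauchy_Schwarz[OF g2[OF m] F[OF m]] by (simp add: x_def \<phi>_def abs_if split: if_splits)
    have "comb \<delta> = (\<lambda>x. F m x - g m x)" by (simp add: gF)
    then have "L2_norm \<Omega> (comb \<delta>) \<le> \<phi> + x"
      using L2_norm_triangle[OF F[OF m] g2[OF m]] by (simp add: x_def \<phi>_def)
    then have "sqrt (ip \<gamma> \<gamma>) * sqrt (ip \<delta> \<delta>) \<le> X * (\<phi> + x)"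
      using \<gamma>X nn semi_inner_nonneg[OF ip, of \<delta>] unfolding ip_norm[of \<delta>] by (intro mult_mono) auto
    with 1 semi_inner_Cauchy_Schwarz_sqrt[OF ip, of \<gamma> \<delta>] show ?thesis by linarith
  qed
  have "x \<le> 2 * (X + \<phi>)"
  proof (rule ccontr)
    assume "\<not> ?thesis"
    then have big: "2 * (X + \<phi>) < x" by simp
    then have "2 * (X + \<phi>) * x \<le> x * x" using nn by (intro mult_right_mono) auto
    then have "(X + \<phi>) * x \<le> X * \<phi>" using x2 by (simp add: algebra_simps)
    moreover have "X * \<phi> \<le> (X + \<phi>) * (X + \<phi>)" using nn by (simp add: algebra_simps)
    moreover have "(X + \<phi>) * (X + \<phi>) \<le> (X + \<phi>) * x" using nn big by (intro mult_left_mono) auto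
    ultimately have "(X + \<phi>) * (X + \<phi>) = X * \<phi>" by linarith
    then have "X * X + X * \<phi> + \<phi> * \<phi> = 0" by (simp add: algebra_simps)
    then have "X = 0" "\<phi> = 0" using nn by (auto simp: add_nonneg_eq_0_iff)
    then show False using x2 big by (simp add: mult_le_0_iff)
  qed
  then show "L2_norm \<Omega> (g m) \<le> 2 * ((\<Sum>l=1..m. step \<tau> l * L2_norm \<Omega> (F l) / (\<tau> m - \<tau> (l - 1)))
      + C * (\<Sum>l\<in>{1..<m}. step \<tau> l * (\<omega> (\<tau> m - \<tau> (l - 1)) * (\<tau> m - \<tau> (l - 1)) powr (-3/2))
               * (L2_norm \<Omega> (g l) + L2_norm \<Omega> (U l))) + L2_norm \<Omega> (F m))"
    by (simp add: x_def \<phi>_def X_def)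
qed

section \<open>The main estimate\<close>

lemma sum_cells_le:
  fixes \<phi> :: "real \<Rightarrow> real"
  assumes mesh: "\<forall>m\<in>{1..M}. \<tau> (m - 1) < \<tau> m" and i: "integrable (lebesgue_on {0<..<T}) \<phi>" and pos: "\<And>t. 0 \<le> \<phi> t"
  shows "(\<Sum>m=1..M. \<integral>t. indicator (cell \<tau> m) t * \<phi> t \<partial>lebesgue_on {0<..<T}) \<le> (\<integral>t. \<phi> t \<partial>lebesgue_on {0<..<T})"
proof -
  let ?J = "lebesgue_on {0<..<T}"
  have ii: "integrable ?J (\<lambda>t. indicator (cell \<tau> m) t * \<phi> t)" for m
  proof -
    have "cell \<tau> m \<inter> {0<..<T} \<in> sets ?J" by (auto simp: sets_restrict_space_iff cell_def)
    from integrable_mult_indicator[OF this i]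
    have "integrable ?J (\<lambda>t. indicator (cell \<tau> m \<inter> {0<..<T}) t *\<^sub>R \<phi> t)" .
    then show ?thesis
      by (rule Bochner_Integration.integrable_cong[THEN iffD1, OF refl, rotated])
        (auto simp: indicator_def space_restrict_space)
  qed
  have one: "(\<Sum>m=1..M. indicator (cell \<tau> m) t) \<le> (1::real)" for t
  proof (cases "\<exists>m\<in>{1..M}. t \<in> cell \<tau> m")
    case True
    then obtain n where n: "n \<in> {1..M}" "t \<in> cell \<tau> n" by blast
    have "(\<Sum>m=1..M. indicator (cell \<tau> m) t) = (\<Sum>m=1..M. if m = n then 1 else (0::real))"
    proof (intro sum.cong refl)
      fix m assume m: "m \<in> {1..M}"
      have "t \<notin> cell \<tau> m" if "m \<noteq> n" using cell_disjoint[OF mesh m n(1) _ n(2)] that by blast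
      then show "indicator (cell \<tau> m) t = (if m = n then 1 else (0::real))" using n(2) by (simp add: indicator_def)
    qed
    then show ?thesis using n by simp
  next
    case False
    then have "(\<Sum>m=1..M. indicator (cell \<tau> m) t) = (0::real)" by (intro sum.neutral) auto
    then show ?thesis by simp
  qed
  have "(\<Sum>m=1..M. \<integral>t. indicator (cell \<tau> m) t * \<phi> t \<partial>?J) = (\<integral>t. (\<Sum>m=1..M. indicator (cell \<tau> m) t * \<phi> t) \<partial>?J)"
    by (rule Bochner_Integration.integral_sum[symmetric]) (rule ii)
  also have "\<dots> \<le> (\<integral>t. \<phi> t \<partial>?J)"
  proof (rule integral_mono[OF Bochner_Integration.integrable_sum[OF ii] i])
    fix t
    have "(\<Sum>m=1..M. indicator (cell \<tau> m) t) * \<phi> t \<le> 1 * \<phi> t" using one pos by (intro mult_right_mono)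
    then show "(\<Sum>m=1..M. indicator (cell \<tau> m) t * \<phi> t) \<le> \<phi> t" by (simp add: sum_distrib_right)
  qed
  finally show ?thesis .
qed

lemma represents_L2_rep:
  assumes \<Omega>: "bounded \<Omega>" "open \<Omega>" and g: "represents_L2 \<Omega> F g"
  shows "L2_norm \<Omega> (L2_rep \<Omega> F) = L2_norm \<Omega> g"
proof -
  have r: "represents_L2 \<Omega> F (L2_rep \<Omega> F)" unfolding L2_rep_def using someI[of "represents_L2 \<Omega> F" g] g by simp
  have m: "L2_rep \<Omega> F \<in> L2 \<Omega>" "g \<in> L2 \<Omega>" using r g by (auto simp: represents_L2_def)
  have ae: "AE x in lebesgue_on \<Omega>. L2_rep \<Omega> F x = g x" by (rule represents_L2_unique[OF \<Omega> r g])
  have "L2_inner \<Omega> (L2_rep \<Omega> F) (L2_rep \<Omega> F) = L2_inner \<Omega> g (L2_rep \<Omega> F)"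
    by (rule L2_inner_cong_AE[OF m m(1) ae])
  also have "\<dots> = L2_inner \<Omega> (L2_rep \<Omega> F) g" by (rule L2_inner_sym)
  also have "\<dots> = L2_inner \<Omega> g g" by (rule L2_inner_cong_AE[OF m m(2) ae])
  finally show ?thesis by (simp add: L2_norm_def)
qed

lemma Lp_L2_norm_constant:
  assumes k: "0 < step \<tau> m" and p: "1 \<le> p"
  shows "Lp_L2_norm p (cell \<tau> m) \<Omega> (\<lambda>t. g) powr p = step \<tau> m * L2_norm \<Omega> g powr p"
proof -
  have "(\<integral>t. L2_norm \<Omega> g powr p \<partial>lebesgue_on (cell \<tau> m)) = step \<tau> m * L2_norm \<Omega> g powr p"
    using measure_lebesgue_on_cell[OF k] by simp
  then show ?thesis using k p by (simp add: Lp_L2_norm_def powr_powr)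
qed

theorem corollary3p14:
  fixes \<Omega> :: "(real ^ 'n) set"
    and T \<alpha> c \<beta> \<kappa> :: real
    and a :: "'n \<Rightarrow> 'n \<Rightarrow> real \<Rightarrow> real ^ 'n \<Rightarrow> real"
    and \<omega> :: "real \<Rightarrow> real"
  assumes "bounded_lipschitz_domain \<Omega>"
    and "T > 0"
    and "\<alpha> > 0"
    and "admissible_modulus T \<omega>"
    and "admissible_coefficients \<Omega> T a \<alpha> \<omega>"
    and "c > 0" and "\<beta> > 0" and "\<kappa> > 0"
  shows "\<exists>\<mu>>0. \<exists>\<delta>0>0. \<exists>C>0.
    \<forall>(\<tau> :: nat \<Rightarrow> real) (M :: nat).
      admissible_mesh T c \<beta> \<kappa> \<tau> M \<longrightarrow> max_step \<tau> M - min_step \<tau> M \<le> \<delta>0 \<longrightarrow>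
      (\<forall>p f u. 1 \<le> p \<longrightarrow> f \<in> Lp_L2 p {0<..<T} \<Omega> \<longrightarrow> dG0_solution \<Omega> T a \<tau> M f (\<lambda>x. 0) u \<longrightarrow>
        (\<forall>m \<in> {1..M}. functional_in_L2 \<Omega> (avg_A \<Omega> a \<tau> m (val \<tau> u m))) \<and>
        (\<Sum>m=1..M.
            (Lp_L2_norm p (cell \<tau> m) \<Omega> (\<lambda>t. L2_rep \<Omega> (avg_A \<Omega> a \<tau> m (val \<tau> u m)))) powr p
            + step \<tau> m *
              (L2_norm \<Omega> (\<lambda>x. jump \<tau> (\<lambda>x. 0) u (m - 1) x / step \<tau> m)) powr p) powr (1 / p)
        \<le> C * exp (\<mu> * T) * ln (T / max_step \<tau> M) * Lp_L2_norm p {0<..<T} \<Omega> f)"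
proof -
  have \<Omega>: "bounded \<Omega>" "open \<Omega>" using assms(1) by (auto simp: bounded_lipschitz_domain_def)
  note T = \<open>T > 0\<close> and \<alpha> = \<open>\<alpha> > 0\<close> and \<kappa> = \<open>\<kappa> > 0\<close>
  obtain B where ell: "\<And>t. t \<in> {0..T} \<Longrightarrow> elliptic_at \<Omega> a \<alpha> B t"
    using coefficients_at_every_time[OF \<Omega>(2) T assms(5)] unfolding elliptic_at_def by blast
  have cont: "\<And>i j. AE x in lebesgue_on \<Omega>. continuous_on {0..T} (\<lambda>t. a i j t x)"
    and w: "\<And>i j t s. t \<in> {0..T} \<Longrightarrow> s \<in> {0..T} \<Longrightarrow> AE x in lebesgue_on \<Omega>. \<bar>a i j t x - a i j s x\<bar> \<le> \<omega> \<bar>t - s\<bar>"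
    using assms(5) by (auto simp: admissible_coefficients_def)
  have \<omega>: "\<And>t. t \<in> {0..T} \<Longrightarrow> 0 \<le> \<omega> t" "mono_on {0..T} \<omega>"
    and \<omega>a: "antimono_on {0<..T} (\<lambda>t. \<omega> t / t powr (3/2))"
    and \<omega>i: "integrable (lebesgue_on {0<..<T}) (\<lambda>t. \<omega> t * t powr (-3/2))"
    using assms(4) unfolding admissible_modulus_def by blast+
  define h where "h s = \<omega> s * s powr (-3/2)" for s
  have h: "antimono_on {0<..T} h" "set_integrable lebesgue {0<..<T} h" "\<And>s. s \<in> {0<..T} \<Longrightarrow> 0 \<le> h s"
  proof -
    have "h = (\<lambda>t. \<omega> t / t powr (3/2))"
    proof
      show "h t = \<omega> t / t powr (3/2)" for t using powr_minus_divide[of t "3/2"] by (simp add: h_def)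
    qed
    then show "antimono_on {0<..T} h" using \<omega>a by simp
    show "set_integrable lebesgue {0<..<T} h"
      using \<omega>i unfolding h_def set_integrable_def by (simp add: integrable_restrict_space)
    show "0 \<le> h s" if "s \<in> {0<..T}" for s using \<omega>(1)[of s] that by (simp add: h_def)
  qed
  define C1 where "C1 = real CARD('n) / \<alpha> * sqrt (1 + \<kappa>)"
  have C1: "0 < C1" using \<alpha> \<kappa> by (simp add: C1_def)
  obtain \<mu> C0 where \<mu>: "\<mu> > 0" and C0: "C0 > 0" and
    kernel: "\<And>\<tau> M p \<phi> Y. admissible_mesh T c \<beta> \<kappa> \<tau> M \<Longrightarrow> 1 \<le> p \<Longrightarrow>
    (\<forall>m\<in>{1..M}. 0 \<le> \<phi> m \<and> 0 \<le> Y m \<and>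
       Y m \<le> (5 + T) * (\<Sum>l=1..m. step \<tau> l * \<phi> l / (\<tau> m - \<tau> (l - 1)))
            + (2 * C1) * (\<Sum>l\<in>{1..<m}. step \<tau> l * h (\<tau> m - \<tau> (l - 1)) * Y l)) \<Longrightarrow>
    (\<Sum>m=1..M. step \<tau> m * Y m powr p)
      \<le> (C0 * exp (\<mu> * T) * ln (T / max_step \<tau> M)) powr p * (\<Sum>m=1..M. step \<tau> m * \<phi> m powr p)"
  proof -
    have "0 < 5 + T" "0 < 2 * C1" using T C1 by auto
    from log_kernel_estimate[OF T h assms(6,7) \<kappa> this] show ?thesis using that by blast
  qed
  have main: "(\<forall>m \<in> {1..M}. functional_in_L2 \<Omega> (avg_A \<Omega> a \<tau> m (val \<tau> u m))) \<and>
        (\<Sum>m=1..M.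
            (Lp_L2_norm p (cell \<tau> m) \<Omega> (\<lambda>t. L2_rep \<Omega> (avg_A \<Omega> a \<tau> m (val \<tau> u m)))) powr p
            + step \<tau> m *
              (L2_norm \<Omega> (\<lambda>x. jump \<tau> (\<lambda>x. 0) u (m - 1) x / step \<tau> m)) powr p) powr (1 / p)
        \<le> (2 * C0) * exp (\<mu> * T) * ln (T / max_step \<tau> M) * Lp_L2_norm p {0<..<T} \<Omega> f"
    if adm: "admissible_mesh T c \<beta> \<kappa> \<tau> M" and p: "1 \<le> p" and f: "f \<in> Lp_L2 p {0<..<T} \<Omega>"
      and dG: "dG0_solution \<Omega> T a \<tau> M f (\<lambda>x. 0) u" for \<tau> M p f u
  proof -
    have mesh: "\<tau> 0 = 0" "\<tau> M = T" "\<forall>m\<in>{1..M}. \<tau> (m - 1) < \<tau> m" and mx: "max_step \<tau> M \<le> T / 4" and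
      rat: "\<forall>m \<in> {1..M - 1}. 1 / \<kappa> \<le> step \<tau> m / step \<tau> (m + 1) \<and> step \<tau> m / step \<tau> (m + 1) \<le> \<kappa>"
      using adm by (auto simp: admissible_mesh_def)
    note mono = mesh_mono[OF mesh(3)] and smono = mesh_strict_mono[OF mesh(3)]
    have k: "0 < step \<tau> m" if "m \<in> {1..M}" for m using mesh(3) that by (simp add: step_def)
    define U where "U m = (if m = 0 then (\<lambda>x. 0) else val \<tau> u m)" for m
    have U: "U l \<in> H10 \<Omega>" if l: "l \<in> {1..M}" for l
    proof -
      obtain v where "v \<in> H10 \<Omega>" "\<forall>t\<in>cell \<tau> l. u t = v"
        using dG l unfolding dG0_solution_def X0_def by blast
      moreover have "\<tau> l \<in> cell \<tau> l" using mesh(3) l by (simp add: cell_def)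
      ultimately show ?thesis using l by (simp add: U_def val_def)
    qed
    have U0: "U 0 = (\<lambda>x. 0)" by (simp add: U_def)
    obtain F where F: "\<And>m. m \<in> {1..M} \<Longrightarrow> F m \<in> L2 \<Omega>"
      and eq: "\<And>m v. m \<in> {1..M} \<Longrightarrow> v \<in> H10 \<Omega> \<Longrightarrow>
        L2_inner \<Omega> (\<lambda>x. U m x - U (m - 1) x) v + step \<tau> m * avg_A \<Omega> a \<tau> m (U m) v = step \<tau> m * L2_inner \<Omega> (F m) v"
      and normF: "\<And>m. m \<in> {1..M} \<Longrightarrow> step \<tau> m * L2_norm \<Omega> (F m) powr p
        \<le> (\<integral>t. indicator (cell \<tau> m) t * L2_norm \<Omega> (f t) powr p \<partial>lebesgue_on {0<..<T})"
      using dG0_cell_equations[OF \<Omega> mesh p f dG] unfolding U_def[symmetric] by blast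
    define g where "g = (\<lambda>l x. F l x - (U l x - U (l - 1) x) / step \<tau> l)"
    have est: "represents_L2 \<Omega> (avg_A \<Omega> a \<tau> m (U m)) (g m)"
      "L2_norm \<Omega> (U m) \<le> (\<Sum>l=1..m. step \<tau> l * L2_norm \<Omega> (F l))"
      "L2_norm \<Omega> (g m) \<le> 2 * ((\<Sum>l=1..m. step \<tau> l * L2_norm \<Omega> (F l) / (\<tau> m - \<tau> (l - 1)))
        + C1 * (\<Sum>l\<in>{1..<m}. step \<tau> l * h (\<tau> m - \<tau> (l - 1)) * (L2_norm \<Omega> (g l) + L2_norm \<Omega> (U l)))
        + L2_norm \<Omega> (F m))"
      if m: "m \<in> {1..M}" for m
      unfolding g_def C1_def h_def
      by (rule discrete_solution_estimate[where \<alpha> = \<alpha> and \<kappa> = \<kappa> and \<tau> = \<tau> and M = M and T = T and B = B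
            and \<omega> = \<omega> and a = a and U = U and F = F];
          fact \<Omega> \<alpha> \<kappa> mesh rat ell cont w \<omega> U U0 F eq m)+
    define b where "b m = (\<Sum>l=1..m. step \<tau> l * L2_norm \<Omega> (F l) / (\<tau> m - \<tau> (l - 1)))" for m
    have tpos: "0 < \<tau> m - \<tau> (l - 1)" "\<tau> m - \<tau> (l - 1) \<le> T" if "l \<in> {1..m}" "m \<in> {1..M}" for l m
    proof -
      have 1: "l - 1 < m" "m \<le> M" "l - 1 \<le> M" using that by auto
      show "0 < \<tau> m - \<tau> (l - 1)" using smono[OF 1(1,2)] by linarith
      have "0 \<le> \<tau> (l - 1)" using mono[of 0 "l - 1"] 1 mesh(1) by simp
      then show "\<tau> m - \<tau> (l - 1) \<le> T" using mono[of m M] 1 mesh(2) by simp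
    qed
    have b_term: "0 \<le> step \<tau> l * L2_norm \<Omega> (F l) / (\<tau> m - \<tau> (l - 1))" if "l \<in> {1..m}" "m \<in> {1..M}" for l m
      using tpos[OF that] k[of l] that by (intro divide_nonneg_pos mult_nonneg_nonneg) auto
    have b0: "0 \<le> b m" if "m \<in> {1..M}" for m unfolding b_def using b_term that by (intro sum_nonneg) auto
    have Fb: "L2_norm \<Omega> (F m) \<le> b m" if m: "m \<in> {1..M}" for m
    proof -
      have "step \<tau> m * L2_norm \<Omega> (F m) / (\<tau> m - \<tau> (m - 1)) \<le> b m"
        unfolding b_def by (rule member_le_sum) (use m b_term in auto)
      then show ?thesis using k[OF m] by (simp add: step_def)
    qed
    have Ub: "L2_norm \<Omega> (U m) \<le> T * b m" if m: "m \<in> {1..M}" for m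
    proof -
      have "step \<tau> l * L2_norm \<Omega> (F l) \<le> T * (step \<tau> l * L2_norm \<Omega> (F l) / (\<tau> m - \<tau> (l - 1)))" if l: "l \<in> {1..m}" for l
      proof -
        have "(\<tau> m - \<tau> (l - 1)) * (step \<tau> l * L2_norm \<Omega> (F l) / (\<tau> m - \<tau> (l - 1)))
            \<le> T * (step \<tau> l * L2_norm \<Omega> (F l) / (\<tau> m - \<tau> (l - 1)))"
          by (rule mult_right_mono[OF tpos(2)[OF l m] b_term[OF l m]])
        then show ?thesis using tpos(1)[OF l m] by simp
      qed
      then have "(\<Sum>l=1..m. step \<tau> l * L2_norm \<Omega> (F l)) \<le> T * b m"
        unfolding b_def sum_distrib_left by (intro sum_mono)
      then show ?thesis using est(2)[OF m] by linarith
    qed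
    \<comment> \<open>The sum \<open>Y\<close> bounds all quantities at level \<open>m\<close>. Besides the kernel term, \<open>g m\<close> contributes \<open>4 b m\<close>, \<open>U m\<close>
      contributes \<open>T * b m\<close>, and \<open>b m\<close> counts once: this is the constant \<open>5 + T\<close>.\<close>
    define Y where "Y m = L2_norm \<Omega> (g m) + L2_norm \<Omega> (U m) + b m" for m
    have Y: "0 \<le> L2_norm \<Omega> (F m) \<and> 0 \<le> Y m \<and> Y m \<le> (5 + T) * (\<Sum>l=1..m. step \<tau> l * L2_norm \<Omega> (F l) / (\<tau> m - \<tau> (l - 1)))
            + (2 * C1) * (\<Sum>l\<in>{1..<m}. step \<tau> l * h (\<tau> m - \<tau> (l - 1)) * Y l)" if m: "m \<in> {1..M}" for m
    proof -
      have "(\<Sum>l\<in>{1..<m}. step \<tau> l * h (\<tau> m - \<tau> (l - 1)) * (L2_norm \<Omega> (g l) + L2_norm \<Omega> (U l)))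
          \<le> (\<Sum>l\<in>{1..<m}. step \<tau> l * h (\<tau> m - \<tau> (l - 1)) * Y l)"
      proof (intro sum_mono mult_left_mono)
        fix l assume l: "l \<in> {1..<m}"
        then have lM: "l \<in> {1..M}" "l \<in> {1..m}" using m by auto
        show "L2_norm \<Omega> (g l) + L2_norm \<Omega> (U l) \<le> Y l" using b0[OF lM(1)] by (simp add: Y_def)
        show "0 \<le> step \<tau> l * h (\<tau> m - \<tau> (l - 1))"
          using k[OF lM(1)] h(3) tpos[OF lM(2) m] by simp
      qed
      then have C1_le: "C1 * (\<Sum>l\<in>{1..<m}. step \<tau> l * h (\<tau> m - \<tau> (l - 1)) * (L2_norm \<Omega> (g l) + L2_norm \<Omega> (U l)))
          \<le> C1 * (\<Sum>l\<in>{1..<m}. step \<tau> l * h (\<tau> m - \<tau> (l - 1)) * Y l)"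
        using C1 by (intro mult_left_mono) auto
      have "L2_norm \<Omega> (g m) \<le> 2 * (b m + C1 * (\<Sum>l\<in>{1..<m}. step \<tau> l * h (\<tau> m - \<tau> (l - 1)) * Y l) + b m)"
      proof -
        have "2 * (b m + C1 * (\<Sum>l\<in>{1..<m}. step \<tau> l * h (\<tau> m - \<tau> (l - 1)) * (L2_norm \<Omega> (g l) + L2_norm \<Omega> (U l)))
            + L2_norm \<Omega> (F m)) \<le> 2 * (b m + C1 * (\<Sum>l\<in>{1..<m}. step \<tau> l * h (\<tau> m - \<tau> (l - 1)) * Y l) + b m)"
          by (intro mult_left_mono add_mono order_refl C1_le Fb[OF m]) simp
        with est(3)[OF m, folded b_def] show ?thesis by (rule order_trans)
      qed
      then have "Y m \<le> (5 + T) * b m + (2 * C1) * (\<Sum>l\<in>{1..<m}. step \<tau> l * h (\<tau> m - \<tau> (l - 1)) * Y l)"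
        using Ub[OF m] by (simp add: Y_def algebra_simps)
      moreover have "0 \<le> Y m" using b0[OF m] by (simp add: Y_def)
      ultimately show ?thesis unfolding b_def[symmetric] using L2_norm_nonneg[of \<Omega> "F m"] by blast
    qed
    have Ysum: "(\<Sum>m=1..M. step \<tau> m * Y m powr p)
      \<le> (C0 * exp (\<mu> * T) * ln (T / max_step \<tau> M)) powr p * (\<Sum>m=1..M. step \<tau> m * L2_norm \<Omega> (F m) powr p)"
      by (rule kernel[OF adm p]) (use Y in blast)
    have rep: "represents_L2 \<Omega> (avg_A \<Omega> a \<tau> m (val \<tau> u m)) (g m)" if m: "m \<in> {1..M}" for m
      using est(1)[OF m] m by (simp add: U_def)
    have deriv: "L2_norm \<Omega> (\<lambda>x. jump \<tau> (\<lambda>x. 0) u (m - 1) x / step \<tau> m) \<le> Y m" if m: "m \<in> {1..M}" for m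
    proof -
      have "jump \<tau> (\<lambda>x. 0) u (m - 1) = (\<lambda>x. U m x - U (m - 1) x)"
        using m by (cases "m = 1") (auto simp: jump_def U_def fun_eq_iff)
      then have "(\<lambda>x. jump \<tau> (\<lambda>x. 0) u (m - 1) x / step \<tau> m) = (\<lambda>x. F m x - g m x)" by (simp add: g_def)
      moreover have "L2_norm \<Omega> (\<lambda>x. F m x - g m x) \<le> L2_norm \<Omega> (F m) + L2_norm \<Omega> (g m)"
        using rep[OF m] by (intro L2_norm_triangle F m) (simp add: represents_L2_def)
      ultimately have "L2_norm \<Omega> (\<lambda>x. jump \<tau> (\<lambda>x. 0) u (m - 1) x / step \<tau> m)
          \<le> L2_norm \<Omega> (F m) + L2_norm \<Omega> (g m)" by simp
      then show ?thesis using Fb[OF m] L2_norm_nonneg[of \<Omega> "U m"] unfolding Y_def by linarith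
    qed
    define Z where "Z = C0 * exp (\<mu> * T) * ln (T / max_step \<tau> M)"
    define \<Phi> where "\<Phi> = (\<integral>t. L2_norm \<Omega> (f t) powr p \<partial>lebesgue_on {0<..<T})"
    have \<Phi>0: "0 \<le> \<Phi>" unfolding \<Phi>_def by (rule integral_nonneg_AE) simp
    have Z0: "0 \<le> Z"
    proof -
      have M: "1 \<le> M" using mesh(1,2) T by (cases M) auto
      have "step \<tau> 1 \<le> max_step \<tau> M" unfolding max_step_def using M by (intro Max_ge) auto
      then have "0 < max_step \<tau> M" using k[of 1] M by auto
      then have "1 \<le> T / max_step \<tau> M" using mx T by simp
      then show ?thesis unfolding Z_def using C0 by simp
    qed
    have "(\<Sum>m=1..M. step \<tau> m * L2_norm \<Omega> (F m) powr p)
        \<le> (\<Sum>m=1..M. \<integral>t. indicator (cell \<tau> m) t * L2_norm \<Omega> (f t) powr p \<partial>lebesgue_on {0<..<T})"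
      by (intro sum_mono normF)
    also have "\<dots> \<le> \<Phi>"
      unfolding \<Phi>_def by (rule sum_cells_le[OF mesh(3)]) (use f in \<open>auto simp: Lp_L2_def\<close>)
    finally have F\<Phi>: "(\<Sum>m=1..M. step \<tau> m * L2_norm \<Omega> (F m) powr p) \<le> \<Phi>" .
    define S where "S = (\<Sum>m=1..M.
            (Lp_L2_norm p (cell \<tau> m) \<Omega> (\<lambda>t. L2_rep \<Omega> (avg_A \<Omega> a \<tau> m (val \<tau> u m)))) powr p
            + step \<tau> m * (L2_norm \<Omega> (\<lambda>x. jump \<tau> (\<lambda>x. 0) u (m - 1) x / step \<tau> m)) powr p)"
    have "S \<le> (\<Sum>m=1..M. 2 * (step \<tau> m * Y m powr p))"
      unfolding S_def
    proof (rule sum_mono)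
      fix m assume m: "m \<in> {1..M}"
      have "L2_norm \<Omega> (g m) \<le> Y m" using b0[OF m] L2_norm_nonneg[of \<Omega> "U m"] unfolding Y_def by linarith
      then have "L2_norm \<Omega> (g m) powr p \<le> Y m powr p" using p by (intro powr_mono2) auto
      moreover have "L2_norm \<Omega> (\<lambda>x. jump \<tau> (\<lambda>x. 0) u (m - 1) x / step \<tau> m) powr p \<le> Y m powr p"
        using deriv[OF m] p by (intro powr_mono2) auto
      ultimately have "step \<tau> m * L2_norm \<Omega> (g m) powr p
          + step \<tau> m * L2_norm \<Omega> (\<lambda>x. jump \<tau> (\<lambda>x. 0) u (m - 1) x / step \<tau> m) powr p
          \<le> step \<tau> m * Y m powr p + step \<tau> m * Y m powr p"
        using k[OF m] by (intro add_mono mult_left_mono) auto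
      then show "(Lp_L2_norm p (cell \<tau> m) \<Omega> (\<lambda>t. L2_rep \<Omega> (avg_A \<Omega> a \<tau> m (val \<tau> u m)))) powr p
            + step \<tau> m * (L2_norm \<Omega> (\<lambda>x. jump \<tau> (\<lambda>x. 0) u (m - 1) x / step \<tau> m)) powr p
          \<le> 2 * (step \<tau> m * Y m powr p)"
        unfolding Lp_L2_norm_constant[OF k[OF m] p] represents_L2_rep[OF \<Omega> rep[OF m]] by linarith
    qed
    also have "\<dots> = 2 * (\<Sum>m=1..M. step \<tau> m * Y m powr p)" by (simp add: sum_distrib_left)
    also have "\<dots> \<le> 2 * (Z powr p * \<Phi>)"
    proof (rule mult_left_mono)
      have "Z powr p * (\<Sum>m=1..M. step \<tau> m * L2_norm \<Omega> (F m) powr p) \<le> Z powr p * \<Phi>"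
        by (rule mult_left_mono[OF F\<Phi>]) simp
      then show "(\<Sum>m=1..M. step \<tau> m * Y m powr p) \<le> Z powr p * \<Phi>" using Ysum unfolding Z_def[symmetric] by linarith
    qed simp
    finally have S_le: "S \<le> 2 * (Z powr p * \<Phi>)" .
    have S0: "0 \<le> S" unfolding S_def using k by (intro sum_nonneg add_nonneg_nonneg mult_nonneg_nonneg) (auto intro: less_imp_le)
    have "S powr (1 / p) \<le> (2 * (Z powr p * \<Phi>)) powr (1 / p)"
      using S_le S0 p by (intro powr_mono2) auto
    also have "\<dots> = 2 powr (1 / p) * (Z * \<Phi> powr (1 / p))"
      using \<Phi>0 Z0 p by (simp add: powr_mult powr_powr)
    also have "\<dots> \<le> 2 powr 1 * (Z * \<Phi> powr (1 / p))"
      using Z0 p by (intro mult_right_mono powr_mono mult_nonneg_nonneg) auto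
    also have "\<dots> = 2 * C0 * exp (\<mu> * T) * ln (T / max_step \<tau> M) * Lp_L2_norm p {0<..<T} \<Omega> f"
      by (simp add: Z_def \<Phi>_def Lp_L2_norm_def)
    finally have "S powr (1 / p) \<le> 2 * C0 * exp (\<mu> * T) * ln (T / max_step \<tau> M) * Lp_L2_norm p {0<..<T} \<Omega> f" .
    moreover have "\<forall>m\<in>{1..M}. functional_in_L2 \<Omega> (avg_A \<Omega> a \<tau> m (val \<tau> u m))"
      using rep unfolding functional_in_L2_def by blast
    ultimately show ?thesis unfolding S_def by blast
  qed
  show ?thesis
  proof (intro exI conjI allI impI)
    show "\<mu> > 0" "(1::real) > 0" "2 * C0 > 0" using \<mu> C0 by auto
  qed (use main in blast)+
qed

end
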